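(* Let $E\subset\mathbb{C}$ be an infinite compact set such that $\overline{\mathbb{C}}\setminus E$ is simply connected, let $\mathbf{F}=(F_1,\ldots,F_d)\in\mathcal{H}(E)^d$, let $\mu\in\mathbf{Reg}_{1,2}(E)$, and let $\mathbf{m}=(m_1,\ldots,m_d)\in\mathbb{N}^d$ be a fixed multi-index with $|\mathbf{m}|=m_1+\cdots+m_d$. Suppose that $\mathbf{F}$ has exactly $|\mathbf{m}|$ system poles with respect to $\mathbf{m}$, counting multiplicities. Then the (monic) denominators $Q_{n,|\mathbf{m}|}^{\mu}$ of the orthogonal Hermite-Padé approximants are uniquely determined for all sufficiently large $n$ and $$\limsup_{n\to\infty}\|Q_{n,|\mathbf{m}|}^{\mu}-Q_{\mathbf{m}}^{\mathbf{F}}\|^{1/n}=\max\left\{\frac{|\Phi(\xi)|}{\boldsymbol\rho_{\xi}(\mathbf{F},\mathbf{m})}:\xi\in\mathcal{P}(\mathbf{F},\mathbf{m})\right\},$$ where $\|\cdot\|$ denotes the coefficient norm in the space of polynomials. Additionally, for each $i=1,\ldots,d$, each $k=0,\ldots,m_i-1$, and any compact subset $K$ of $D_{i,k}^{*}(\mathbf{F},\mathbf{m})\setminus\mathcal{P}(\mathbf{F},\mathbf{m})$, $$\limsup_{n\to\infty}\left\|\frac{P_{n,\mathbf{m},k,i}^{\mu}}{Q_{n,|\mathbf{m}|}^{\mu}}-z^{k}F_i\right\|_{K}^{1/n}\le\frac{\|\Phi\|_K}{\boldsymbol\rho_{i,k}^{*}(\mathbf{F},\mathbf{m})},$$ where $\|\cdot\|_K$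 denotes the sup-norm on $K$ and, if $K\subset E$, then $\|\Phi\|_K$ is replaced by $1$.
   Context: **Basic notation.** $\mathbb{N}=\{1,2,\ldots\}$. $\mathcal{H}(E)$ is the set of functions holomorphic in some neighborhood of $E$, and $\mathcal{H}(E)^d$ the set of $d$-tuples of such functions. $\mathcal{M}(E)$ is the set of finite positive Borel measures with infinite support contained in $E$. For $\mu\in\mathcal{M}(E)$, $\langle g,h\rangle_\mu=\int g(\zeta)\overline{h(\zeta)}\,d\mu(\zeta)$, and $p_n(z)=\kappa_nz^n+\cdots$, $\kappa_n>0$, $n\ge 0$, is the orthonormal polynomial of degree $n$ with respect to $\mu$, i.e. $\langle p_n,p_k\rangle_\mu=\delta_{n,k}$. The second type functions are $s_n(z)=\int\frac{\overline{p_n(\zeta)}}{z-\zeta}\,d\mu(\zeta)$, $z\in\overline{\mathbb{C}}\setminus\mathrm{supp}(\mu)$. The coefficient norm $\|\cdot\|$ of a polynomial is e.g. the sum of the absolute values of its coefficients. **Conformal map and canonical domains.** $\Phi$ is the unique conformal map of $\overline{\mathbb{C}}\setminus E$ onto $\overline{\mathbb{C}}\setminus\{|w|\le1\}$ with $\Phi(\infty)=\infty$, $\Phi'(\infty)>0$. For $\rho>1$, $D_\rho=E\cup\{z\in\mathbb{C}\setminus E:|\Phi(z)|<\rho\}$ is the canonical domain of index $\rho$ ($D_\infty=\mathbb{C}$). If $K\not\subset E$, $\|\Phi\|_K$ is the supremum of $|\Phi|$ on $K\setminus E$. Quotients with denominator $\infty$ are $0$. **Class of measures.** $\mu\in\mathbf{Reg}_{1,2}(E)$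 means $\mu\in\mathcal{M}(E)$ and both $\lim_{n}|p_n(z)|^{1/n}=|\Phi(z)|$ and $\lim_n|s_n(z)|^{1/n}=|\Phi(z)|^{-1}$ hold uniformly on compact subsets of $\mathbb{C}\setminus E$. **Orthogonal Hermite-Padé approximants.** For $n\in\mathbb{N}$ there exist polynomials $Q_{n,|\mathbf{m}|}^\mu\not\equiv0$ with $\deg Q_{n,|\mathbf{m}|}^\mu\le|\mathbf{m}|$ and $P_{n,\mathbf{m},k,i}^\mu$ with $\deg P_{n,\mathbf{m},k,i}^\mu\le n-1$ ($k=0,\ldots,m_i-1$, $i=1,\ldots,d$) such that $$\langle Q_{n,|\mathbf{m}|}^\mu z^kF_i-P_{n,\mathbf{m},k,i}^\mu,\,p_j\rangle_\mu=0,\qquad j=0,1,\ldots,n,$$ for all such $k,i$. $Q_{n,|\mathbf{m}|}^\mu$ is normalized to have leading coefficient $1$, and (if not unique) one solution is chosen for each $n$; it is called a denominator of an $(n,\mathbf{m})$ orthogonal Hermite-Padé approximant of $\mathbf{F}$ with respect to $\mu$. Given $Q_{n,|\mathbf{m}|}^\mu$, the $P_{n,\mathbf{m},k,i}^\mu$ are unique. **System poles.** A polynomial combination of $\mathbf{F}$ (with respect to $\mathbf{m}$) is a function $\sum_{i=1}^dv_iF_i$ with $v_i$ polynomials, $\deg v_i<m_i$. A point $\xi\in\mathbb{C}\setminus E$ is a system pole of order $\tau$ of $\mathbf{F}$ with respect to $\mathbf{m}$ if $\tau$ is the largest positive integer such that for each $t=1,\ldots,\tau$ there is at least one polynomial combination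 which is (extends to be) holomorphic on a neighborhood of $\overline{D}_{|\Phi(\xi)|}$ except for a pole at $z=\xi$ of exact order $t$. System poles are counted with their order. $Q_{\mathbf{m}}^{\mathbf{F}}$ is the monic polynomial whose zeros are the system poles of $\mathbf{F}$ with respect to $\mathbf{m}$, taking account of their order, and $\mathcal{P}(\mathbf{F},\mathbf{m})$ is the set of its distinct zeros. **Characteristic indices.** For $G\in\mathcal{H}(E)$ and an integer $t\ge0$, $\rho_t(G)\in(1,\infty]$ is the index of the largest canonical domain to which $G$ extends as a meromorphic function with at most $t$ poles counting multiplicities. If $\xi$ is a system pole of order $\tau$ and $1\le t\le\tau$, $\rho_{\xi,t}(\mathbf{F},\mathbf{m})$ is the largest of the numbers $\rho_t(G)$, where $G$ runs over the polynomial combinations that are holomorphic on a neighborhood of $\overline{D}_{|\Phi(\xi)|}$ except for a pole at $\xi$ of order $t$. Set $\boldsymbol\rho_{\xi,t}(\mathbf{F},\mathbf{m})=\min_{k=1,\ldots,t}\rho_{\xi,k}(\mathbf{F},\mathbf{m})$ and $\boldsymbol\rho_\xi(\mathbf{F},\mathbf{m})=\boldsymbol\rho_{\xi,\tau}(\mathbf{F},\mathbf{m})$. For $i\in\{1,\ldots,d\}$, $k\in\{0,\ldots,m_i-1\}$, $D_{i,k}(\mathbf{F},\mathbf{m})$ is the largest canonical domain in which all the poles of $z^kF_i$ are system poles of $\mathbf{F}$ with respect to $\mathbf{m}$, their order as poles of $z^kF_i$ does not exceed their order as system poles, and $z^kF_i$ has no other singularity; $\boldsymbol\rho_{i,k}(\mathbf{F},\mathbf{m})$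 is its index. If $\xi_1,\ldots,\xi_N$ are the poles of $z^kF_i$ in $D_{i,k}(\mathbf{F},\mathbf{m})$ and $\hat\tau_j$ is the order of $\xi_j$ as a pole of $z^kF_i$, then $$\boldsymbol\rho_{i,k}^*(\mathbf{F},\mathbf{m})=\min\Big\{\boldsymbol\rho_{i,k}(\mathbf{F},\mathbf{m}),\ \min_{j=1,\ldots,N}\boldsymbol\rho_{\xi_j,\hat\tau_j}(\mathbf{F},\mathbf{m})\Big\}$$ (the inner minimum is omitted if $N=0$), and $D_{i,k}^*(\mathbf{F},\mathbf{m})$ is the canonical domain with this index. *)

theory Defs
  imports "HOL-Complex_Analysis.Complex_Analysis"
begin

section \<open>The compact set and its exterior conformal map\<close>

text \<open>
  The Riemann sphere is the unit sphere of \<open>complex \<times> real\<close>; finite points are embedded by inverse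
  stereographic projection and the point at infinity is the north pole \<open>(0, 1)\<close>.
\<close>
definition stereo :: "complex \<Rightarrow> complex \<times> real" where
  "stereo z = ((2 / ((norm z)\<^sup>2 + 1)) *\<^sub>R z, ((norm z)\<^sup>2 - 1) / ((norm z)\<^sup>2 + 1))"

lemma stereo_bij_betw: "bij_betw stereo UNIV (sphere 0 1 - {(0, 1)})"
proof -
  have pos: "(norm z)\<^sup>2 + 1 > 0" for z :: complex
    by (metis add_pos_nonneg add.commute zero_less_one zero_le_power2)
  have inv: "(1 / (1 - snd (stereo z))) *\<^sub>R fst (stereo z) = z" for z
  proof -
    have "1 - snd (stereo z) = 2 / ((norm z)\<^sup>2 + 1)"
      using pos[of z] by (simp add: stereo_def field_simps)
    moreover have "fst (stereo z) = (2 / ((norm z)\<^sup>2 + 1)) *\<^sub>R z"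
      by (simp add: stereo_def)
    moreover have "(1 / (2 / ((norm z)\<^sup>2 + 1))) * (2 / ((norm z)\<^sup>2 + 1)) = 1"
      using pos[of z] by simp
    ultimately show ?thesis
      by (metis scaleR_one scaleR_scaleR)
  qed
  have 1: "inj stereo"
    by (metis injI inv)
  have 2: "norm (stereo z) = 1" for z
  proof -
    have "(norm (stereo z))\<^sup>2 = (norm (fst (stereo z)))\<^sup>2 + (snd (stereo z))\<^sup>2"
      by (simp add: norm_prod_def)
    also have "\<dots> = (4 * (norm z)\<^sup>2 + ((norm z)\<^sup>2 - 1)\<^sup>2) / ((norm z)\<^sup>2 + 1)\<^sup>2"
      using pos[of z] by (simp add: stereo_def power_divide power_mult_distrib add_divide_distrib)
    also have "4 * (norm z)\<^sup>2 + ((norm z)\<^sup>2 - 1)\<^sup>2 = ((norm z)\<^sup>2 + 1)\<^sup>2"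
      by (simp add: power2_eq_square algebra_simps)
    finally have "(norm (stereo z))\<^sup>2 = 1" using pos[of z] by simp
    then show ?thesis
      using norm_ge_zero[of "stereo z"] unfolding power2_eq_1_iff by linarith
  qed
  have 3: "stereo z \<noteq> (0, 1)" for z
    using pos[of z] by (simp add: stereo_def field_simps)
  have 4: "x \<in> range stereo" if x: "x \<in> sphere 0 1 - {(0, 1)}" for x
  proof -
    obtain w s where ws: "x = (w, s)" by (cases x)
    have n: "(norm w)\<^sup>2 + s\<^sup>2 = 1" using x by (simp add: ws norm_prod_def)
    have s: "s \<noteq> 1" using x n by (auto simp: ws)
    have "s\<^sup>2 \<le> 1" using n zero_le_power2[of "norm w"] by linarith
    then have s1: "1 - s > 0" using s by (simp add: power2_le_iff_abs_le abs_square_le_1)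
    have nw: "(norm w)\<^sup>2 = (1 - s) * (1 + s)"
      using n by (simp add: power2_eq_square algebra_simps)
    define z where "z = (1 / (1 - s)) *\<^sub>R w"
    have "(norm z)\<^sup>2 = (1 + s) / (1 - s)"
      using s1 by (simp add: z_def power_divide nw) (simp add: power2_eq_square)
    then have "(norm z)\<^sup>2 + 1 = 2 / (1 - s)" and "(norm z)\<^sup>2 - 1 = 2 * s / (1 - s)"
      using s1 by (simp_all add: field_simps)
    then have "stereo z = (w, s)"
      using s1 by (simp add: stereo_def z_def)
    then show ?thesis using ws by (metis rangeI)
  qed
  have "range stereo = sphere 0 1 - {(0, 1)}"
  proof
    show "range stereo \<subseteq> sphere 0 1 - {(0, 1)}"
      using 2 3 by (metis DiffI image_subsetI mem_sphere_0 singletonD)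
  qed (use 4 in blast)
  with 1 show ?thesis
    unfolding bij_betw_def by blast
qed

text \<open>\<open>\<Phi>\<close> is only considered on the complement of \<open>E\<close>; its values on \<open>E\<close> are irrelevant.
  Its derivative at infinity is the limit of \<open>\<Phi> z / z\<close>.\<close>
definition exterior_map :: "complex set \<Rightarrow> (complex \<Rightarrow> complex) \<Rightarrow> bool" where
  "exterior_map E \<Phi> \<longleftrightarrow>
     \<Phi> holomorphic_on (- E) \<and> inj_on \<Phi> (- E) \<and> \<Phi> ` (- E) = {w. 1 < norm w} \<and>
     filterlim \<Phi> at_infinity at_infinity \<and>
     (\<exists>c::real. 0 < c \<and> ((\<lambda>z. \<Phi> z / z) \<longlongrightarrow> of_real c) at_infinity)"

definition canon_dom :: "complex set \<Rightarrow> (complex \<Rightarrow> complex) \<Rightarrow> ereal \<Rightarrow> complex set" where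
  "canon_dom E \<Phi> \<rho> = E \<union> {z. z \<notin> E \<and> ereal (norm (\<Phi> z)) < \<rho>}"

definition Phi_norm :: "complex set \<Rightarrow> (complex \<Rightarrow> complex) \<Rightarrow> complex set \<Rightarrow> ereal" where
  "Phi_norm E \<Phi> K = (if K \<subseteq> E then 1 else (SUP z\<in>K - E. ereal (norm (\<Phi> z))))"


section \<open>Measures and orthonormal polynomials\<close>

definition msupport :: "complex measure \<Rightarrow> complex set" where
  "msupport \<mu> = {z. \<forall>U. open U \<and> z \<in> U \<longrightarrow> 0 < emeasure \<mu> U}"

definition admissible_measure :: "complex set \<Rightarrow> complex measure \<Rightarrow> bool" where
  "admissible_measure E \<mu> \<longleftrightarrow>
     finite_measure \<mu> \<and> sets \<mu> = sets borel \<and> infinite (msupport \<mu>) \<and> msupport \<mu> \<subseteq> E"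

text \<open>
  The integral is restricted to the support, whose complement is a null set, because the functions
  integrated below are given only near the support and have arbitrary, possibly non-measurable,
  values elsewhere.
\<close>
definition mu_inner ::
  "complex measure \<Rightarrow> (complex \<Rightarrow> complex) \<Rightarrow> (complex \<Rightarrow> complex) \<Rightarrow> complex" where
  "mu_inner \<mu> g h = (LINT \<zeta>:msupport \<mu>|\<mu>. g \<zeta> * cnj (h \<zeta>))"

definition orthonormal_polys :: "complex measure \<Rightarrow> (nat \<Rightarrow> complex poly) \<Rightarrow> bool" where
  "orthonormal_polys \<mu> p \<longleftrightarrow>
     (\<forall>n. degree (p n) = n \<and> lead_coeff (p n) \<in> \<real> \<and> 0 < Re (lead_coeff (p n))) \<and>
     (\<forall>n k. mu_inner \<mu> (poly (p n)) (poly (p k)) = (if n = k then 1 else 0))"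

definition second_type ::
  "complex measure \<Rightarrow> (nat \<Rightarrow> complex poly) \<Rightarrow> nat \<Rightarrow> complex \<Rightarrow> complex" where
  "second_type \<mu> p n z = (LINT \<zeta>:msupport \<mu>|\<mu>. cnj (poly (p n) \<zeta>) / (z - \<zeta>))"

definition Reg12 ::
  "complex set \<Rightarrow> (complex \<Rightarrow> complex) \<Rightarrow> (nat \<Rightarrow> complex poly) \<Rightarrow> complex measure \<Rightarrow> bool" where
  "Reg12 E \<Phi> p \<mu> \<longleftrightarrow>
     admissible_measure E \<mu> \<and>
     (\<forall>K. compact K \<and> K \<subseteq> - E \<longrightarrow>
        uniform_limit K (\<lambda>n z. root n (norm (poly (p n) z))) (\<lambda>z. norm (\<Phi> z)) sequentially \<and>
        uniform_limit K (\<lambda>n z. root n (norm (second_type \<mu> p n z)))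
          (\<lambda>z. inverse (norm (\<Phi> z))) sequentially)"


section \<open>Orthogonal Hermite-Pade approximants\<close>

text \<open>Tuples are indexed by \<open>{1..d}\<close>.\<close>

definition multi_size :: "nat \<Rightarrow> (nat \<Rightarrow> nat) \<Rightarrow> nat" where
  "multi_size d m = (\<Sum>i=1..d. m i)"

definition HP_numerator ::
  "complex measure \<Rightarrow> (nat \<Rightarrow> complex poly) \<Rightarrow> (complex \<Rightarrow> complex) \<Rightarrow> nat \<Rightarrow> complex poly \<Rightarrow>
   nat \<Rightarrow> complex poly \<Rightarrow> bool" where
  "HP_numerator \<mu> p f n Q k P \<longleftrightarrow>
     degree P \<le> n - 1 \<and>
     (\<forall>j\<le>n. mu_inner \<mu> (\<lambda>z. poly Q z * z ^ k * f z - poly P z) (poly (p j)) = 0)"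

definition HP_denominator ::
  "complex measure \<Rightarrow> (nat \<Rightarrow> complex poly) \<Rightarrow> nat \<Rightarrow> (nat \<Rightarrow> complex \<Rightarrow> complex) \<Rightarrow>
   (nat \<Rightarrow> nat) \<Rightarrow> nat \<Rightarrow> complex poly \<Rightarrow> bool" where
  "HP_denominator \<mu> p d F m n Q \<longleftrightarrow>
     Q \<noteq> 0 \<and> lead_coeff Q = 1 \<and> degree Q \<le> multi_size d m \<and>
     (\<forall>i\<in>{1..d}. \<forall>k<m i. \<exists>P. HP_numerator \<mu> p (F i) n Q k P)"


section \<open>Continuation and poles\<close>

text \<open>Functions given on some neighbourhood of \<open>E\<close> are total functions whose values elsewhere carry
  no information; everything below depends only on the germ along \<open>E\<close>.\<close>

definition agree_near :: "complex set \<Rightarrow> (complex \<Rightarrow> complex) \<Rightarrow> (complex \<Rightarrow> complex) \<Rightarrow> bool" where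
  "agree_near E g G \<longleftrightarrow> (\<exists>V. open V \<and> E \<subseteq> V \<and> (\<forall>z\<in>V. g z = G z))"

definition pole_order :: "(complex \<Rightarrow> complex) \<Rightarrow> complex \<Rightarrow> nat" where
  "pole_order g z = (if is_pole g z then nat (- zorder g z) else 0)"

text \<open>Requiring \<open>g\<close> to be \<open>nicely\<close> meromorphic fills in removable singularities, so that \<open>g\<close> is
  determined on \<open>D\<close> and is holomorphic off its poles.\<close>
definition mero_ext ::
  "complex set \<Rightarrow> (complex \<Rightarrow> complex) \<Rightarrow> complex set \<Rightarrow> (complex \<Rightarrow> complex) \<Rightarrow> bool" where
  "mero_ext E G D g \<longleftrightarrow> g nicely_meromorphic_on D \<and> agree_near E g G"

definition continuation ::
  "complex set \<Rightarrow> (complex \<Rightarrow> complex) \<Rightarrow> complex set \<Rightarrow> complex \<Rightarrow> complex" where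
  "continuation E G D = (SOME g. mero_ext E G D g)"

text \<open>The largest canonical domain is encoded by the supremum of the indices; the supremum is
  attained, since extensions to increasing domains glue together. The same applies to
  \<open>rho_comp\<close> below.\<close>
definition rho_mero ::
  "complex set \<Rightarrow> (complex \<Rightarrow> complex) \<Rightarrow> nat \<Rightarrow> (complex \<Rightarrow> complex) \<Rightarrow> ereal" where
  "rho_mero E \<Phi> t G = Sup {\<rho>. 1 < \<rho> \<and>
     (\<exists>g. mero_ext E G (canon_dom E \<Phi> \<rho>) g \<and>
          finite {z \<in> canon_dom E \<Phi> \<rho>. is_pole g z} \<and>
          (\<Sum>z\<in>{z \<in> canon_dom E \<Phi> \<rho>. is_pole g z}. pole_order g z) \<le> t)}"


section \<open>System poles\<close>

definition poly_comb ::
  "nat \<Rightarrow> (nat \<Rightarrow> complex \<Rightarrow> complex) \<Rightarrow> (nat \<Rightarrow> nat) \<Rightarrow> (complex \<Rightarrow> complex) set" where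
  "poly_comb d F m = {(\<lambda>z. \<Sum>i=1..d. poly (v i) z * F i z) |v :: nat \<Rightarrow> complex poly.
     \<forall>i\<in>{1..d}. degree (v i) < m i}"

definition sole_pole ::
  "complex set \<Rightarrow> (complex \<Rightarrow> complex) \<Rightarrow> complex \<Rightarrow> nat \<Rightarrow> (complex \<Rightarrow> complex) \<Rightarrow> bool" where
  "sole_pole E \<Phi> \<xi> t G \<longleftrightarrow>
     (\<exists>U g. open U \<and> closure (canon_dom E \<Phi> (ereal (norm (\<Phi> \<xi>)))) \<subseteq> U \<and>
        g holomorphic_on (U - {\<xi>}) \<and> agree_near E g G \<and> is_pole g \<xi> \<and> pole_order g \<xi> = t)"

definition system_pole ::
  "complex set \<Rightarrow> (complex \<Rightarrow> complex) \<Rightarrow> nat \<Rightarrow> (nat \<Rightarrow> complex \<Rightarrow> complex) \<Rightarrow> (nat \<Rightarrow> nat) \<Rightarrow>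
   complex \<Rightarrow> nat \<Rightarrow> bool" where
  "system_pole E \<Phi> d F m \<xi> \<tau> \<longleftrightarrow>
     \<xi> \<notin> E \<and> 1 \<le> \<tau> \<and>
     (\<forall>t\<in>{1..\<tau>}. \<exists>G\<in>poly_comb d F m. sole_pole E \<Phi> \<xi> t G) \<and>
     (\<forall>\<tau>'. (\<forall>t\<in>{1..\<tau>'}. \<exists>G\<in>poly_comb d F m. sole_pole E \<Phi> \<xi> t G) \<longrightarrow> \<tau>' \<le> \<tau>)"

definition system_poles ::
  "complex set \<Rightarrow> (complex \<Rightarrow> complex) \<Rightarrow> nat \<Rightarrow> (nat \<Rightarrow> complex \<Rightarrow> complex) \<Rightarrow> (nat \<Rightarrow> nat) \<Rightarrow>
   complex set" where
  "system_poles E \<Phi> d F m = {\<xi>. \<exists>\<tau>. system_pole E \<Phi> d F m \<xi> \<tau>}"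

definition system_order ::
  "complex set \<Rightarrow> (complex \<Rightarrow> complex) \<Rightarrow> nat \<Rightarrow> (nat \<Rightarrow> complex \<Rightarrow> complex) \<Rightarrow> (nat \<Rightarrow> nat) \<Rightarrow>
   complex \<Rightarrow> nat" where
  "system_order E \<Phi> d F m \<xi> = (THE \<tau>. system_pole E \<Phi> d F m \<xi> \<tau>)"

definition system_poly ::
  "complex set \<Rightarrow> (complex \<Rightarrow> complex) \<Rightarrow> nat \<Rightarrow> (nat \<Rightarrow> complex \<Rightarrow> complex) \<Rightarrow> (nat \<Rightarrow> nat) \<Rightarrow>
   complex poly" where
  "system_poly E \<Phi> d F m =
     (\<Prod>\<xi>\<in>system_poles E \<Phi> d F m. [:- \<xi>, 1:] ^ system_order E \<Phi> d F m \<xi>)"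

definition coeff_norm :: "complex poly \<Rightarrow> real" where
  "coeff_norm q = (\<Sum>i\<le>degree q. norm (coeff q i))"


section \<open>Characteristic indices\<close>

text \<open>The supremum is a maximum: the combinations \<open>G\<close> range over a finite-dimensional space, and those
  with \<open>rho_mero\<close> at least a given value come from a nested family of subspaces.\<close>
definition rho_pole ::
  "complex set \<Rightarrow> (complex \<Rightarrow> complex) \<Rightarrow> nat \<Rightarrow> (nat \<Rightarrow> complex \<Rightarrow> complex) \<Rightarrow> (nat \<Rightarrow> nat) \<Rightarrow>
   complex \<Rightarrow> nat \<Rightarrow> ereal" where
  "rho_pole E \<Phi> d F m \<xi> t =
     (SUP G\<in>{G \<in> poly_comb d F m. sole_pole E \<Phi> \<xi> t G}. rho_mero E \<Phi> t G)"

definition brho_pole ::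
  "complex set \<Rightarrow> (complex \<Rightarrow> complex) \<Rightarrow> nat \<Rightarrow> (nat \<Rightarrow> complex \<Rightarrow> complex) \<Rightarrow> (nat \<Rightarrow> nat) \<Rightarrow>
   complex \<Rightarrow> nat \<Rightarrow> ereal" where
  "brho_pole E \<Phi> d F m \<xi> t = (MIN k\<in>{1..t}. rho_pole E \<Phi> d F m \<xi> k)"

definition brho ::
  "complex set \<Rightarrow> (complex \<Rightarrow> complex) \<Rightarrow> nat \<Rightarrow> (nat \<Rightarrow> complex \<Rightarrow> complex) \<Rightarrow> (nat \<Rightarrow> nat) \<Rightarrow>
   complex \<Rightarrow> ereal" where
  "brho E \<Phi> d F m \<xi> = brho_pole E \<Phi> d F m \<xi> (system_order E \<Phi> d F m \<xi>)"

definition rho_comp ::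
  "complex set \<Rightarrow> (complex \<Rightarrow> complex) \<Rightarrow> nat \<Rightarrow> (nat \<Rightarrow> complex \<Rightarrow> complex) \<Rightarrow> (nat \<Rightarrow> nat) \<Rightarrow>
   nat \<Rightarrow> nat \<Rightarrow> ereal" where
  "rho_comp E \<Phi> d F m i k = Sup {\<rho>. 1 < \<rho> \<and>
     (\<exists>g. mero_ext E (\<lambda>z. z ^ k * F i z) (canon_dom E \<Phi> \<rho>) g \<and>
          (\<forall>\<xi>\<in>canon_dom E \<Phi> \<rho>. is_pole g \<xi> \<longrightarrow>
             \<xi> \<in> system_poles E \<Phi> d F m \<and> pole_order g \<xi> \<le> system_order E \<Phi> d F m \<xi>))}"

definition dom_comp ::
  "complex set \<Rightarrow> (complex \<Rightarrow> complex) \<Rightarrow> nat \<Rightarrow> (nat \<Rightarrow> complex \<Rightarrow> complex) \<Rightarrow> (nat \<Rightarrow> nat) \<Rightarrow>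
   nat \<Rightarrow> nat \<Rightarrow> complex set" where
  "dom_comp E \<Phi> d F m i k = canon_dom E \<Phi> (rho_comp E \<Phi> d F m i k)"

definition ext_comp ::
  "complex set \<Rightarrow> (complex \<Rightarrow> complex) \<Rightarrow> nat \<Rightarrow> (nat \<Rightarrow> complex \<Rightarrow> complex) \<Rightarrow> (nat \<Rightarrow> nat) \<Rightarrow>
   nat \<Rightarrow> nat \<Rightarrow> complex \<Rightarrow> complex" where
  "ext_comp E \<Phi> d F m i k = continuation E (\<lambda>z. z ^ k * F i z) (dom_comp E \<Phi> d F m i k)"

text \<open>If there are no poles, the infimum is \<open>\<infinity>\<close> and so drops out.\<close>
definition rho_star ::
  "complex set \<Rightarrow> (complex \<Rightarrow> complex) \<Rightarrow> nat \<Rightarrow> (nat \<Rightarrow> complex \<Rightarrow> complex) \<Rightarrow> (nat \<Rightarrow> nat) \<Rightarrow>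
   nat \<Rightarrow> nat \<Rightarrow> ereal" where
  "rho_star E \<Phi> d F m i k = min (rho_comp E \<Phi> d F m i k)
     (INF \<xi>\<in>{\<xi> \<in> dom_comp E \<Phi> d F m i k. is_pole (ext_comp E \<Phi> d F m i k) \<xi>}.
        brho_pole E \<Phi> d F m \<xi> (pole_order (ext_comp E \<Phi> d F m i k) \<xi>))"

definition dom_star ::
  "complex set \<Rightarrow> (complex \<Rightarrow> complex) \<Rightarrow> nat \<Rightarrow> (nat \<Rightarrow> complex \<Rightarrow> complex) \<Rightarrow> (nat \<Rightarrow> nat) \<Rightarrow>
   nat \<Rightarrow> nat \<Rightarrow> complex set" where
  "dom_star E \<Phi> d F m i k = canon_dom E \<Phi> (rho_star E \<Phi> d F m i k)"


section \<open>Sup-norms and their roots\<close>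

definition sup_norm :: "complex set \<Rightarrow> (complex \<Rightarrow> complex) \<Rightarrow> ereal" where
  "sup_norm K h = (SUP z\<in>K. ereal (norm (h z)))"

text \<open>A sup-norm may be infinite; over the empty set it is \<open>-\<infinity>\<close>, whose root is \<open>0\<close> here.\<close>
definition ereal_root :: "nat \<Rightarrow> ereal \<Rightarrow> ereal" where
  "ereal_root n x = (if x = \<infinity> then \<infinity> else ereal (root n (real_of_ereal x)))"

end

theory Submission
  imports Defs
begin

text \<open>
  Write \<open>L\<^sub>n f = \<langle>f, p\<^sub>n\<rangle>\<close>. By Cauchy's formula on a level curve of \<open>\<Phi>\<close> and Fubini, \<open>L\<^sub>n f\<close> is an integral of \<open>f\<close>
  against the second type function, so it decays like \<open>\<rho>\<^sup>-\<^sup>n\<close> when \<open>f\<close> is holomorphic on \<open>D\<^sub>\<rho>\<close>; conversely such a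
  decay makes the Fourier series continue \<open>f\<close> to \<open>D\<^sub>\<rho>\<close>. Poles are handled without residues: after splitting off
  principal parts, \<open>L\<^sub>n (Q\<^sub>n G) = 0\<close> is a relation between the Taylor coefficients of \<open>Q\<^sub>n\<close> at a system pole \<open>\<xi>\<close>,
  the numbers \<open>L\<^sub>n ((z - \<xi>)\<^sup>-\<^sup>s)\<close> (of exact rate \<open>1 / |\<Phi> \<xi>|\<close> for \<open>s = 1\<close>) and a term of rate \<open>1 / \<rho>\<^sub>t(G)\<close>.
  Solving these triangular systems gives the rate of the Hermite data of \<open>Q\<^sub>n\<close> at all system poles, and stability of
  Hermite interpolation turns it into the rate of \<open>Q\<^sub>n - Q\<^sub>F\<close>. If that rate were better, \<open>Q\<^sub>F G\<close> would continue
  further for all combinations \<open>G\<close>; removing the poles of \<open>G\<close> one by one, starting from the outermost, would then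
  contradict the definition of the characteristic indices. For the approximants, the error \<open>Q\<^sub>n z\<^sup>k F\<^sub>i - P\<^sub>n\<close> is the
  Fourier remainder of \<open>Q\<^sub>n z\<^sup>k F\<^sub>i\<close>, which is split in the same way.
\<close>

section \<open>Exponential rates\<close>

text \<open>For powers of 1 / (z - \<xi>) above the first only upper rates of the Fourier
  coefficients are used; a lower bound is at hand for 1 / (z - \<xi>) itself, whose coefficient is a
  value of the second type function up to sign. So each row of a triangular system is solved by
  dividing by this one coefficient, which explains why every order t = 1, ..., \<tau> must be
  realised by a combination and why the indices are minima over k \<le> t. Monic denominators are
  not known to be bounded beforehand: the estimates run on multiples with coefficient sum 1, and
  because there are as many Taylor data at the system poles as the degree |m|, interpolation keeps
  their leading coefficients away from 0. In the converse direction, continuing a combination past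
  the circle of its own pole may uncover poles at system poles farther out; they are cancelled by
  combinations with one pure principal part, which dictates the order from the outside inwards. A
  convergent Fourier series must moreover be shown to represent its function; this rests on a
  vanishing Cauchy transform and the infinite support of \<mu>.\<close>

definition rate_le :: "(nat \<Rightarrow> 'a::real_normed_vector) \<Rightarrow> real \<Rightarrow> bool" where
  "rate_le a x \<longleftrightarrow> (\<forall>y>x. \<exists>C. \<forall>n. norm (a n) \<le> C * y ^ n)"

lemma rate_leD:
  assumes "rate_le a x" "0 \<le> x" "x < y"
  obtains C where "C > 0" "\<And>n. norm (a n) \<le> C * y ^ n"
proof -
  obtain C where C: "\<And>n. norm (a n) \<le> C * y ^ n"
    using assms unfolding rate_le_def by blast
  have "norm (a n) \<le> max C 1 * y ^ n" for n
  proof -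
    have "C * y ^ n \<le> max C 1 * y ^ n"
      using assms by (intro mult_right_mono) auto
    then show ?thesis using C[of n] by linarith
  qed
  then show ?thesis by (intro that[of "max C 1"]) auto
qed

text \<open>Demanding the bound for every n costs nothing: for y > x \<ge> 0 the powers of y are
  positive, so finitely many exceptional terms are absorbed into the constant by adding their
  quotients \<open>norm (a k) / y ^ k\<close>.\<close>

lemma rate_leI_eventually:
  assumes "0 \<le> x" "\<And>y. x < y \<Longrightarrow> \<exists>C. \<forall>\<^sub>F n in sequentially. norm (a n) \<le> C * y ^ n"
  shows "rate_le a x"
  unfolding rate_le_def
proof (intro allI impI)
  fix y assume y: "x < y"
  then have y0: "y > 0" using assms(1) by simp
  obtain C N where N: "\<And>n. n \<ge> N \<Longrightarrow> norm (a n) \<le> C * y ^ n"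
    using assms(2)[OF y] unfolding eventually_sequentially by blast
  define C' where "C' = \<bar>C\<bar> + (\<Sum>k<N. norm (a k) / y ^ k)"
  have "norm (a n) \<le> C' * y ^ n" for n
  proof (cases "n < N")
    case True
    have "norm (a n) / y ^ n \<le> (\<Sum>k<N. norm (a k) / y ^ k)"
      using True y0 by (intro member_le_sum) auto
    also have "\<dots> \<le> C'" by (simp add: C'_def)
    finally show ?thesis using y0 by (simp add: field_simps)
  next
    case False
    have "C \<le> C'" unfolding C'_def
      by (smt (verit) sum_nonneg divide_nonneg_nonneg norm_ge_zero zero_le_power y0)
    then have "C * y ^ n \<le> C' * y ^ n" using y0 by (intro mult_right_mono) auto
    then show ?thesis using N[of n] False by simp
  qed
  then show "\<exists>C. \<forall>n. norm (a n) \<le> C * y ^ n" by blast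
qed

lemma rate_le_mono: "rate_le a x \<Longrightarrow> x \<le> x' \<Longrightarrow> rate_le a x'"
  unfolding rate_le_def by auto

lemma rate_le_dense:
  assumes "\<And>y. x < y \<Longrightarrow> rate_le a y" shows "rate_le a x"
  unfolding rate_le_def
proof (intro allI impI)
  fix y assume "x < y"
  then obtain z where "x < z" "z < y" using dense by blast
  then show "\<exists>C. \<forall>n. norm (a n) \<le> C * y ^ n" using assms unfolding rate_le_def by blast
qed

lemma rate_le_norm_mono:
  assumes "rate_le b x" "0 \<le> x" "\<forall>\<^sub>F n in sequentially. norm (a n) \<le> C * norm (b n)" "0 \<le> C"
  shows "rate_le a x"
proof (rule rate_leI_eventually)
  fix y assume "x < y"
  then obtain D where D: "D > 0" "\<And>n. norm (b n) \<le> D * y ^ n"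
    using rate_leD[OF assms(1,2)] by blast
  have "\<forall>\<^sub>F n in sequentially. norm (a n) \<le> (C * D) * y ^ n"
    using assms(3)
  proof eventually_elim
    case (elim n)
    have "C * norm (b n) \<le> C * (D * y ^ n)" using D(2) assms(4) by (intro mult_left_mono) auto
    with elim show ?case by (simp add: mult.assoc)
  qed
  then show "\<exists>C. \<forall>\<^sub>F n in sequentially. norm (a n) \<le> C * y ^ n" by blast
qed (fact assms)

lemma rate_le_cong:
  assumes "rate_le b x" "0 \<le> x" "\<forall>\<^sub>F n in sequentially. a n = b n"
  shows "rate_le a x"
  by (rule rate_le_norm_mono[OF assms(1,2), of _ 1]) (use assms(3) in \<open>auto elim: eventually_mono\<close>)

lemma rate_le_zero: "0 \<le> x \<Longrightarrow> rate_le (\<lambda>_. 0) x"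
  unfolding rate_le_def by (auto intro!: exI[of _ 0])

lemma rate_le_add:
  assumes "rate_le a x" "rate_le b x" "0 \<le> x"
  shows "rate_le (\<lambda>n. a n + b n) x"
  unfolding rate_le_def
proof (intro allI impI)
  fix y assume y: "x < y"
  obtain C where C: "\<And>n. norm (a n) \<le> C * y ^ n" using rate_leD[OF assms(1,3) y] by blast
  obtain D where D: "\<And>n. norm (b n) \<le> D * y ^ n" using rate_leD[OF assms(2,3) y] by blast
  have "norm (a n + b n) \<le> (C + D) * y ^ n" for n
    using norm_triangle_ineq[of "a n" "b n"] C[of n] D[of n] by (simp add: algebra_simps)
  then show "\<exists>C. \<forall>n. norm (a n + b n) \<le> C * y ^ n" by blast
qed

lemma rate_le_sum:
  assumes "\<And>i. i \<in> I \<Longrightarrow> rate_le (a i) x" "0 \<le> x"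
  shows "rate_le (\<lambda>n. \<Sum>i\<in>I. a i n) x"
  using assms
proof (induction I rule: infinite_finite_induct)
  case (insert i I) then show ?case by (simp add: rate_le_add)
qed (simp_all add: rate_le_zero)

lemma rate_le_uminus: "rate_le (\<lambda>n. - a n) x \<longleftrightarrow> rate_le a x"
  by (simp add: rate_le_def)

lemma rate_le_norm: "rate_le (\<lambda>n. norm (a n)) x \<longleftrightarrow> rate_le a x"
  by (simp add: rate_le_def)

text \<open>By continuity of the product both factors can be enlarged slightly. This is the slack
  that lets rates multiply although each bound holds only for strictly larger bases.\<close>

lemma real_mult_split:
  fixes x y z :: real
  assumes "0 \<le> x" "0 \<le> y" "x * y < z"
  obtains x' y' where "x < x'" "y < y'" "x' * y' < z"
proof -
  have "((\<lambda>d. (x + d) * (y + d)) \<longlongrightarrow> (x + 0) * (y + 0)) (at_right 0)"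
    by (intro tendsto_intros)
  then have "\<forall>\<^sub>F d in at_right 0. (x + d) * (y + d) < z"
    using assms(3) by (intro order_tendstoD(2)) auto
  then have "\<forall>\<^sub>F d in at_right 0. (x + d) * (y + d) < z \<and> d > 0"
    by (intro eventually_conj eventually_at_right_less)
  then obtain d where "(x + d) * (y + d) < z" "d > 0"
    using eventually_happens trivial_limit_at_right_real by blast
  then show ?thesis using that[of "x + d" "y + d"] by simp
qed

lemma rate_le_mult:
  fixes a b :: "nat \<Rightarrow> 'a::real_normed_field"
  assumes "rate_le a x" "rate_le b y" "0 \<le> x" "0 \<le> y"
  shows "rate_le (\<lambda>n. a n * b n) (x * y)"
  unfolding rate_le_def
proof (intro allI impI)
  fix z assume "x * y < z"
  then obtain x' y' where xy: "x < x'" "y < y'" "x' * y' < z" using real_mult_split assms by metis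
  obtain C where C: "C > 0" "\<And>n. norm (a n) \<le> C * x' ^ n" using rate_leD[OF assms(1,3) xy(1)] by blast
  obtain D where D: "D > 0" "\<And>n. norm (b n) \<le> D * y' ^ n" using rate_leD[OF assms(2,4) xy(2)] by blast
  have "norm (a n * b n) \<le> (C * D) * z ^ n" for n
  proof -
    have "norm (a n * b n) \<le> (C * x' ^ n) * (D * y' ^ n)"
      unfolding norm_mult using C D xy assms by (intro mult_mono) auto
    also have "\<dots> = (C * D) * (x' * y') ^ n" by (simp add: power_mult_distrib)
    also have "\<dots> \<le> (C * D) * z ^ n"
      using C D xy assms by (intro mult_left_mono power_mono) auto
    finally show ?thesis .
  qed
  then show "\<exists>C. \<forall>n. norm (a n * b n) \<le> C * z ^ n" by blast
qed

lemma rate_le_bounded: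
  assumes "\<forall>\<^sub>F n in sequentially. norm (a n) \<le> B"
  shows "rate_le a 1"
proof (rule rate_leI_eventually)
  fix y :: real assume y: "1 < y"
  have "\<forall>\<^sub>F n in sequentially. norm (a n) \<le> \<bar>B\<bar> * y ^ n"
    using assms
  proof eventually_elim
    case (elim n)
    have "\<bar>B\<bar> * 1 \<le> \<bar>B\<bar> * y ^ n" using y by (intro mult_left_mono) auto
    then show ?case using elim by simp
  qed
  then show "\<exists>C. \<forall>\<^sub>F n in sequentially. norm (a n) \<le> C * y ^ n" by blast
qed simp

lemma rate_le_mult_bounded:
  fixes a b :: "nat \<Rightarrow> 'a::real_normed_field"
  assumes "\<forall>\<^sub>F n in sequentially. norm (a n) \<le> B" "rate_le b x" "0 \<le> x"
  shows "rate_le (\<lambda>n. a n * b n) x"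
  using rate_le_mult[OF rate_le_bounded[OF assms(1)] assms(2)] assms(3) by simp

lemma rate_le_tendsto_zero:
  assumes "rate_le a x" "0 \<le> x" "x < 1"
  shows "a \<longlonglongrightarrow> 0"
proof -
  obtain y where y: "x < y" "y < 1" using assms(3) dense by blast
  obtain C where C: "C > 0" "\<And>n. norm (a n) \<le> C * y ^ n" using rate_leD[OF assms(1,2) y(1)] by blast
  have "(\<lambda>n. C * y ^ n) \<longlonglongrightarrow> C * 0"
    using y assms by (intro tendsto_intros LIMSEQ_power_zero) auto
  then show ?thesis
    by (intro Lim_null_comparison[of a "\<lambda>n. C * y ^ n"]) (use C in auto)
qed

text \<open>Dividing rates requires a lower bound on \<open>b\<close> for all large n, not merely
  along a subsequence. In the application \<open>b\<close> is the Fourier coefficient of a simple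
  pole.\<close>

lemma rate_le_cancel:
  fixes a b :: "nat \<Rightarrow> 'a::real_normed_field"
  assumes "rate_le (\<lambda>n. a n * b n) x" "0 \<le> x" "0 < w"
    and low: "\<And>v. 0 < v \<Longrightarrow> v < w \<Longrightarrow> \<forall>\<^sub>F n in sequentially. v ^ n \<le> norm (b n)"
  shows "rate_le a (x / w)"
proof (rule rate_leI_eventually)
  fix y assume y: "x / w < y"
  then have y0: "0 < y" using assms by (meson divide_nonneg_pos le_less_trans)
  have "x / y < w" using y y0 assms(3) by (simp add: field_simps)
  then obtain v where v: "x / y < v" "v < w" using dense by blast
  have v0: "0 < v" using v(1) y0 assms(2) by (meson divide_nonneg_pos le_less_trans)
  have "x < y * v" using v y0 by (simp add: field_simps)
  then obtain C where C: "C > 0" "\<And>n. norm (a n * b n) \<le> C * (y * v) ^ n"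
    using rate_leD[OF assms(1,2)] by blast
  have "\<forall>\<^sub>F n in sequentially. norm (a n) \<le> C * y ^ n"
    using low[OF v0 v(2)]
  proof eventually_elim
    case (elim n)
    have "norm (a n) * v ^ n \<le> norm (a n) * norm (b n)" using elim by (intro mult_left_mono) auto
    also have "\<dots> \<le> C * (y * v) ^ n" using C(2)[of n] by (simp add: norm_mult)
    also have "\<dots> = (C * y ^ n) * v ^ n" by (simp add: power_mult_distrib)
    finally show ?case using v0 by simp
  qed
  then show "\<exists>C. \<forall>\<^sub>F n in sequentially. norm (a n) \<le> C * y ^ n" by blast
qed (use assms in simp)

text \<open>A base z strictly between x and y absorbs the constant, since C (z / y)^n tends to
  0.\<close>

lemma rate_le_eventually_power:
  assumes "rate_le a x" "0 \<le> x" "x < y"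
  shows "\<forall>\<^sub>F n in sequentially. norm (a n) \<le> y ^ n"
proof -
  obtain z where z: "x < z" "z < y" using assms(3) dense by blast
  obtain C where C: "C > 0" "\<And>n. norm (a n) \<le> C * z ^ n" using rate_leD[OF assms(1,2) z(1)] by blast
  have "(\<lambda>n. C * (z / y) ^ n) \<longlonglongrightarrow> C * 0"
    using z assms by (intro tendsto_intros LIMSEQ_power_zero) auto
  then have "\<forall>\<^sub>F n in sequentially. C * (z / y) ^ n < 1"
    by (intro order_tendstoD(2)) auto
  then show ?thesis
  proof eventually_elim
    case (elim n)
    have "C * z ^ n \<le> y ^ n" using elim z assms by (simp add: power_divide field_simps)
    then show ?case using C(2)[of n] by linarith
  qed
qed

text \<open>Together with \<open>limsup_rate_le\<close> this identifies \<open>rate_le a x\<close>,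
  for x \<ge> 0, with the bound x on the upper limit of the n-th roots, so roots occur only on
  entering or leaving the estimates.\<close>

lemma rate_le_limsup:
  assumes "rate_le a x" "0 \<le> x"
  shows "limsup (\<lambda>n. ereal (root n (norm (a n)))) \<le> ereal x"
proof (rule dense_ge)
  fix e assume "ereal x < e"
  then obtain y where y: "x < y" "ereal y < e" using ereal_dense2 less_ereal.simps(1) by blast
  have "\<forall>\<^sub>F n in sequentially. ereal (root n (norm (a n))) \<le> ereal y"
    using rate_le_eventually_power[OF assms y(1)] eventually_gt_at_top[of 0]
  proof eventually_elim
    case (elim n)
    then have "root n (norm (a n)) \<le> root n (y ^ n)" by (intro real_root_le_mono) auto
    also have "\<dots> = y" using elim y assms by (intro real_root_power_cancel) auto
    finally show ?case by simp
  qed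
  then have "limsup (\<lambda>n. ereal (root n (norm (a n)))) \<le> ereal y" by (intro Limsup_bounded)
  then show "limsup (\<lambda>n. ereal (root n (norm (a n)))) \<le> e" using y(2) by (meson less_imp_le order_trans)
qed

lemma limsup_rate_le:
  assumes "limsup (\<lambda>n. ereal (root n (norm (a n)))) \<le> ereal x" "0 \<le> x"
  shows "rate_le a x"
proof (rule rate_leI_eventually)
  fix y assume y: "x < y"
  have "limsup (\<lambda>n. ereal (root n (norm (a n)))) < ereal y"
    using assms(1) y by (meson le_less_trans less_ereal.simps(1))
  then have "\<forall>\<^sub>F n in sequentially. ereal (root n (norm (a n))) < ereal y"
    using Limsup_lessD by blast
  then have "\<forall>\<^sub>F n in sequentially. norm (a n) \<le> 1 * y ^ n"
    using eventually_gt_at_top[of 0]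
  proof eventually_elim
    case (elim n)
    have "norm (a n) = root n (norm (a n)) ^ n" using elim by simp
    also have "\<dots> \<le> y ^ n" using elim by (intro power_mono) auto
    finally show ?case by simp
  qed
  then show "\<exists>C. \<forall>\<^sub>F n in sequentially. norm (a n) \<le> C * y ^ n" by blast
qed (fact assms)

section \<open>Taylor coefficients of polynomials and Hermite interpolation\<close>

text \<open>Shifting the variable turns the l-th Taylor coefficient at \<xi> into an ordinary
  coefficient, so no derivatives or factorials occur.\<close>

definition tcoeff :: "complex poly \<Rightarrow> complex \<Rightarrow> nat \<Rightarrow> complex" where
  "tcoeff q \<xi> l = coeff (pcompose q [:\<xi>, 1:]) l"

lemma poly_tcoeff:
  assumes "degree q \<le> M"
  shows "poly q z = (\<Sum>l\<le>M. tcoeff q \<xi> l * (z - \<xi>) ^ l)"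
proof -
  have d: "degree (pcompose q [:\<xi>, 1:]) \<le> M" using assms by (simp add: degree_pcompose)
  have "poly q z = poly (pcompose q [:\<xi>, 1:]) (z - \<xi>)" by (simp add: poly_pcompose)
  also have "\<dots> = (\<Sum>l\<le>M. tcoeff q \<xi> l * (z - \<xi>) ^ l)"
    unfolding tcoeff_def poly_altdef
    by (rule sum.mono_neutral_left) (use d in \<open>auto simp: coeff_eq_0\<close>)
  finally show ?thesis .
qed

lemma tcoeff_diff: "tcoeff (p - q) \<xi> l = tcoeff p \<xi> l - tcoeff q \<xi> l"
  by (simp add: tcoeff_def pcompose_diff)

lemma tcoeff_smult: "tcoeff (smult c q) \<xi> l = c * tcoeff q \<xi> l"
  by (simp add: tcoeff_def pcompose_smult)

lemma tcoeff_0: "tcoeff q \<xi> 0 = poly q \<xi>"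
proof -
  have "tcoeff q \<xi> 0 = poly (pcompose q [:\<xi>, 1:]) 0" by (simp add: tcoeff_def poly_0_coeff_0)
  then show ?thesis by (simp add: poly_pcompose)
qed

text \<open>Shows how division by z - x acts on Taylor data: at \<xi> = x the index shifts by one,
  at any other node a first-order recursion with factor \<xi> - x appears. These are the two cases
  of the stability induction.\<close>

lemma tcoeff_linear_mult:
  "tcoeff ([:a:] + [:- x, 1:] * r) \<xi> l =
     (if l = 0 then a else tcoeff r \<xi> (l - 1)) + (\<xi> - x) * tcoeff r \<xi> l"
proof -
  have "pcompose ([:a:] + [:- x, 1:] * r) [:\<xi>, 1:] = [:a:] + [:\<xi> - x, 1:] * pcompose r [:\<xi>, 1:]"
    unfolding pcompose_add pcompose_mult pcompose_pCons by (simp add: algebra_simps pcompose_pCons)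
  moreover have "coeff ([:a:] + [:\<xi> - x, 1:] * s) l =
     (if l = 0 then a else coeff s (l - 1)) + (\<xi> - x) * coeff s l" for s
    by (cases l) (auto simp: algebra_simps)
  ultimately show ?thesis unfolding tcoeff_def by presburger
qed

lemma tcoeff_dvd:
  assumes "[:- \<xi>, 1:] ^ k dvd q" "l < k" shows "tcoeff q \<xi> l = 0"
proof -
  obtain r where r: "q = [:- \<xi>, 1:] ^ k * r" using assms(1) by (auto elim: dvdE)
  have "pcompose ([:- \<xi>, 1:] ^ k) [:\<xi>, 1:] = [:0, 1:] ^ k"
    by (induction k) (simp_all add: pcompose_mult pcompose_pCons one_pCons del: mult_pCons_left)
  then have "pcompose q [:\<xi>, 1:] = monom 1 k * pcompose r [:\<xi>, 1:]"
    by (simp add: r pcompose_mult monom_altdef)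
  then show ?thesis using assms(2) by (simp add: tcoeff_def coeff_monom_mult)
qed

text \<open>Dividing out one linear factor lowers the degree and changes
  the data at the other nodes boundedly.\<close>
lemma hermite_bound:
  fixes \<tau> :: "complex \<Rightarrow> nat"
  assumes "finite S"
  shows "\<exists>C\<ge>0. \<forall>r \<epsilon>. degree r < (\<Sum>\<xi>\<in>S. \<tau> \<xi>) \<or> r = 0 \<longrightarrow>
           (\<forall>\<xi>\<in>S. \<forall>l<\<tau> \<xi>. norm (tcoeff r \<xi> l) \<le> \<epsilon>) \<longrightarrow> 0 \<le> \<epsilon> \<longrightarrow> (\<forall>i. norm (coeff r i) \<le> C * \<epsilon>)"
proof (induction "\<Sum>\<xi>\<in>S. \<tau> \<xi>" arbitrary: \<tau>)
  case 0
  then show ?case by (intro exI[of _ 0]) auto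
next
  case (Suc N)
  have "\<exists>x\<in>S. \<tau> x \<noteq> 0"
  proof (rule ccontr)
    assume "\<not> (\<exists>x\<in>S. \<tau> x \<noteq> 0)"
    then have "(\<Sum>\<xi>\<in>S. \<tau> \<xi>) = 0" by simp
    with Suc(2) show False by simp
  qed
  then obtain x where x: "x \<in> S" "\<tau> x \<noteq> 0" by blast
  define \<tau>' where "\<tau>' = \<tau>(x := \<tau> x - 1)"
  have sum': "N = (\<Sum>\<xi>\<in>S. \<tau>' \<xi>)"
  proof -
    have "(\<Sum>\<xi>\<in>S. \<tau> \<xi>) = \<tau> x + (\<Sum>\<xi>\<in>S - {x}. \<tau> \<xi>)" using assms x by (simp add: sum.remove)
    moreover have "(\<Sum>\<xi>\<in>S. \<tau>' \<xi>) = \<tau>' x + (\<Sum>\<xi>\<in>S - {x}. \<tau>' \<xi>)" using assms x by (simp add: sum.remove)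
    moreover have "(\<Sum>\<xi>\<in>S - {x}. \<tau>' \<xi>) = (\<Sum>\<xi>\<in>S - {x}. \<tau> \<xi>)" by (intro sum.cong) (auto simp: \<tau>'_def)
    ultimately show ?thesis using Suc(2) x unfolding \<tau>'_def by (simp only: fun_upd_same)
  qed
  obtain C' where C': "C' \<ge> 0" "\<And>r \<epsilon> i. degree r < N \<or> r = 0 \<Longrightarrow>
      (\<And>\<xi> l. \<xi> \<in> S \<Longrightarrow> l < \<tau>' \<xi> \<Longrightarrow> norm (tcoeff r \<xi> l) \<le> \<epsilon>) \<Longrightarrow> 0 \<le> \<epsilon> \<Longrightarrow> norm (coeff r i) \<le> C' * \<epsilon>"
    using Suc(1)[OF sum', folded sum'] by meson
  \<comment> \<open>The recursion at another node divides by its distance from x; the inserted 1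
    keeps the minimum defined when x is the only node.\<close>
  define \<delta> where "\<delta> = Min (insert 1 ((\<lambda>\<xi>. norm (\<xi> - x)) ` (S - {x})))"
  have \<delta>0: "\<delta> > 0" unfolding \<delta>_def using assms by (subst Min_gr_iff) auto
  have \<delta>: "\<delta> \<le> norm (\<xi> - x)" if "\<xi> \<in> S" "\<xi> \<noteq> x" for \<xi>
    unfolding \<delta>_def using assms that by (intro Min_le) auto
  \<comment> \<open>Solves K (l + 1) = 2 / \<delta> + (2 / \<delta>) K l with K 0 = 2 / \<delta>.
    The factor 2 is needed at l = 0, where both the datum at \<xi> and the remainder
    \<open>a\<close> enter, and is kept throughout.\<close>
  define K where "K l = (\<Sum>j\<le>l. (2 / \<delta>) ^ Suc j)" for l :: nat
  define M where "M = 1 + (\<Sum>\<xi>\<in>S. K (\<tau> \<xi>))"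
  have K0: "K l \<ge> 0" for l unfolding K_def using \<delta>0 by (intro sum_nonneg) auto
  have Kmono: "K l \<le> K l'" if "l \<le> l'" for l l'
    unfolding K_def using that \<delta>0 by (intro sum_mono2) auto
  have M1: "M \<ge> 1" unfolding M_def using K0 by (simp add: sum_nonneg)
  have KM: "K l \<le> M" if "\<xi> \<in> S" "l < \<tau> \<xi>" for \<xi> l
  proof -
    have "K l \<le> K (\<tau> \<xi>)" using that by (intro Kmono) auto
    also have "\<dots> \<le> (\<Sum>\<xi>\<in>S. K (\<tau> \<xi>))" using that assms K0 by (intro member_le_sum) auto
    finally show ?thesis by (simp add: M_def)
  qed
  define C where "C = 1 + (1 + norm x) * (C' * M)"
  have "norm (coeff r i) \<le> C * \<epsilon>"
    if r: "degree r < (\<Sum>\<xi>\<in>S. \<tau> \<xi>) \<or> r = 0"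
      and data: "\<forall>\<xi>\<in>S. \<forall>l<\<tau> \<xi>. norm (tcoeff r \<xi> l) \<le> \<epsilon>" and e: "0 \<le> \<epsilon>" for r \<epsilon> i
  proof -
    define a where "a = poly r x"
    define r' where "r' = synthetic_div r x"
    have rr': "r = [:a:] + [:- x, 1:] * r'"
      using synthetic_div_correct'[of x r] by (simp add: a_def r'_def add.commute)
    have degr': "degree r' < N \<or> r' = 0"
      using r Suc(2) by (auto simp: r'_def degree_synthetic_div synthetic_div_eq_0_iff)
    have a: "norm a \<le> \<epsilon>" using data x by (auto simp: a_def tcoeff_0[symmetric])
    have d': "norm (tcoeff r' \<xi> l) \<le> M * \<epsilon>" if \<xi>: "\<xi> \<in> S" "l < \<tau>' \<xi>" for \<xi> l
    proof (cases "\<xi> = x")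
      case True
      have "tcoeff r x (Suc l) = tcoeff r' x l" by (subst rr', subst tcoeff_linear_mult) simp
      moreover have "Suc l < \<tau> x" using \<xi> True by (simp add: \<tau>'_def)
      ultimately have "norm (tcoeff r' \<xi> l) \<le> \<epsilon>" using data x True by metis
      also have "\<dots> \<le> M * \<epsilon>" using M1 e by (simp add: mult_le_cancel_right1)
      finally show ?thesis .
    next
      case False
      have lt: "l < \<tau> \<xi>" using \<xi> False by (simp add: \<tau>'_def)
      have "norm (tcoeff r' \<xi> l) \<le> K l * \<epsilon>" using lt
      proof (induction l)
        case 0
        have "tcoeff r \<xi> 0 = a + (\<xi> - x) * tcoeff r' \<xi> 0" by (subst rr', subst tcoeff_linear_mult) simp
        then have "norm ((\<xi> - x) * tcoeff r' \<xi> 0) = norm (tcoeff r \<xi> 0 - a)" by simp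
        also have "\<dots> \<le> 2 * \<epsilon>" using norm_triangle_ineq4[of "tcoeff r \<xi> 0" a] data \<xi> 0 a by fastforce
        finally have "norm (\<xi> - x) * norm (tcoeff r' \<xi> 0) \<le> 2 * \<epsilon>" by (simp add: norm_mult)
        moreover have "\<delta> * norm (tcoeff r' \<xi> 0) \<le> norm (\<xi> - x) * norm (tcoeff r' \<xi> 0)"
          using \<delta>[OF \<xi>(1) False] by (intro mult_right_mono) auto
        ultimately show ?case using \<delta>0 by (simp add: K_def field_simps)
      next
        case (Suc l)
        have "tcoeff r \<xi> (Suc l) = tcoeff r' \<xi> l + (\<xi> - x) * tcoeff r' \<xi> (Suc l)"
          by (subst rr', subst tcoeff_linear_mult) simp
        then have "norm ((\<xi> - x) * tcoeff r' \<xi> (Suc l)) = norm (tcoeff r \<xi> (Suc l) - tcoeff r' \<xi> l)" by simp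
        also have "\<dots> \<le> norm (tcoeff r \<xi> (Suc l)) + norm (tcoeff r' \<xi> l)" by (rule norm_triangle_ineq4)
        also have "\<dots> \<le> \<epsilon> + K l * \<epsilon>" using data \<xi> Suc by (intro add_mono) auto
        also have "\<dots> \<le> 2 * \<epsilon> + 2 * K l * \<epsilon>" using e K0[of l] by simp
        finally have "norm (\<xi> - x) * norm (tcoeff r' \<xi> (Suc l)) \<le> 2 * \<epsilon> + 2 * K l * \<epsilon>" by (simp add: norm_mult)
        moreover have "\<delta> * norm (tcoeff r' \<xi> (Suc l)) \<le> norm (\<xi> - x) * norm (tcoeff r' \<xi> (Suc l))"
          using \<delta>[OF \<xi>(1) False] by (intro mult_right_mono) auto
        ultimately have "norm (tcoeff r' \<xi> (Suc l)) \<le> (2 / \<delta>) * \<epsilon> + (2 / \<delta>) * K l * \<epsilon>"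
          using \<delta>0 by (simp add: field_simps)
        also have "\<dots> = K (Suc l) * \<epsilon>"
        proof -
          have "K (Suc l) = (2 / \<delta>) + (2 / \<delta>) * K l"
            unfolding K_def sum.atMost_Suc_shift by (simp add: sum_distrib_left)
          then show ?thesis by (simp only: ring_distribs)
        qed
        finally show ?case .
      qed
      also have "\<dots> \<le> M * \<epsilon>" using KM[OF \<xi>(1) lt] e by (intro mult_right_mono)
      finally show ?thesis .
    qed
    have c': "norm (coeff r' j) \<le> C' * (M * \<epsilon>)" for j
      using degr' d' M1 e by (intro C'(2)) auto
    have "coeff r i = (if i = 0 then a else coeff r' (i - 1)) - x * coeff r' i"
      by (subst rr') (cases i, auto)
    then have "norm (coeff r i) \<le> norm (if i = 0 then a else coeff r' (i - 1)) + norm x * norm (coeff r' i)"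
      using norm_triangle_ineq4[of "if i = 0 then a else coeff r' (i - 1)" "x * coeff r' i"]
      by (simp add: norm_mult)
    also have "\<dots> \<le> (\<epsilon> + C' * (M * \<epsilon>)) + norm x * (C' * (M * \<epsilon>))"
    proof (intro add_mono mult_left_mono c')
      have "0 \<le> C' * (M * \<epsilon>)" using C'(1) M1 e by auto
      then show "norm (if i = 0 then a else coeff r' (i - 1)) \<le> \<epsilon> + C' * (M * \<epsilon>)"
        using a c'[of "i - 1"] e by (smt (verit))
    qed auto
    also have "\<dots> = C * \<epsilon>" by (simp add: C_def algebra_simps)
    finally show ?thesis .
  qed
  moreover have "C \<ge> 0" unfolding C_def using C'(1) M1 by simp
  ultimately show ?case by blast
qed

section \<open>Principal parts\<close>

text \<open>Induction on N, each step dividing \<open>h z - h \<xi>\<close> by z - \<xi>.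
  Removability of the singularity keeps the quotient holomorphic on all of D, so the remainder is
  global although the expansion is taken at one point.\<close>

lemma taylor_division:
  fixes k :: "complex \<Rightarrow> complex"
  assumes D: "open D" "\<xi> \<in> D" and k: "k holomorphic_on D"
  shows "\<exists>h c. h holomorphic_on D \<and> (\<forall>z\<in>D. k z = (z - \<xi>) ^ N * h z + (\<Sum>i<N. c i * (z - \<xi>) ^ i)) \<and>
           (0 < N \<longrightarrow> c 0 = k \<xi>)"
proof (induction N)
  case 0 then show ?case using k by (intro exI[of _ k]) auto
next
  case (Suc N)
  then obtain h c where hc: "h holomorphic_on D"
    "\<And>z. z \<in> D \<Longrightarrow> k z = (z - \<xi>) ^ N * h z + (\<Sum>i<N. c i * (z - \<xi>) ^ i)" "0 < N \<longrightarrow> c 0 = k \<xi>"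
    by blast
  define h' where "h' = (\<lambda>z. if z = \<xi> then deriv h \<xi> else (h z - h \<xi>) / (z - \<xi>))"
  have h': "h' holomorphic_on D" unfolding h'_def by (rule pole_lemma_open) (use hc D in auto)
  have *: "h z = h \<xi> + (z - \<xi>) * h' z" for z by (auto simp: h'_def)
  have "k z = (z - \<xi>) ^ Suc N * h' z + (\<Sum>i<Suc N. (c(N := h \<xi>)) i * (z - \<xi>) ^ i)" if "z \<in> D" for z
    using hc(2)[OF that] by (subst (asm) *) (simp add: algebra_simps)
  moreover have "(c(N := h \<xi>)) 0 = k \<xi>"
    using hc(2)[OF D(2)] hc(3) by (cases "N = 0") auto
  ultimately show ?case using h' by blast
qed

text \<open>The numerator may vanish at \<xi>, so N is only an upper bound for the pole order. This
  latitude is used where a pole arises from division by the system polynomial and its true order is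
  unknown.\<close>

definition pole_form :: "(complex \<Rightarrow> complex) \<Rightarrow> complex \<Rightarrow> nat \<Rightarrow> (complex \<Rightarrow> complex) \<Rightarrow> bool" where
  "pole_form g \<xi> N k \<longleftrightarrow> (\<exists>r>0. k holomorphic_on ball \<xi> r \<and> (\<forall>z\<in>ball \<xi> r - {\<xi>}. g z = k z / (z - \<xi>) ^ N))"

text \<open>The product \<open>(z - \<xi>) ^ N * g z\<close> extends holomorphically over \<xi>, and
  its first N Taylor terms, divided by \<open>(z - \<xi>) ^ N\<close>, form the principal part. The
  top coefficient is the value of the numerator at \<xi>, from which the exact order can be read
  off.\<close>

lemma principal_part_single:
  assumes D: "open D" "\<xi> \<in> D" and N: "1 \<le> N" and g: "g holomorphic_on D - {\<xi>}" and pf: "pole_form g \<xi> N k"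
  shows "\<exists>h c. h holomorphic_on D \<and> (\<forall>z\<in>D - {\<xi>}. g z = h z + (\<Sum>i=1..N. c i / (z - \<xi>) ^ i)) \<and> c N = k \<xi>"
proof -
  obtain r where r: "r > 0" "k holomorphic_on ball \<xi> r" "\<And>z. z \<in> ball \<xi> r - {\<xi>} \<Longrightarrow> g z = k z / (z - \<xi>) ^ N"
    using pf unfolding pole_form_def by blast
  define K where "K = (\<lambda>z. if z = \<xi> then k \<xi> else (z - \<xi>) ^ N * g z)"
  have "K holomorphic_on (D - {\<xi>}) \<union> (D \<inter> ball \<xi> r)"
  proof (rule holomorphic_on_Un)
    have "(\<lambda>z. (z - \<xi>) ^ N * g z) holomorphic_on D - {\<xi>}" by (intro holomorphic_intros g)
    then show "K holomorphic_on D - {\<xi>}" by (rule holomorphic_transform) (auto simp: K_def)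
    have "k holomorphic_on D \<inter> ball \<xi> r" using r(2) by (rule holomorphic_on_subset) auto
    then show "K holomorphic_on D \<inter> ball \<xi> r"
      by (rule holomorphic_transform) (use r(3) in \<open>auto simp: K_def\<close>)
  qed (use D in auto)
  moreover have "(D - {\<xi>}) \<union> (D \<inter> ball \<xi> r) = D" using r(1) by auto
  ultimately have "K holomorphic_on D" by simp
  then obtain h c where hc: "h holomorphic_on D"
    "\<And>z. z \<in> D \<Longrightarrow> K z = (z - \<xi>) ^ N * h z + (\<Sum>i<N. c i * (z - \<xi>) ^ i)" "0 < N \<longrightarrow> c 0 = K \<xi>"
    using taylor_division[OF D, of K N] by blast
  have "g z = h z + (\<Sum>i=1..N. c (N - i) / (z - \<xi>) ^ i)" if "z \<in> D - {\<xi>}" for z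
  proof -
    have nz: "z - \<xi> \<noteq> 0" using that by auto
    have "(z - \<xi>) ^ N * g z = (z - \<xi>) ^ N * h z + (\<Sum>i<N. c i * (z - \<xi>) ^ i)"
      using hc(2)[of z] that by (simp add: K_def)
    moreover have "(\<Sum>i<N. c i * (z - \<xi>) ^ i) = (z - \<xi>) ^ N * (\<Sum>i<N. c i / (z - \<xi>) ^ (N - i))"
      unfolding sum_distrib_left using nz by (intro sum.cong) (auto simp: power_diff)
    ultimately have "(z - \<xi>) ^ N * g z = (z - \<xi>) ^ N * (h z + (\<Sum>i<N. c i / (z - \<xi>) ^ (N - i)))"
      by (simp add: ring_distribs)
    then have "g z = h z + (\<Sum>i<N. c i / (z - \<xi>) ^ (N - i))" using nz by simp
    also have "(\<Sum>i<N. c i / (z - \<xi>) ^ (N - i)) = (\<Sum>i=1..N. c (N - i) / (z - \<xi>) ^ i)"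
      by (rule sum.reindex_bij_witness[of _ "\<lambda>i. N - i" "\<lambda>i. N - i"]) auto
    finally show ?thesis .
  qed
  moreover have "c (N - N) = k \<xi>" using hc(3) N by (simp add: K_def)
  ultimately show ?thesis using hc(1) by (intro exI[of _ h] exI[of _ "\<lambda>i. c (N - i)"]) auto
qed

lemma principal_parts:
  assumes "finite S" "open D" "S \<subseteq> D" "g holomorphic_on D - S"
    "\<And>\<xi>. \<xi> \<in> S \<Longrightarrow> 1 \<le> N \<xi>" "\<And>\<xi>. \<xi> \<in> S \<Longrightarrow> pole_form g \<xi> (N \<xi>) (k \<xi>)"
  shows "\<exists>h c. h holomorphic_on D \<and>
     (\<forall>z\<in>D - S. g z = h z + (\<Sum>\<xi>\<in>S. \<Sum>i=1..N \<xi>. c \<xi> i / (z - \<xi>) ^ i)) \<and> (\<forall>\<xi>\<in>S. c \<xi> (N \<xi>) = k \<xi> \<xi>)"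
  using assms
proof (induction S arbitrary: g k rule: finite_induct)
  case empty then show ?case by (intro exI[of _ g]) auto
next
  case (insert \<xi> S)
  have oD: "open (D - S)" using insert by (auto intro: open_Diff finite_imp_closed)
  have e: "D - S - {\<xi>} = D - insert \<xi> S" by auto
  obtain h1 c1 where h1: "h1 holomorphic_on D - S"
    "\<And>z. z \<in> D - insert \<xi> S \<Longrightarrow> g z = h1 z + (\<Sum>i=1..N \<xi>. c1 i / (z - \<xi>) ^ i)" "c1 (N \<xi>) = k \<xi> \<xi>"
  proof -
    have "\<xi> \<in> D - S" "1 \<le> N \<xi>" "g holomorphic_on D - S - {\<xi>}" "pole_form g \<xi> (N \<xi>) (k \<xi>)"
      using insert.hyps insert.prems by (simp_all add: e)
    from principal_part_single[OF oD this] show ?thesis unfolding e using that by blast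
  qed
  \<comment> \<open>Removing the principal part at \<xi> changes the numerator at another pole
    \<xi>' by a term that vanishes there, because \<open>1 \<le> N \<xi>'\<close>; the top
    coefficients therefore survive the induction.\<close>
  define k' where "k' \<xi>' = (\<lambda>z. k \<xi>' z - (z - \<xi>') ^ N \<xi>' * (\<Sum>i=1..N \<xi>. c1 i / (z - \<xi>) ^ i))" for \<xi>'
  have pf: "pole_form h1 \<xi>' (N \<xi>') (k' \<xi>')" if \<xi>': "\<xi>' \<in> S" for \<xi>'
  proof -
    obtain r where r: "r > 0" "k \<xi>' holomorphic_on ball \<xi>' r" "\<And>z. z \<in> ball \<xi>' r - {\<xi>'} \<Longrightarrow> g z = k \<xi>' z / (z - \<xi>') ^ N \<xi>'"
      using insert.prems(5)[of \<xi>'] \<xi>' unfolding pole_form_def by blast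
    have "open (D - (insert \<xi> S - {\<xi>'}))" using insert by (auto intro: open_Diff finite_imp_closed)
    moreover have "\<xi>' \<in> D - (insert \<xi> S - {\<xi>'})" using insert \<xi>' by auto
    ultimately obtain r' where r': "r' > 0" "ball \<xi>' r' \<subseteq> D - (insert \<xi> S - {\<xi>'})"
      unfolding open_contains_ball by blast
    have "\<xi> \<notin> ball \<xi>' r'" using r' \<xi>' insert.hyps by auto
    then have "k' \<xi>' holomorphic_on ball \<xi>' (min r r')"
      unfolding k'_def
      by (intro holomorphic_intros holomorphic_on_subset[OF r(2)]) auto
    moreover have "h1 z = k' \<xi>' z / (z - \<xi>') ^ N \<xi>'" if z: "z \<in> ball \<xi>' (min r r') - {\<xi>'}" for z
    proof -
      have "z \<in> D - insert \<xi> S" using z r' by auto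
      then have "h1 z = g z - (\<Sum>i=1..N \<xi>. c1 i / (z - \<xi>) ^ i)" using h1(2) by simp
      moreover have "g z = k \<xi>' z / (z - \<xi>') ^ N \<xi>'" using r(3) z by auto
      ultimately show ?thesis using z by (simp add: k'_def diff_divide_distrib)
    qed
    ultimately show ?thesis unfolding pole_form_def using r(1) r'(1)
      by (intro exI[of _ "min r r'"]) auto
  qed
  obtain h c where hc: "h holomorphic_on D"
    "\<And>z. z \<in> D - S \<Longrightarrow> h1 z = h z + (\<Sum>\<xi>\<in>S. \<Sum>i=1..N \<xi>. c \<xi> i / (z - \<xi>) ^ i)" "\<And>\<xi>. \<xi> \<in> S \<Longrightarrow> c \<xi> (N \<xi>) = k' \<xi> \<xi>"
  proof -
    have "\<exists>h c. h holomorphic_on D \<and>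
      (\<forall>z\<in>D - S. h1 z = h z + (\<Sum>\<xi>\<in>S. \<Sum>i=1..N \<xi>. c \<xi> i / (z - \<xi>) ^ i)) \<and> (\<forall>\<xi>\<in>S. c \<xi> (N \<xi>) = k' \<xi> \<xi>)"
    proof (rule insert.IH[OF insert.prems(1) _ h1(1) _ pf])
      show "S \<subseteq> D" using insert.prems(2) by simp
      show "1 \<le> N \<xi>'" if "\<xi>' \<in> S" for \<xi>' using insert.prems(4)[of \<xi>'] that by simp
    qed
    then show ?thesis using that by blast
  qed
  define c' where "c' = c(\<xi> := c1)"
  have "g z = h z + (\<Sum>\<xi>\<in>insert \<xi> S. \<Sum>i=1..N \<xi>. c' \<xi> i / (z - \<xi>) ^ i)" if z: "z \<in> D - insert \<xi> S" for z
  proof -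
    have "(\<Sum>\<xi>\<in>S. \<Sum>i=1..N \<xi>. c' \<xi> i / (z - \<xi>) ^ i) = (\<Sum>\<xi>\<in>S. \<Sum>i=1..N \<xi>. c \<xi> i / (z - \<xi>) ^ i)"
      using insert.hyps by (intro sum.cong) (auto simp: c'_def)
    then show ?thesis using h1(2)[OF z] hc(2)[of z] z insert.hyps by (simp add: c'_def)
  qed
  moreover have "c' \<eta> (N \<eta>) = k \<eta> \<eta>" if "\<eta> \<in> insert \<xi> S" for \<eta>
    using that h1(3) hc(3) insert.hyps insert.prems(4)[of \<eta>] by (auto simp: c'_def k'_def)
  ultimately show ?case using hc(1) by blast
qed

lemma pole_form_of_pole:
  assumes g: "g holomorphic_on U - {\<xi>}" "open U" "\<xi> \<in> U" "is_pole g \<xi>"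
  shows "pole_form g \<xi> (pole_order g \<xi>) (zor_poly g \<xi>)" "zor_poly g \<xi> \<xi> \<noteq> 0" "1 \<le> pole_order g \<xi>"
proof -
  have *: "zorder g \<xi> < 0" "zor_poly g \<xi> \<xi> \<noteq> 0"
    "\<exists>r>0. cball \<xi> r \<subseteq> U \<and> zor_poly g \<xi> holomorphic_on cball \<xi> r \<and>
       (\<forall>w\<in>cball \<xi> r - {\<xi>}. g w = zor_poly g \<xi> w / (w - \<xi>) ^ nat (- zorder g \<xi>) \<and> zor_poly g \<xi> w \<noteq> 0)"
    using zorder_exist_pole[OF g] by auto
  then show "zor_poly g \<xi> \<xi> \<noteq> 0" "1 \<le> pole_order g \<xi>" using g(4) by (auto simp: pole_order_def)
  obtain r where "r > 0" "zor_poly g \<xi> holomorphic_on cball \<xi> r"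
     "\<forall>w\<in>cball \<xi> r - {\<xi>}. g w = zor_poly g \<xi> w / (w - \<xi>) ^ nat (- zorder g \<xi>)" using *(3) by blast
  then show "pole_form g \<xi> (pole_order g \<xi>) (zor_poly g \<xi>)"
    unfolding pole_form_def pole_order_def using g(4)
    by (auto intro!: exI[of _ r] elim: holomorphic_on_subset)
qed

text \<open>Deleting the other poles from D isolates each pole, so the single-pole analysis applies
  there; off the poles a nicely meromorphic function is analytic. The nonzero top coefficients come
  from the nonzero values of the \<open>zor_poly\<close> factors.\<close>

lemma nicely_meromorphic_principal_parts:
  assumes D: "open D" and g: "g nicely_meromorphic_on D" and fin: "finite {z \<in> D. is_pole g z}"
  shows "\<exists>h c. h holomorphic_on D \<and> (\<forall>z\<in>D - {z \<in> D. is_pole g z}.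
     g z = h z + (\<Sum>\<xi>\<in>{z \<in> D. is_pole g z}. \<Sum>i=1..pole_order g \<xi>. c \<xi> i / (z - \<xi>) ^ i)) \<and>
     (\<forall>\<xi>\<in>{z \<in> D. is_pole g z}. c \<xi> (pole_order g \<xi>) \<noteq> 0 \<and> 1 \<le> pole_order g \<xi>)"
proof -
  define S where "S = {z \<in> D. is_pole g z}"
  have "g analytic_on {z}" if "z \<in> D - S" for z
    using nicely_meromorphic_on_imp_analytic_at[OF g] that by (auto simp: S_def)
  then have "g analytic_on D - S" using analytic_on_analytic_at[of g "D - S"] by blast
  then have hol: "g holomorphic_on D - S" by (rule analytic_imp_holomorphic)
  have *: "pole_form g \<xi> (pole_order g \<xi>) (zor_poly g \<xi>) \<and> zor_poly g \<xi> \<xi> \<noteq> 0 \<and> 1 \<le> pole_order g \<xi>" if \<xi>: "\<xi> \<in> S" for \<xi>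
  proof -
    have "open (D - (S - {\<xi>}))" using D fin by (auto simp: S_def intro: open_Diff finite_imp_closed)
    moreover have "g holomorphic_on (D - (S - {\<xi>})) - {\<xi>}" using hol by (rule holomorphic_on_subset) auto
    ultimately show ?thesis
      using pole_form_of_pole[of g "D - (S - {\<xi>})" \<xi>] \<xi> by (auto simp: S_def)
  qed
  have S: "finite S" "S \<subseteq> D" using fin by (auto simp: S_def)
  obtain h c where hc: "h holomorphic_on D"
     "\<forall>z\<in>D - S. g z = h z + (\<Sum>\<xi>\<in>S. \<Sum>i=1..pole_order g \<xi>. c \<xi> i / (z - \<xi>) ^ i)"
     "\<forall>\<xi>\<in>S. c \<xi> (pole_order g \<xi>) = zor_poly g \<xi> \<xi>"
    using principal_parts[OF S(1) D S(2) hol, of "pole_order g" "\<lambda>\<xi>. zor_poly g \<xi>"] * by blast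
  have "c \<xi> (pole_order g \<xi>) \<noteq> 0 \<and> 1 \<le> pole_order g \<xi>" if "\<xi> \<in> S" for \<xi>
    using hc(3)[rule_format, OF that] *[OF that] by argo
  then show ?thesis unfolding S_def[symmetric] using hc(1,2) by blast
qed

text \<open>Over the common denominator \<open>(z - \<xi>) ^ N\<close> the numerator takes the
  nonzero value \<open>c N\<close> at \<xi>.\<close>

lemma pole_order_principal_part:
  assumes D: "open D" "\<xi> \<in> D" and h: "h holomorphic_on D" and N: "1 \<le> N" "c N \<noteq> 0"
    and g: "\<And>z. z \<in> D - {\<xi>} \<Longrightarrow> g z = h z + (\<Sum>i=1..N. c i / (z - \<xi>) ^ i)"
  shows "is_pole g \<xi>" "pole_order g \<xi> = N"
proof -
  define G where "G = (\<lambda>z. (z - \<xi>) ^ N * h z + (\<Sum>i=1..N. c i * (z - \<xi>) ^ (N - i)))"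
  have G: "G holomorphic_on D" unfolding G_def by (intro holomorphic_intros h)
  have "(\<Sum>i=1..N. c i * (\<xi> - \<xi>) ^ (N - i)) = (\<Sum>i\<in>{N}. c i * (\<xi> - \<xi>) ^ (N - i))"
    using N by (intro sum.mono_neutral_right) auto
  moreover have "(\<xi> - \<xi>) ^ N = 0" using N by simp
  ultimately have "G \<xi> = c N" by (simp only: G_def) simp
  then have G0: "G \<xi> \<noteq> 0" using N by simp
  have eq: "g z = G z / (z - \<xi>) ^ N" if "z \<in> D" "z \<noteq> \<xi>" for z
  proof -
    have "(\<Sum>i=1..N. c i * (z - \<xi>) ^ (N - i)) = (z - \<xi>) ^ N * (\<Sum>i=1..N. c i / (z - \<xi>) ^ i)"
      unfolding sum_distrib_left using that by (intro sum.cong) (simp_all add: power_diff)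
    then have "G z = (z - \<xi>) ^ N * g z" using g[of z] that by (simp add: G_def ring_distribs)
    then show ?thesis using that by simp
  qed
  have "\<forall>\<^sub>F z in at \<xi>. z \<in> D - {\<xi>}" by (rule eventually_at_in_open[OF D])
  then have ev: "\<forall>\<^sub>F z in at \<xi>. g z = G z / (z - \<xi>) ^ N" by eventually_elim (use eq in auto)
  show p: "is_pole g \<xi>"
    using is_pole_basic[OF G D G0, of N] N is_pole_cong[OF ev refl] by simp
  have "zorder g \<xi> = - int N"
    by (rule zorder_eqI[OF D G G0]) (simp add: eq power_int_minus divide_inverse)
  then show "pole_order g \<xi> = N" using p by (simp add: pole_order_def)
qed

text \<open>The value 0 at the pole is the convention built into
  \<open>nicely_meromorphic_on\<close>; away from \<xi> the function is analytic.\<close>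

lemma nicely_meromorphic_on_single_pole:
  assumes D: "open D" and h: "h holomorphic_on D" and N: "1 \<le> N" "c N \<noteq> 0" and \<xi>: "\<xi> \<in> D"
    and g: "\<And>z. z \<in> D - {\<xi>} \<Longrightarrow> g z = h z + (\<Sum>i=1..N. c i / (z - \<xi>) ^ i)" and g0: "g \<xi> = 0"
  shows "g nicely_meromorphic_on D" "{z \<in> D. is_pole g z} = {\<xi>}" "pole_order g \<xi> = N"
proof -
  note p = pole_order_principal_part[OF D \<xi> h N g]
  have "(\<lambda>z. h z + (\<Sum>i=1..N. c i / (z - \<xi>) ^ i)) holomorphic_on D - {\<xi>}"
    by (intro holomorphic_intros holomorphic_on_subset[OF h]) auto
  then have "g holomorphic_on D - {\<xi>}" by (rule holomorphic_transform) (use g in auto)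
  then have an: "g analytic_on D - {\<xi>}" using D by (simp add: analytic_on_open open_delete)
  have "isolated_singularity_at g \<xi>"
  proof -
    obtain r where "r > 0" "ball \<xi> r \<subseteq> D" using D \<xi> open_contains_ball by blast
    then show ?thesis unfolding isolated_singularity_at_def
      by (intro exI[of _ r]) (auto intro: analytic_on_subset[OF an])
  qed
  moreover have "isolated_singularity_at g z" if "z \<in> D - {\<xi>}" for z
  proof -
    have "g analytic_on {z}" by (rule analytic_on_subset[OF an]) (use that in auto)
    then show ?thesis by (rule isolated_singularity_at_analytic)
  qed
  ultimately show "g nicely_meromorphic_on D"
    using nicely_meromorphic_onI_open[OF D an] p g0 by blast
  have "\<not> is_pole g z" if "z \<in> D - {\<xi>}" for z
    using an that by (meson analytic_at_imp_no_pole analytic_on_analytic_at)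
  then show "{z \<in> D. is_pole g z} = {\<xi>}" using p \<xi> by auto
  show "pole_order g \<xi> = N" by (rule p)
qed

section \<open>Geometry of the canonical domains\<close>

text \<open>The set is the image of I times the real line under polar coordinates.\<close>

lemma connected_norm_interval:
  fixes I :: "real set"
  assumes "connected I" "\<And>s. s \<in> I \<Longrightarrow> 0 \<le> s"
  shows "connected {w::complex. norm w \<in> I}"
proof -
  have "connected ((\<lambda>(s, t). of_real s * cis t) ` (I \<times> (UNIV :: real set)))"
    by (intro connected_continuous_image connected_Times assms)
       (auto simp: case_prod_beta intro!: continuous_intros)
  also have "(\<lambda>(s, t). of_real s * cis t) ` (I \<times> (UNIV :: real set)) = {w. norm w \<in> I}"
  proof (intro equalityI subsetI)
    fix w :: complex assume "w \<in> {w. norm w \<in> I}"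
    moreover have "w = of_real (norm w) * cis (Arg w)" by (metis rcis_cmod_Arg rcis_def)
    ultimately show "w \<in> (\<lambda>(s, t). of_real s * cis t) ` (I \<times> UNIV)"
      by (intro image_eqI[of _ _ "(norm w, Arg w)"]) auto
  qed (use assms(2) in \<open>auto simp: norm_mult\<close>)
  finally show ?thesis .
qed

locale exterior_domain =
  fixes E :: "complex set" and \<Phi> :: "complex \<Rightarrow> complex"
  assumes compact_E: "compact E" and E_nonempty: "E \<noteq> {}" and exterior: "exterior_map E \<Phi>"
begin

abbreviation D :: "ereal \<Rightarrow> complex set" where "D \<equiv> canon_dom E \<Phi>"

definition \<Psi> :: "complex \<Rightarrow> complex" where "\<Psi> = inv_into (- E) \<Phi>"

lemma holomorphic_Phi: "\<Phi> holomorphic_on - E"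
  and inj_Phi: "inj_on \<Phi> (- E)"
  and image_Phi: "\<Phi> ` (- E) = {w. 1 < norm w}"
  and Phi_at_infinity: "filterlim \<Phi> at_infinity at_infinity"
  using exterior unfolding exterior_map_def by auto

lemma open_compl_E: "open (- E)"
  using compact_E compact_imp_closed by auto

lemma continuous_Phi: "continuous_on (- E) \<Phi>"
  using holomorphic_Phi holomorphic_on_imp_continuous_on by blast

lemma Phi_gt_1: "z \<notin> E \<Longrightarrow> 1 < norm (\<Phi> z)"
  using image_Phi by auto

lemma Psi_notin: "1 < norm w \<Longrightarrow> \<Psi> w \<notin> E"
  unfolding \<Psi>_def using inv_into_into[of w \<Phi> "- E"] image_Phi by auto

lemma Phi_Psi: "1 < norm w \<Longrightarrow> \<Phi> (\<Psi> w) = w"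
  unfolding \<Psi>_def using f_inv_into_f[of w \<Phi> "- E"] image_Phi by auto

lemma Psi_Phi: "z \<notin> E \<Longrightarrow> \<Psi> (\<Phi> z) = z"
  unfolding \<Psi>_def using inj_Phi by simp

lemma holomorphic_Psi: "\<Psi> holomorphic_on {w. 1 < norm w}"
proof -
  obtain g where g: "g holomorphic_on (\<Phi> ` (- E))" "\<And>z. z \<in> - E \<Longrightarrow> g (\<Phi> z) = z"
    using holomorphic_has_inverse[OF holomorphic_Phi open_compl_E inj_Phi] by metis
  have "g holomorphic_on {w. 1 < norm w}" using g(1) image_Phi by simp
  then show ?thesis
    by (rule holomorphic_transform) (metis g(2) Phi_Psi Psi_notin ComplI mem_Collect_eq)
qed

lemma continuous_Psi: "continuous_on {w. 1 < norm w} \<Psi>"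
  using holomorphic_Psi holomorphic_on_imp_continuous_on by blast

lemma Psi_image:
  assumes "\<And>s. P s \<Longrightarrow> 1 < s"
  shows "{z. z \<notin> E \<and> P (norm (\<Phi> z))} = \<Psi> ` {w. P (norm w)}"
proof (intro equalityI subsetI)
  fix z assume "z \<in> {z. z \<notin> E \<and> P (norm (\<Phi> z))}"
  then show "z \<in> \<Psi> ` {w. P (norm w)}" by (intro image_eqI[of _ _ "\<Phi> z"]) (auto simp: Psi_Phi)
qed (use assms in \<open>auto simp: Psi_notin Phi_Psi\<close>)

lemma connected_level:
  assumes "connected {s. P s}" "\<And>s. P s \<Longrightarrow> 1 < s"
  shows "connected {z. z \<notin> E \<and> P (norm (\<Phi> z))}"
proof -
  have "connected {w::complex. norm w \<in> {s. P s}}"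
    using assms by (intro connected_norm_interval) force+
  then have "connected (\<Psi> ` {w. P (norm w)})"
    by (intro connected_continuous_image continuous_on_subset[OF continuous_Psi]) (use assms(2) in auto)
  then show ?thesis using Psi_image[of P] assms(2) by simp
qed

text \<open>Take a circle around E and a bound M for |\<Phi>| on it. The superlevel set {|\<Phi>| >
  M} is connected, misses the circle and has a point outside it, hence lies outside. So \<Psi> tends
  to infinity at infinity, which later keeps \<Phi> bounded on bounded sets.\<close>

lemma Psi_large: "\<exists>M>1. \<forall>w. M < norm w \<longrightarrow> R < norm (\<Psi> w)"
proof -
  obtain R0 where R0: "R0 > 0" "\<And>z. z \<in> E \<Longrightarrow> norm z < R0"
    using compact_imp_bounded[OF compact_E] unfolding bounded_pos
    by (metis add_strict_increasing2 norm_ge_zero le_less_trans less_add_one zero_less_one add_pos_pos)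
  define R' where "R' = max R R0"
  have R': "R' > 0" "R \<le> R'" "\<And>z. z \<in> E \<Longrightarrow> norm z < R'"
    using R0 unfolding R'_def by (auto simp: less_max_iff_disj)
  have sub: "sphere 0 R' \<subseteq> - E"
  proof
    fix z :: complex assume "z \<in> sphere 0 R'" then show "z \<in> - E" using R'(3)[of z] by auto
  qed
  have "compact (\<Phi> ` sphere 0 R')"
    by (intro compact_continuous_image continuous_on_subset[OF continuous_Phi sub]) auto
  then have "\<exists>M0. \<forall>w\<in>\<Phi> ` sphere 0 R'. norm w \<le> M0"
    using compact_imp_bounded bounded_iff by metis
  then obtain M0 where M0: "\<And>z. z \<in> sphere 0 R' \<Longrightarrow> norm (\<Phi> z) \<le> M0"
    by (meson imageI)
  define M where "M = max M0 2"
  have M: "M > 1" "\<And>z. z \<in> sphere 0 R' \<Longrightarrow> norm (\<Phi> z) \<le> M"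
    using M0 unfolding M_def by (auto simp: le_max_iff_disj)
  define A where "A = {z. z \<notin> E \<and> M < norm (\<Phi> z)}"
  have "connected A" unfolding A_def
    using M(1) by (intro connected_level) (auto simp: greaterThan_def[symmetric])
  then have conn: "connected (norm ` A)" by (intro connected_continuous_image continuous_intros)
  have "\<forall>\<^sub>F z in at_infinity. M + 1 \<le> norm (\<Phi> z)"
    using Phi_at_infinity unfolding filterlim_at_infinity_conv_norm_at_top filterlim_at_top by blast
  moreover have "\<forall>\<^sub>F z::complex in at_infinity. R' + 1 \<le> norm z" by (simp add: eventually_at_infinity) blast
  ultimately have "\<forall>\<^sub>F z in at_infinity. M + 1 \<le> norm (\<Phi> z) \<and> R' + 1 \<le> norm z" by (rule eventually_conj)
  then obtain z0 where z0: "M + 1 \<le> norm (\<Phi> z0)" "R' + 1 \<le> norm z0"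
    using eventually_happens trivial_limit_at_infinity by blast
  have z0A: "z0 \<in> A" using z0 R'(3)[of z0] by (auto simp: A_def)
  have "R < norm (\<Psi> w)" if "M < norm w" for w
  proof (rule ccontr)
    assume "\<not> R < norm (\<Psi> w)"
    then have le: "norm (\<Psi> w) \<le> R'" using R' by simp
    have "\<Psi> w \<in> A" using that M(1) by (simp add: A_def Psi_notin Phi_Psi)
    then have "R' \<in> norm ` A"
      using connectedD_interval[OF conn, of "norm (\<Psi> w)" "norm z0" R'] le z0 z0A by auto
    then obtain z where "z \<in> A" "norm z = R'" by auto
    then show False using M(2)[of z] by (simp add: A_def)
  qed
  then show ?thesis using M(1) by blast
qed

lemma canon_dom_mono: "r \<le> r' \<Longrightarrow> D r \<subseteq> D r'"
  unfolding canon_dom_def by (auto intro: less_le_trans)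

lemma E_subset_D: "E \<subseteq> D r"
  unfolding canon_dom_def by auto

text \<open>A convergent sequence in the set is bounded, so by the growth of \<Psi> its images under
  \<Phi> stay in a compact annulus r \<le> |w| \<le> M. The limit then lies in the compact
  \<Psi>-image of that annulus and cannot fall into E. Openness of \<open>D r\<close> follows by
  complementation.\<close>

lemma closed_upper: "1 < r \<Longrightarrow> closed {z. z \<notin> E \<and> r \<le> norm (\<Phi> z)}"
  unfolding closed_sequential_limits
proof (intro allI impI, elim conjE)
  fix X l assume r: "1 < r" and X: "\<forall>n. X n \<in> {z. z \<notin> E \<and> r \<le> norm (\<Phi> z)}" and lim: "X \<longlonglongrightarrow> l"
  obtain R where R: "\<And>n. norm (X n) \<le> R"
    using convergent_imp_bounded[OF lim] unfolding bounded_iff by auto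
  obtain M where M: "M > 1" "\<And>w. M < norm w \<Longrightarrow> R < norm (\<Psi> w)" using Psi_large by blast
  have "X n \<in> \<Psi> ` {w. r \<le> norm w \<and> norm w \<le> M}" for n
  proof (rule image_eqI)
    show "X n = \<Psi> (\<Phi> (X n))" using X by (simp add: Psi_Phi)
    then have "\<not> M < norm (\<Phi> (X n))" using M(2)[of "\<Phi> (X n)"] R[of n] by auto
    then show "\<Phi> (X n) \<in> {w. r \<le> norm w \<and> norm w \<le> M}" using X by auto
  qed
  moreover have "compact (\<Psi> ` {w. r \<le> norm w \<and> norm w \<le> M})"
  proof (intro compact_continuous_image continuous_on_subset[OF continuous_Psi])
    have "{w::complex. r \<le> norm w \<and> norm w \<le> M} = cball 0 M \<inter> - ball 0 r" by auto
    then show "compact {w::complex. r \<le> norm w \<and> norm w \<le> M}"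
      by (simp add: compact_Int_closed closed_Compl)
  qed (use r in auto)
  ultimately have "l \<in> \<Psi> ` {w. r \<le> norm w \<and> norm w \<le> M}"
    using lim compact_imp_closed closed_sequentially by metis
  then show "l \<in> {z. z \<notin> E \<and> r \<le> norm (\<Phi> z)}"
    using r by (auto simp: Psi_notin Phi_Psi)
qed

lemma open_D: "1 < r \<Longrightarrow> open (D r)"
proof (cases r)
  case (real s)
  assume "1 < r"
  then have "closed {z. z \<notin> E \<and> s \<le> norm (\<Phi> z)}" using real closed_upper[of s] by simp
  moreover have "D r = - {z. z \<notin> E \<and> s \<le> norm (\<Phi> z)}" using real by (auto simp: canon_dom_def)
  ultimately show ?thesis by (simp add: open_Compl)
next
  case PInf
  then have "D r = UNIV" by (auto simp: canon_dom_def)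
  then show ?thesis by simp
qed auto

text \<open>Only the part of K where |\<Phi>| is at least some t > 1 matters; it is compact and
  disjoint from E, so |\<Phi>| attains a maximum on it.\<close>

lemma compact_subset_D:
  assumes "1 < r" "compact K" "K \<subseteq> D r"
  shows "\<exists>s>1. ereal s < r \<and> K \<subseteq> D (ereal s)"
proof -
  obtain t where t: "1 < t" "ereal t < r"
    using assms(1) ereal_dense2[of 1 r] by auto
  define K0 where "K0 = K \<inter> {z. z \<notin> E \<and> t \<le> norm (\<Phi> z)}"
  have K0: "compact K0" unfolding K0_def using assms(2) closed_upper[OF t(1)] by (intro compact_Int_closed)
  show ?thesis
  proof (cases "K0 = {}")
    case True
    then have "K \<subseteq> D (ereal t)" unfolding K0_def canon_dom_def by auto
    then show ?thesis using t by blast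
  next
    case False
    have "continuous_on K0 (\<lambda>z. norm (\<Phi> z))"
      by (intro continuous_on_norm continuous_on_subset[OF continuous_Phi]) (auto simp: K0_def)
    then obtain m where m: "m \<in> K0" "\<And>z. z \<in> K0 \<Longrightarrow> norm (\<Phi> z) \<le> norm (\<Phi> m)"
      using continuous_attains_sup[OF K0 False] by blast
    have "ereal (norm (\<Phi> m)) < r" using m(1) assms(3) by (auto simp: K0_def canon_dom_def)
    then obtain s where s: "norm (\<Phi> m) < s" "ereal s < r" using ereal_dense2 less_ereal.simps(1) by blast
    have "t \<le> norm (\<Phi> m)" using m(1) by (simp add: K0_def)
    then have "K \<subseteq> D (ereal s)" using m(2) s by (fastforce simp: K0_def canon_dom_def)
    then show ?thesis using s \<open>t \<le> norm (\<Phi> m)\<close> t by (intro exI[of _ s]) auto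
  qed
qed

lemma bounded_D: "bounded (D (ereal r))"
proof -
  have "\<forall>\<^sub>F z in at_infinity. r \<le> norm (\<Phi> z)"
    using Phi_at_infinity unfolding filterlim_at_infinity_conv_norm_at_top filterlim_at_top by blast
  then obtain B where "\<And>z. B \<le> norm z \<Longrightarrow> r \<le> norm (\<Phi> z)" unfolding eventually_at_infinity by blast
  then have "norm z < B" if "norm (\<Phi> z) < r" for z using that by (meson not_le)
  then have "D (ereal r) \<subseteq> E \<union> ball 0 B" by (auto simp: canon_dom_def)
  then show ?thesis using compact_imp_bounded[OF compact_E] bounded_subset bounded_Un bounded_ball by metis
qed

lemma compact_sublevel: "compact (E \<union> {z. z \<notin> E \<and> norm (\<Phi> z) \<le> r})"
proof -
  have "open {z \<in> - E. \<Phi> z \<in> {w. r < norm w}}"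
    using continuous_open_preimage[OF continuous_Phi open_compl_E, of "{w. r < norm w}"]
    by (auto simp: open_Collect_less continuous_intros vimage_def Int_def)
  moreover have "E \<union> {z. z \<notin> E \<and> norm (\<Phi> z) \<le> r} = - {z \<in> - E. \<Phi> z \<in> {w. r < norm w}}" by auto
  ultimately have "closed (E \<union> {z. z \<notin> E \<and> norm (\<Phi> z) \<le> r})" by (simp add: closed_Compl)
  moreover have "E \<union> {z. z \<notin> E \<and> norm (\<Phi> z) \<le> r} \<subseteq> D (ereal (r + 1))" by (auto simp: canon_dom_def)
  ultimately show ?thesis using bounded_subset[OF bounded_D] compact_eq_bounded_closed by blast
qed

text \<open>The part of a slightly larger closed sublevel set that V leaves uncovered is compact and
  disjoint from E, so |\<Phi>| has a minimum there, which exceeds r. With r = 1 the lemma treats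
  arbitrary neighbourhoods of E.\<close>

lemma D_subset_neighbourhood:
  assumes "1 \<le> r" "open V" "E \<union> {z. z \<notin> E \<and> norm (\<Phi> z) \<le> r} \<subseteq> V"
  shows "\<exists>s>r. D (ereal s) \<subseteq> V"
proof -
  define X where "X = (E \<union> {z. z \<notin> E \<and> norm (\<Phi> z) \<le> r + 1}) - V"
  have X: "compact X" unfolding X_def by (intro compact_diff compact_sublevel assms)
  show ?thesis
  proof (cases "X = {}")
    case True
    then have "D (ereal (r + 1)) \<subseteq> V" unfolding X_def canon_dom_def by auto
    then show ?thesis by (intro exI[of _ "r + 1"]) auto
  next
    case False
    have XE: "X \<subseteq> - E" using assms(3) by (auto simp: X_def)
    have "continuous_on X (\<lambda>z. norm (\<Phi> z))"
      by (intro continuous_on_norm continuous_on_subset[OF continuous_Phi XE])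
    then obtain m where m: "m \<in> X" "\<And>z. z \<in> X \<Longrightarrow> norm (\<Phi> m) \<le> norm (\<Phi> z)"
      using continuous_attains_inf[OF X False] by blast
    have rm: "r < norm (\<Phi> m)" using m(1) XE assms(3) by (force simp: X_def)
    have "D (ereal (min (norm (\<Phi> m)) (r + 1))) \<subseteq> V"
    proof
      fix z assume z: "z \<in> D (ereal (min (norm (\<Phi> m)) (r + 1)))"
      show "z \<in> V"
      proof (rule ccontr)
        assume "z \<notin> V"
        then have "z \<in> X" "z \<notin> E" using z assms(3) by (auto simp: X_def canon_dom_def)
        then show False using m(2)[of z] z by (auto simp: canon_dom_def)
      qed
    qed
    then show ?thesis using rm by (intro exI[of _ "min (norm (\<Phi> m)) (r + 1)"]) auto
  qed
qed

lemma D_near_E: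
  assumes "open V" "E \<subseteq> V" shows "\<exists>s>1. D (ereal s) \<subseteq> V"
  by (rule D_subset_neighbourhood) (use assms Phi_gt_1 in \<open>auto simp: not_le[symmetric]\<close>)

text \<open>A point of the level curve is a limit of points obtained by shrinking its image under
  \<Phi> radially. Sole poles are defined through a neighbourhood of the closure of a canonical
  domain; this inclusion turns such a neighbourhood into a strictly larger canonical domain.\<close>

lemma sublevel_subset_closure:
  assumes "1 < r" shows "E \<union> {z. z \<notin> E \<and> norm (\<Phi> z) \<le> r} \<subseteq> closure (D (ereal r))"
proof
  fix z assume z: "z \<in> E \<union> {z. z \<notin> E \<and> norm (\<Phi> z) \<le> r}"
  show "z \<in> closure (D (ereal r))"
  proof (cases "z \<in> D (ereal r)")
    case True then show ?thesis using closure_subset by blast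
  next
    case False
    then have zr: "z \<notin> E" "norm (\<Phi> z) = r" using z by (auto simp: canon_dom_def)
    \<comment> \<open>The images under \<Phi> will have moduli r - (r - 1) / (n + 2), strictly
      between 1 and r: \<Psi> is applied within its domain and the points stay in
      \<open>D (ereal r)\<close>.\<close>
    define X where "X n = \<Psi> (of_real (1 - (1 - 1 / r) * inverse (of_nat (Suc (Suc n)))) * \<Phi> z)" for n
    have c: "0 < 1 - 1 / r" "1 - 1 / r < 1" using assms by auto
    have nrm: "norm (of_real (1 - (1 - 1 / r) * inverse (of_nat (Suc (Suc n)))) * \<Phi> z) = r - (r - 1) * inverse (of_nat (Suc (Suc n)))"
      (is "norm (of_real ?a * _) = _") for n
    proof -
      have "inverse (of_nat (Suc (Suc n))) < (1::real)" by (simp add: field_simps)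
      then have "(1 - 1 / r) * inverse (of_nat (Suc (Suc n))) < 1" using c
        by (metis mult_strict_mono' less_imp_le mult_1 inverse_nonnegative_iff_nonnegative of_nat_0_le_iff)
      then have "norm (of_real ?a * \<Phi> z) = ?a * r" using zr by (simp only: norm_mult norm_of_real)
      also have "(1 - (1 - 1 / r) * u) * r = r - (r - 1) * u" for u using assms by (simp add: field_simps)
      finally show ?thesis .
    qed
    have lt: "1 < r - (r - 1) * inverse (of_nat (Suc (Suc n)))" "r - (r - 1) * inverse (of_nat (Suc (Suc n))) < r" for n
    proof -
      have i: "inverse (of_nat (Suc (Suc n))) < (1::real)" "0 < inverse (of_nat (Suc (Suc n)) :: real)" by (simp_all add: field_simps)
      have "(r - 1) * inverse (of_nat (Suc (Suc n))) < (r - 1) * 1" using i assms by (intro mult_strict_left_mono) auto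
      then show "1 < r - (r - 1) * inverse (of_nat (Suc (Suc n)))" by simp
      show "r - (r - 1) * inverse (of_nat (Suc (Suc n))) < r" using mult_pos_pos[of "r - 1"] i assms by simp
    qed
    have "X n \<in> D (ereal r)" for n
      unfolding X_def canon_dom_def using lt[of n] nrm[of n] by (simp add: Psi_notin Phi_Psi)
    moreover have "X \<longlonglongrightarrow> z"
    proof -
      have "(\<lambda>n. inverse (of_nat (Suc (Suc n))) :: real) \<longlonglongrightarrow> 0"
        using LIMSEQ_inverse_real_of_nat by (rule LIMSEQ_Suc)
      then have "(\<lambda>n. of_real (1 - (1 - 1 / r) * inverse (of_nat (Suc (Suc n)))) * \<Phi> z) \<longlonglongrightarrow> of_real (1 - (1 - 1 / r) * 0) * \<Phi> z"
        by (intro tendsto_intros)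
      then have lim: "(\<lambda>n. of_real (1 - (1 - 1 / r) * inverse (of_nat (Suc (Suc n)))) * \<Phi> z) \<longlonglongrightarrow> \<Phi> z" by simp
      have "open {w::complex. 1 < norm w}" by (intro open_Collect_less continuous_intros)
      then have "isCont \<Psi> (\<Phi> z)"
        using continuous_Psi zr assms by (simp add: continuous_on_eq_continuous_at)
      then have "X \<longlonglongrightarrow> \<Psi> (\<Phi> z)" unfolding X_def using lim by (rule isCont_tendsto_compose)
      then show ?thesis using zr Psi_Phi by simp
    qed
    ultimately show ?thesis unfolding closure_sequential by blast
  qed
qed

text \<open>The annulus {1 < |\<Phi>| < r} is connected, so one of two separating sets misses it and
  meets \<open>D r\<close> only inside E. That piece is open, and closed as E minus the other set,
  hence it is the whole plane, contrary to the boundedness of E.\<close>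

lemma connected_D:
  assumes "1 < r" shows "connected (D r)"
proof (rule connectedI)
  fix A B assume AB: "open A" "open B" "A \<inter> D r \<noteq> {}" "B \<inter> D r \<noteq> {}" "A \<inter> B \<inter> D r = {}" "D r \<subseteq> A \<union> B"
  have "connected {s. 1 < s \<and> ereal s < r}"
    unfolding connected_iff_interval
  proof (intro ballI allI impI)
    fix x y z assume "x \<in> {s. 1 < s \<and> ereal s < r}" "y \<in> {s. 1 < s \<and> ereal s < r}" "x \<le> z" "z \<le> y"
    then have "1 < z" "ereal z \<le> ereal y" "ereal y < r" by auto
    then show "z \<in> {s. 1 < s \<and> ereal s < r}" using le_less_trans by blast
  qed
  then have conn: "connected {z. z \<notin> E \<and> 1 < norm (\<Phi> z) \<and> ereal (norm (\<Phi> z)) < r}"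
    by (intro connected_level) auto
  have no: False if U: "open A'" "open B'" "A' \<inter> D r \<noteq> {}" "A' \<inter> B' \<inter> D r = {}" "D r \<subseteq> A' \<union> B'"
    "A' \<inter> {z. z \<notin> E \<and> 1 < norm (\<Phi> z) \<and> ereal (norm (\<Phi> z)) < r} = {}" for A' B'
  proof -
    have sub: "A' \<inter> D r \<subseteq> E"
    proof
      fix z assume "z \<in> A' \<inter> D r" then show "z \<in> E" using U(6) Phi_gt_1[of z] by (auto simp: canon_dom_def)
    qed
    have "A' \<inter> D r = E - B'" using sub U(4,5) E_subset_D[of r] by fast
    then have "closed (A' \<inter> D r)" using compact_E U(2) by (simp add: closed_Diff compact_imp_closed)
    moreover have "open (A' \<inter> D r)" using U(1) open_D[OF assms] by (rule open_Int)
    ultimately have "A' \<inter> D r = UNIV" using U(3) clopen[of "A' \<inter> D r"] by auto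
    then have "E = UNIV" using sub by blast
    then show False using compact_imp_bounded[OF compact_E] not_bounded_UNIV by metis
  qed
  show False
  proof (cases "A \<inter> {z. z \<notin> E \<and> 1 < norm (\<Phi> z) \<and> ereal (norm (\<Phi> z)) < r} = {}")
    case True show False by (rule no[OF AB(1,2,3,5,6) True])
  next
    case False
    have "B \<inter> {z. z \<notin> E \<and> 1 < norm (\<Phi> z) \<and> ereal (norm (\<Phi> z)) < r} = {}"
    proof (rule ccontr)
      assume B: "B \<inter> {z. z \<notin> E \<and> 1 < norm (\<Phi> z) \<and> ereal (norm (\<Phi> z)) < r} \<noteq> {}"
      have "{z. z \<notin> E \<and> 1 < norm (\<Phi> z) \<and> ereal (norm (\<Phi> z)) < r} \<subseteq> D r" by (auto simp: canon_dom_def)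
      then have "A \<inter> B \<inter> {z. z \<notin> E \<and> 1 < norm (\<Phi> z) \<and> ereal (norm (\<Phi> z)) < r} = {}"
        "{z. z \<notin> E \<and> 1 < norm (\<Phi> z) \<and> ereal (norm (\<Phi> z)) < r} \<subseteq> A \<union> B" using AB(5,6) by fast+
      from connectedD[OF conn AB(1,2) this] show False using False B by simp
    qed
    moreover have "B \<inter> A \<inter> D r = {}" "D r \<subseteq> B \<union> A" using AB(5,6) by auto
    ultimately show False using no[OF AB(2,1,4)] by simp
  qed
qed

lemma holomorphic_unique:
  assumes "1 < r" "f holomorphic_on D r" "g holomorphic_on D r" "agree_near E f g" "z \<in> D r"
  shows "f z = g z"
proof -
  obtain V where V: "open V" "E \<subseteq> V" "\<And>z. z \<in> V \<Longrightarrow> f z = g z" using assms(4) unfolding agree_near_def by blast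
  show ?thesis
    by (rule analytic_continuation_open[of "V \<inter> D r" "D r" f g])
       (use V assms E_nonempty E_subset_D[of r] open_D connected_D in auto)
qed

text \<open>The identity theorem, applied to the difference with its removable singularities filled
  in, gives equality on punctured neighbourhoods only. Equality at the point itself follows because
  nicely meromorphic functions are 0 at poles and equal their limit elsewhere.\<close>

lemma nicely_meromorphic_unique:
  assumes r: "1 < r" and fg: "f nicely_meromorphic_on D r" "g nicely_meromorphic_on D r"
    and ag: "agree_near E f g" and z: "z \<in> D r"
  shows "f z = g z"
proof -
  obtain V where V: "open V" "E \<subseteq> V" "\<And>z. z \<in> V \<Longrightarrow> f z = g z" using ag unfolding agree_near_def by blast
  obtain e where e: "e \<in> E" using E_nonempty by auto
  have mero: "(\<lambda>z. f z - g z) meromorphic_on D r"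
    using fg by (intro meromorphic_intros) (auto simp: nicely_meromorphic_on_def)
  define h where "h = remove_sings (\<lambda>z. f z - g z)"
  have h: "h nicely_meromorphic_on D r" unfolding h_def using mero by (rule remove_sings_nicely_meromorphic)
  have "h w = 0" if "w \<in> V" for w
  proof -
    have "\<forall>\<^sub>F z in at w. z \<in> V" using V(1) that by (intro eventually_at_in_open') auto
    then have "\<forall>\<^sub>F z in at w. f z - g z = 0" by eventually_elim (use V in auto)
    then have "((\<lambda>z. f z - g z) \<longlongrightarrow> 0) (at w)" by (rule tendsto_eventually)
    then show ?thesis unfolding h_def by (rule remove_sings_eqI)
  qed
  moreover have "\<forall>\<^sub>F z in at e. z \<in> V" using V e by (intro eventually_at_in_open') auto
  ultimately have "\<forall>\<^sub>F z in at e. h z = 0" by (auto elim: eventually_mono)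
  then have "\<exists>\<^sub>F z in at e. h z = 0" by (intro eventually_frequently) auto
  then have h0: "h w = 0" if "w \<in> D r" for w
    using frequently_eq_meromorphic_imp_constant[OF _ h open_D[OF r] connected_D[OF r]] e E_subset_D that by blast
  have "\<forall>\<^sub>F w in at z. h w = f w - g w" unfolding h_def
    using mero z by (intro eventually_remove_sings_eq_at meromorphic_on_isolated_singularity) (auto intro: meromorphic_on_subset)
  moreover have "\<forall>\<^sub>F w in at z. w \<in> D r" using z open_D[OF r] by (intro eventually_at_in_open') auto
  ultimately have ev: "\<forall>\<^sub>F w in at z. f w = g w" by eventually_elim (use h0 in auto)
  show ?thesis
  proof (cases "is_pole f z")
    case True
    then have "is_pole g z" using is_pole_cong[OF ev refl] by simp
    then have "\<not> (f \<midarrow>z\<rightarrow> f z)" "\<not> (g \<midarrow>z\<rightarrow> g z)" using True unfolding is_pole_def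
      by (auto dest: not_tendsto_and_filterlim_at_infinity[rotated])
    then have "f z = 0" "g z = 0" using fg z unfolding nicely_meromorphic_on_def by blast+
    then show ?thesis by simp
  next
    case False
    then have "\<not> is_pole g z" using is_pole_cong[OF ev refl] by simp
    then have "f \<midarrow>z\<rightarrow> f z" "g \<midarrow>z\<rightarrow> g z" using False fg z unfolding nicely_meromorphic_on_def by auto
    then have "f \<midarrow>z\<rightarrow> g z" using tendsto_cong[OF ev] by simp
    then show ?thesis using \<open>f \<midarrow>z\<rightarrow> f z\<close> tendsto_unique at_neq_bot by metis
  qed
qed

end

section \<open>Cauchy's formula on the level curves\<close>

context exterior_domain
begin

lemma open_gt1: "open {w::complex. 1 < norm w}"
  by (intro open_Collect_less continuous_intros)

definition level_curve :: "real \<Rightarrow> real \<Rightarrow> complex" where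
  "level_curve r = \<Psi> \<circ> circlepath 0 r"

lemma level_curve:
  assumes r: "1 < r"
  shows "valid_path (level_curve r)" "pathfinish (level_curve r) = pathstart (level_curve r)"
    "path_image (level_curve r) = {z. z \<notin> E \<and> norm (\<Phi> z) = r}"
proof -
  have im: "path_image (circlepath 0 r) = {w. norm w = r}" using r by (auto simp: path_image_circlepath)
  then show "valid_path (level_curve r)"
    unfolding level_curve_def using r
    by (intro valid_path_compose_holomorphic[OF valid_path_circlepath holomorphic_Psi open_gt1]) auto
  show "pathfinish (level_curve r) = pathstart (level_curve r)"
    by (simp add: level_curve_def pathfinish_compose pathstart_compose)
  have "path_image (level_curve r) = \<Psi> ` {w. norm w = r}"
    unfolding level_curve_def path_image_compose im ..
  also have "\<dots> = {z. z \<notin> E \<and> norm (\<Phi> z) = r}" using Psi_image[of "\<lambda>s. s = r"] r by simp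
  finally show "path_image (level_curve r) = {z. z \<notin> E \<and> norm (\<Phi> z) = r}" .
qed

text \<open>The superlevel set beyond r is connected and reaches arbitrarily far out, where the
  winding number vanishes.\<close>

lemma winding_number_level_curve_outside:
  assumes r: "1 < r" and z: "z \<notin> E" "r < norm (\<Phi> z)"
  shows "winding_number (level_curve r) z = 0"
proof -
  define S where "S = {z. z \<notin> E \<and> r < norm (\<Phi> z)}"
  have S: "connected S" unfolding S_def using r by (intro connected_level) (auto simp: greaterThan_def[symmetric])
  have path: "path (level_curve r)" using level_curve(1)[OF r] by (rule valid_path_imp_path)
  obtain B where B: "\<And>z. B \<le> norm z \<Longrightarrow> winding_number (level_curve r) z = 0"
    using winding_number_zero_at_infinity[OF path level_curve(2)[OF r]] by blast
  obtain M where M: "M > 1" "\<And>w. M < norm w \<Longrightarrow> B < norm (\<Psi> w)" using Psi_large by blast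
  define w where "w = (of_real (max M r + 1) :: complex)"
  have "norm w = max M r + 1" unfolding w_def norm_of_real using M(1) by simp
  then have w: "M < norm w" "r < norm w" "1 < norm w" using r by auto
  have "\<Psi> w \<in> S" unfolding S_def using w by (simp add: Psi_notin Phi_Psi)
  moreover have "z \<in> S" using z by (simp add: S_def)
  ultimately have "winding_number (level_curve r) z = winding_number (level_curve r) (\<Psi> w)"
    by (intro winding_number_eq[OF path level_curve(2)[OF r] _ _ S]) (auto simp: level_curve(3)[OF r] S_def)
  then show ?thesis using B[of "\<Psi> w"] M(2)[OF w(1)] by simp
qed

text \<open>In the coordinate \<open>u = 1 / w\<close> the function \<open>u (\<Psi> (1 / u) - z)\<close> extends to the unit disc without zeros.
  Hence \<open>\<Psi>' / (\<Psi> - z)\<close> is \<open>1 / w\<close> plus the derivative of a single-valued function.\<close>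
lemma winding_number_level_curve_inside:
  assumes r: "1 < r" and z: "z \<in> E"
  shows "winding_number (level_curve r) z = 1"
proof -
  obtain c where c: "0 < c" "((\<lambda>z. \<Phi> z / z) \<longlongrightarrow> complex_of_real c) at_infinity"
    using exterior unfolding exterior_map_def by blast
  \<comment> \<open>The value at 0 is the limit of u \<Psi> (1 / u), the reciprocal of the
    derivative c of \<Phi> at infinity.\<close>
  define f where "f u = (if u = 0 then 1 / complex_of_real c else u * (\<Psi> (1 / u) - z))" for u
  have inv1: "1 < norm (1 / u)" if "u \<in> ball 0 1 - {0}" for u :: complex
    using that by (simp add: norm_divide field_simps)
  have Psi_inf: "filterlim (\<lambda>u. \<Psi> (1 / u)) at_infinity (at 0)"
    unfolding filterlim_at_infinity_conv_norm_at_top filterlim_at_top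
  proof
    fix R
    obtain M where M: "M > 1" "\<And>w. M < norm w \<Longrightarrow> R < norm (\<Psi> w)" using Psi_large by blast
    have "\<forall>\<^sub>F u::complex in at 0. u \<in> ball 0 (1 / M) - {0}"
      by (rule eventually_at_in_open) (use M in auto)
    then show "\<forall>\<^sub>F u in at 0. R \<le> norm (\<Psi> (1 / u))"
    proof eventually_elim
      case (elim u)
      then have "M < norm (1 / u)" using M(1) by (simp add: norm_divide field_simps)
      then show ?case using M(2) less_imp_le by blast
    qed
  qed
  have "((\<lambda>u. \<Phi> (\<Psi> (1 / u)) / \<Psi> (1 / u)) \<longlongrightarrow> complex_of_real c) (at 0)"
    by (rule filterlim_compose[OF c(2) Psi_inf])
  then have "((\<lambda>u. inverse (\<Phi> (\<Psi> (1 / u)) / \<Psi> (1 / u))) \<longlongrightarrow> inverse (complex_of_real c)) (at 0)"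
    using c(1) by (intro tendsto_inverse) auto
  moreover have ev: "\<forall>\<^sub>F u::complex in at 0. u \<in> ball 0 1 - {0}" by (rule eventually_at_in_open) auto
  then have "\<forall>\<^sub>F u in at 0. inverse (\<Phi> (\<Psi> (1 / u)) / \<Psi> (1 / u)) = u * \<Psi> (1 / u)"
  proof eventually_elim
    case (elim u) then show ?case using Phi_Psi[OF inv1[OF elim]] by simp
  qed
  ultimately have "((\<lambda>u. u * \<Psi> (1 / u)) \<longlongrightarrow> inverse (complex_of_real c)) (at 0)"
    using tendsto_cong by fastforce
  then have "((\<lambda>u. u * \<Psi> (1 / u) - u * z) \<longlongrightarrow> inverse (complex_of_real c) - 0 * z) (at 0)"
    by (intro tendsto_intros)
  then have "((\<lambda>u. u * \<Psi> (1 / u) - u * z) \<longlongrightarrow> f 0) (at 0)" by (simp add: f_def inverse_eq_divide)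
  moreover have "\<forall>\<^sub>F u in at 0. u * \<Psi> (1 / u) - u * z = f u"
    using ev by eventually_elim (auto simp: f_def algebra_simps)
  ultimately have f0: "(f \<longlongrightarrow> f 0) (at 0)" using tendsto_cong by fastforce
  have holf: "f holomorphic_on ball 0 1"
  proof (rule no_isolated_singularity'[of "{0}"])
    have "(\<lambda>u. \<Psi> (1 / u)) holomorphic_on ball 0 1 - {0}"
      unfolding o_def[symmetric, of \<Psi> "\<lambda>u. 1 / u"]
      by (rule holomorphic_on_compose_gen[OF _ holomorphic_Psi]) (use inv1 in \<open>auto intro!: holomorphic_intros\<close>)
    then have "(\<lambda>u. u * (\<Psi> (1 / u) - z)) holomorphic_on ball 0 1 - {0}" by (intro holomorphic_intros)
    then show "f holomorphic_on ball 0 1 - {0}" by (rule holomorphic_transform) (simp add: f_def)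
    show "(f \<longlongrightarrow> f u) (at u within ball 0 1)" if "u \<in> {0}" for u
      using f0 that by (auto intro: tendsto_within_subset)
  qed auto
  have fnz: "f u \<noteq> 0" if "u \<in> ball 0 1" for u
    using Psi_notin[OF inv1, of u] z that c(1) by (auto simp: f_def)
  have "(\<lambda>u. deriv f u / f u) holomorphic_on ball 0 1"
    by (intro holomorphic_intros holomorphic_deriv holf fnz) auto
  then obtain \<Lambda> where \<Lambda>: "\<And>u. u \<in> ball 0 1 \<Longrightarrow> (\<Lambda> has_field_derivative deriv f u / f u) (at u within ball 0 1)"
    using holomorphic_convex_primitive'[of "ball 0 1" "\<lambda>u. deriv f u / f u"] by auto
  have inv2: "1 / w \<in> ball 0 1" "w \<noteq> 0" if "1 < norm w" for w :: complex
  proof -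
    show "w \<noteq> 0" using that by auto
    then show "1 / w \<in> ball 0 1" using that by (simp add: norm_divide divide_less_eq)
  qed
  \<comment> \<open>The logarithmic derivative of the product
    \<open>\<Psi> w - z = w * f (1 / w)\<close>.\<close>
  have eq: "deriv \<Psi> w * (1 / (\<Psi> w - z)) = 1 / w + deriv f (1 / w) / f (1 / w) * (- 1 / w\<^sup>2)" if w: "1 < norm w" for w
  proof -
    have w0: "w \<noteq> 0" using inv2[OF w] by simp
    have P: "\<Psi> v = v * f (1 / v) + z" if "1 < norm v" for v using inv2[OF that] by (simp add: f_def)
    have "(f has_field_derivative deriv f (1 / w)) (at (1 / w))"
      using holf inv2[OF w] by (simp add: holomorphic_derivI)
    then have "((\<lambda>v. v * f (1 / v) + z) has_field_derivative
        (1 * f (1 / w) + deriv f (1 / w) * (- 1 / w\<^sup>2) * w) + 0) (at w)"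
      using w0 by (auto intro!: derivative_eq_intros DERIV_chain2[of f _ _ w] simp: power2_eq_square)
    moreover have "\<forall>\<^sub>F v in nhds w. v * f (1 / v) + z = \<Psi> v"
      using eventually_nhds_in_open[OF open_gt1, of w] w by (auto elim!: eventually_mono simp: P)
    ultimately have "(\<Psi> has_field_derivative f (1 / w) + deriv f (1 / w) * (- 1 / w\<^sup>2) * w) (at w)"
      by (subst (asm) DERIV_cong_ev) auto
    then have d: "deriv \<Psi> w = f (1 / w) + deriv f (1 / w) * (- 1 / w\<^sup>2) * w" by (rule DERIV_imp_deriv)
    have "\<Psi> w - z = w * f (1 / w)" using P[OF w] by simp
    then show ?thesis using fnz[OF inv2(1)[OF w]] w0 unfolding d by (simp add: field_simps power2_eq_square)
  qed
  have im: "path_image (circlepath 0 r) = {w. norm w = r}" using r by (auto simp: path_image_circlepath)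
  have "((\<lambda>w. deriv f (1 / w) / f (1 / w) * (- 1 / w\<^sup>2)) has_contour_integral 0) (circlepath 0 r)"
  proof (rule Cauchy_theorem_primitive)
    show "((\<lambda>w. \<Lambda> (1 / w)) has_field_derivative deriv f (1 / w) / f (1 / w) * (- 1 / w\<^sup>2)) (at w within {w. 1 < norm w})"
      if "w \<in> {w. 1 < norm w}" for w
    proof -
      have w: "1 < norm w" using that by simp
      have "(\<Lambda> has_field_derivative deriv f (1 / w) / f (1 / w)) (at (1 / w))"
        using \<Lambda>[OF inv2(1)[OF w]] unfolding at_within_open[OF inv2(1)[OF w] open_ball] .
      moreover have "((\<lambda>w. 1 / w) has_field_derivative - 1 / w\<^sup>2) (at w within {w. 1 < norm w})"
        using inv2(2)[OF w] by (auto intro!: derivative_eq_intros simp: power2_eq_square)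
      ultimately show ?thesis by (rule DERIV_chain2)
    qed
  qed (use r im in auto)
  moreover have "((\<lambda>w. 1 / w) has_contour_integral 2 * of_real pi * \<i>) (circlepath 0 r)"
  proof -
    have "(\<lambda>w. 1 / w) contour_integrable_on circlepath 0 r"
      by (rule contour_integrable_holomorphic_simple[of _ "- {0}"]) (use r im in \<open>auto intro!: holomorphic_intros\<close>)
    from has_contour_integral_integral[OF this] show ?thesis
      using contour_integral_circlepath[of r 0] r by simp
  qed
  ultimately have "((\<lambda>w. 1 / w + deriv f (1 / w) / f (1 / w) * (- 1 / w\<^sup>2)) has_contour_integral 2 * of_real pi * \<i> + 0) (circlepath 0 r)"
    by (rule has_contour_integral_add[rotated])
  then have "((\<lambda>w. deriv \<Psi> w * (1 / (\<Psi> w - z))) has_contour_integral 2 * of_real pi * \<i> + 0) (circlepath 0 r)"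
    by (rule has_contour_integral_eq) (use eq im r in auto)
  then have ci: "contour_integral (circlepath 0 r) (\<lambda>w. deriv \<Psi> w * (1 / (\<Psi> w - z))) = 2 * of_real pi * \<i>"
    by (simp add: contour_integral_unique)
  have "winding_number (level_curve r) z = 1 / (2 * of_real pi * \<i>) * contour_integral (level_curve r) (\<lambda>w. 1 / (w - z))"
    using level_curve[OF r] z by (subst winding_number_valid_path) auto
  also have "contour_integral (level_curve r) (\<lambda>w. 1 / (w - z)) = contour_integral (circlepath 0 r) (\<lambda>w. deriv \<Psi> w * (1 / (\<Psi> w - z)))"
    unfolding level_curve_def
    by (rule contour_integral_comp_analyticW[of _ "{w. 1 < norm w}"])
       (use holomorphic_Psi open_gt1 r im in \<open>auto simp: analytic_on_open\<close>)
  finally show ?thesis unfolding ci by simp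
qed

lemma Cauchy_level_curve:
  assumes r: "1 < r" "ereal r < \<rho>" and f: "f holomorphic_on D \<rho>" and z: "z \<in> E"
  shows "((\<lambda>w. f w / (w - z)) has_contour_integral (2 * pi * \<i> * f z)) (level_curve r)"
proof -
  have r1: "1 < \<rho>" using r by (metis less_ereal.simps(1) less_trans one_ereal_def)
  have "((\<lambda>w. f w / (w - z)) has_contour_integral (2 * pi * \<i> * winding_number (level_curve r) z * f z)) (level_curve r)"
  proof (rule Cauchy_integral_formula_global[OF open_D[OF r1] f])
    show "z \<in> D \<rho>" using z E_subset_D by blast
    show "path_image (level_curve r) \<subseteq> D \<rho> - {z}"
      using level_curve(3)[OF r(1)] z r(2) by (auto simp: canon_dom_def)
    show "winding_number (level_curve r) w = 0" if "w \<notin> D \<rho>" for w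
    proof (rule winding_number_level_curve_outside[OF r(1)])
      show "w \<notin> E" using that E_subset_D by blast
      have "\<rho> \<le> ereal (norm (\<Phi> w))" using that by (auto simp: canon_dom_def not_less)
      with r(2) have "ereal r < ereal (norm (\<Phi> w))" by (rule less_le_trans)
      then show "r < norm (\<Phi> w)" by simp
    qed
  qed (use level_curve[OF r(1)] in auto)
  then show ?thesis using winding_number_level_curve_inside[OF r(1) z] by simp
qed

text \<open>Cauchy's formula over [0, 1] with a continuous density independent of z, the form in
  which it can be integrated against \<mu>.\<close>

lemma Cauchy_level_curve_integral:
  assumes r: "1 < r" "ereal r < \<rho>" and f: "f holomorphic_on D \<rho>"
  obtains b :: "real \<Rightarrow> complex" where "continuous_on {0..1} b"
    "\<And>z. z \<in> E \<Longrightarrow> ((\<lambda>t. b t / (level_curve r t - z)) has_integral f z) {0..1}"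
proof -
  define a where "a t = (2 * pi * \<i> * r * exp (2 * of_real pi * \<i> * t)) * deriv \<Psi> (circlepath 0 r t)" for t :: real
  define b where "b t = f (level_curve r t) * a t / (2 * pi * \<i>)" for t
  have cp: "circlepath 0 r t \<in> {w. 1 < norm w}" for t
    using r by (simp add: circlepath norm_mult)
  have der: "(level_curve r has_vector_derivative a t) (at t)" for t
    unfolding level_curve_def a_def
    by (rule field_vector_diff_chain_at[OF has_vector_derivative_circlepath])
       (use holomorphic_derivI[OF holomorphic_Psi open_gt1] cp in auto)
  have cc: "continuous_on {0..1} (circlepath 0 r)" by (auto simp: circlepath intro!: continuous_intros)
  have "continuous_on {w. 1 < norm w} (deriv \<Psi>)"
    by (intro holomorphic_on_imp_continuous_on holomorphic_deriv holomorphic_Psi open_gt1)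
  then have "continuous_on {0..1} (\<lambda>t. deriv \<Psi> (circlepath 0 r t))"
    by (rule continuous_on_compose2[OF _ cc]) (use cp in auto)
  then have ca: "continuous_on {0..1} a" unfolding a_def by (intro continuous_intros)
  have lc: "continuous_on {0..1} (level_curve r)"
    unfolding level_curve_def o_def by (rule continuous_on_compose2[OF continuous_Psi cc]) (use cp in auto)
  have "level_curve r t \<in> D \<rho>" if "t \<in> {0..1}" for t
  proof -
    have "level_curve r t \<in> path_image (level_curve r)" using that by (simp add: path_image_def)
    then show ?thesis unfolding level_curve(3)[OF r(1)] using r(2) by (simp add: canon_dom_def)
  qed
  then have "continuous_on {0..1} (\<lambda>t. f (level_curve r t))"
    by (intro continuous_on_compose2[OF holomorphic_on_imp_continuous_on[OF f] lc]) auto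
  then have "continuous_on {0..1} b" unfolding b_def using ca by (intro continuous_intros) auto
  moreover have "((\<lambda>t. b t / (level_curve r t - z)) has_integral f z) {0..1}" if z: "z \<in> E" for z
  proof -
    have "((\<lambda>t. f (level_curve r t) / (level_curve r t - z) * vector_derivative (level_curve r) (at t within {0..1}))
        has_integral 2 * pi * \<i> * f z) {0..1}"
      using Cauchy_level_curve[OF r f z] unfolding has_contour_integral_def .
    then have "((\<lambda>t. 1 / (2 * pi * \<i>) * (f (level_curve r t) / (level_curve r t - z) * vector_derivative (level_curve r) (at t within {0..1})))
        has_integral 1 / (2 * pi * \<i>) * (2 * pi * \<i> * f z)) {0..1}"
      by (rule has_integral_mult_right)
    moreover have "1 / (2 * pi * \<i>) * (2 * pi * \<i> * f z) = f z" by simp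
    ultimately show ?thesis
    proof (rule has_integral_eq[rotated, OF back_subst[of "\<lambda>x. (_ has_integral x) _"]])
      fix t :: real assume t: "t \<in> {0..1}"
      have "vector_derivative (level_curve r) (at t within {0..1}) = a t"
        using der t by (intro vector_derivative_at_within_ivl) auto
      then show "1 / (2 * pi * \<i>) * (f (level_curve r t) / (level_curve r t - z) * vector_derivative (level_curve r) (at t within {0..1}))
        = b t / (level_curve r t - z)" by (simp add: b_def)
    qed
  qed
  ultimately show ?thesis using that by blast
qed

end

section \<open>Cauchy transforms\<close>

lemma closed_msupport: "closed (msupport \<mu>)"
proof -
  have "- msupport \<mu> = \<Union> {U. open U \<and> emeasure \<mu> U = 0}"
    unfolding msupport_def by (auto simp: zero_less_iff_neq_zero)
  then have "open (- msupport \<mu>)" by (simp add: open_Union)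
  then show ?thesis by (simp add: closed_def)
qed

text \<open>The complement of the support is a union of open null sets, and by the Lindelof property
  countably many of them suffice.\<close>

lemma null_compl_msupport:
  assumes "sets \<mu> = sets borel" shows "emeasure \<mu> (- msupport \<mu>) = 0"
proof -
  define \<F> where "\<F> = {U. open U \<and> emeasure \<mu> U = 0}"
  have eq: "- msupport \<mu> = \<Union> \<F>"
    unfolding msupport_def \<F>_def by (auto simp: zero_less_iff_neq_zero)
  obtain \<G> where G: "\<G> \<subseteq> \<F>" "countable \<G>" "\<Union> \<G> = \<Union> \<F>"
    using Lindelof[of \<F>] unfolding \<F>_def by auto
  have "(\<Union>U\<in>\<G>. U) \<in> null_sets \<mu>"
    by (rule null_sets_UN') (use G assms in \<open>auto simp: \<F>_def null_sets_def\<close>)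
  then show ?thesis using eq G(3) by (auto simp: null_sets_def)
qed

text \<open>Fubini turns the integral of f g into an integral over the curve of b times the Cauchy
  transform of g. The kernel is measurable and integrable because it is continuous on the compact
  product of S and [0, 1], outside which it is set to 0.\<close>

lemma Cauchy_kernel_bound:
  fixes S :: "complex set" and b l :: "real \<Rightarrow> complex"
  assumes fin: "finite_measure \<mu>" and sets: "sets \<mu> = sets borel" and S: "compact S"
    and b: "continuous_on {0..1} b" and l: "continuous_on {0..1} l" and ne: "\<And>t z. t \<in> {0..1} \<Longrightarrow> z \<in> S \<Longrightarrow> l t \<noteq> z"
    and f: "\<And>z. z \<in> S \<Longrightarrow> ((\<lambda>t. b t / (l t - z)) has_integral f z) {0..1}"
    and g: "continuous_on S g" and M: "\<And>t. t \<in> {0..1} \<Longrightarrow> norm (b t) \<le> M"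
    and B: "\<And>t. t \<in> {0..1} \<Longrightarrow> norm (LINT z:S|\<mu>. g z / (l t - z)) \<le> B"
  shows "norm (LINT z:S|\<mu>. f z * g z) \<le> M * B"
proof -
  interpret finite_measure \<mu> by (rule fin)
  interpret P: pair_sigma_finite \<mu> "lborel :: real measure" ..
  define k :: "complex \<Rightarrow> real \<Rightarrow> complex" where
    "k z t = indicator (S \<times> {0..1}) (z, t) *\<^sub>R (b t / (l t - z) * g z)" for z t
  have closed: "closed S" using S by (rule compact_imp_closed)
  have setsP: "sets (\<mu> \<Otimes>\<^sub>M lborel) = sets (borel :: (complex \<times> real) measure)"
  proof -
    have "sets (\<mu> \<Otimes>\<^sub>M (lborel :: real measure)) = sets ((borel :: complex measure) \<Otimes>\<^sub>M (borel :: real measure))"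
      by (intro sets_pair_measure_cong sets sets_lborel)
    then show ?thesis by (simp only: borel_prod)
  qed
  have cont: "continuous_on (S \<times> {0..1}) (\<lambda>x. b (snd x) / (l (snd x) - fst x) * g (fst x))"
  proof (intro continuous_intros)
    show "continuous_on (S \<times> {0..1}) (\<lambda>x. b (snd x))" by (rule continuous_on_compose2[OF b]) (auto intro!: continuous_intros)
    show "continuous_on (S \<times> {0..1}) (\<lambda>x. l (snd x))" by (rule continuous_on_compose2[OF l]) (auto intro!: continuous_intros)
    show "continuous_on (S \<times> {0..1}) (\<lambda>x. g (fst x))" by (rule continuous_on_compose2[OF g]) (auto intro!: continuous_intros)
  qed (use ne in auto)
  have comp: "compact (S \<times> {0..1::real})" using S by (intro compact_Times) auto
  then have "bounded ((\<lambda>x. b (snd x) / (l (snd x) - fst x) * g (fst x)) ` (S \<times> {0..1}))"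
    by (intro compact_imp_bounded compact_continuous_image cont)
  then obtain K where K: "\<And>x. x \<in> S \<times> {0..1} \<Longrightarrow> norm (b (snd x) / (l (snd x) - fst x) * g (fst x)) \<le> K"
    unfolding bounded_iff by (meson imageI)
  have SI: "S \<times> {0..1::real} \<in> sets borel" using comp by (simp add: borel_closed compact_imp_closed)
  have kmeas: "case_prod k \<in> borel_measurable (\<mu> \<Otimes>\<^sub>M lborel)"
  proof -
    have "(\<lambda>x. indicator (S \<times> {0..1}) x *\<^sub>R (b (snd x) / (l (snd x) - fst x) * g (fst x))) \<in> borel_measurable borel"
      by (rule borel_measurable_continuous_on_indicator[OF SI cont])
    moreover have "(\<lambda>x. indicator (S \<times> {0..1}) x *\<^sub>R (b (snd x) / (l (snd x) - fst x) * g (fst x))) = case_prod k"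
      by (auto simp: k_def)
    ultimately show ?thesis unfolding measurable_cong_sets[OF setsP refl] by simp
  qed
  have int: "integrable (\<mu> \<Otimes>\<^sub>M lborel) (case_prod k)"
  proof (rule integrableI_bounded_set[where A = "S \<times> {0..1::real}" and B = K])
    show "S \<times> {0..1::real} \<in> sets (\<mu> \<Otimes>\<^sub>M lborel)" using SI unfolding setsP .
    have "S \<in> sets \<mu>" using closed sets by simp
    then have "emeasure (\<mu> \<Otimes>\<^sub>M lborel) (S \<times> {0..1::real}) = emeasure \<mu> S * emeasure lborel {0..1::real}"
      by (intro lborel.emeasure_pair_measure_Times) auto
    then show "emeasure (\<mu> \<Otimes>\<^sub>M lborel) (S \<times> {0..1::real}) < \<infinity>"
      by (simp add: less_top[symmetric])
    show "AE x in \<mu> \<Otimes>\<^sub>M lborel. x \<in> S \<times> {0..1} \<longrightarrow> norm (case_prod k x) \<le> K"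
      using K by (auto simp: k_def)
    show "AE x in \<mu> \<Otimes>\<^sub>M lborel. x \<notin> S \<times> {0..1} \<longrightarrow> case_prod k x = 0"
      by (auto simp: k_def indicator_def)
  qed (rule kmeas)
  have "(LINT z:S|\<mu>. f z * g z) = (LINT z|\<mu>. LINT t|lborel. k z t)"
    unfolding set_lebesgue_integral_def
  proof (rule Bochner_Integration.integral_cong[OF refl])
    fix z assume "z \<in> space \<mu>"
    show "indicator S z *\<^sub>R (f z * g z) = (LINT t|lborel. k z t)"
    proof (cases "z \<in> S")
      case True
      have "continuous_on {0..1} (\<lambda>t. b t / (l t - z))"
        using b l ne[OF _ True] by (intro continuous_intros) auto
      then have si: "set_integrable lborel {0..1} (\<lambda>t. b t / (l t - z))" by (rule borel_integrable_atLeastAtMost')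
      have "(LINT t:{0..1}|lborel. b t / (l t - z)) = integral {0..1} (\<lambda>t. b t / (l t - z))"
        by (rule set_borel_integral_eq_integral(2)[OF si])
      also have "\<dots> = f z" using f[OF True] by (rule integral_unique)
      finally have "f z * g z = (LINT t|lborel. indicator {0..1} t *\<^sub>R (b t / (l t - z))) * g z"
        by (simp add: set_lebesgue_integral_def)
      also have "\<dots> = (LINT t|lborel. (indicator {0..1} t *\<^sub>R (b t / (l t - z))) * g z)"
        by (rule integral_mult_left_zero[symmetric])
      also have "\<dots> = (LINT t|lborel. k z t)"
        by (rule Bochner_Integration.integral_cong[OF refl]) (use True in \<open>simp add: k_def indicator_def\<close>)
      finally show ?thesis using True by simp
    qed (simp add: k_def)
  qed
  also have "\<dots> = (LINT t|lborel. LINT z|\<mu>. k z t)" using P.Fubini_integral[OF int] by simp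
  finally have eq: "(LINT z:S|\<mu>. f z * g z) = (LINT t|lborel. LINT z|\<mu>. k z t)" .
  have kt: "(LINT z|\<mu>. k z t) = indicator {0..1} t *\<^sub>R (b t * (LINT z:S|\<mu>. g z / (l t - z)))" for t
  proof -
    have "(LINT z|\<mu>. k z t) = (LINT z|\<mu>. (indicator {0..1} t *\<^sub>R b t) * (indicator S z *\<^sub>R (g z / (l t - z))))"
      by (rule Bochner_Integration.integral_cong[OF refl]) (simp add: k_def indicator_def)
    also have "\<dots> = (indicator {0..1} t *\<^sub>R b t) * (LINT z|\<mu>. indicator S z *\<^sub>R (g z / (l t - z)))"
      by (rule integral_mult_right_zero)
    finally show ?thesis by (simp add: set_lebesgue_integral_def)
  qed
  have "norm (LINT t|lborel. LINT z|\<mu>. k z t) \<le> (LINT t|lborel. indicator {0..1::real} t *\<^sub>R (M * B))"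
  proof (rule order_trans[OF integral_norm_bound integral_mono])
    show "integrable lborel (\<lambda>t. norm (LINT z|\<mu>. k z t))"
      using P.integrable_snd[OF int] by (rule integrable_norm)
    show "integrable lborel (\<lambda>t. indicator {0..1::real} t *\<^sub>R (M * B))" by (simp add: integrable_mult_left_iff)
    fix t :: real
    show "norm (LINT z|\<mu>. k z t) \<le> indicator {0..1} t *\<^sub>R (M * B)"
    proof (cases "t \<in> {0..1}")
      case True
      have "norm (b t) * norm (LINT z:S|\<mu>. g z / (l t - z)) \<le> M * B"
        using M[OF True] B[OF True] order_trans[OF norm_ge_zero M[OF True]] by (intro mult_mono) auto
      then show ?thesis using True unfolding kt by (simp add: norm_mult)
    qed (simp add: kt)
  qed
  also have "\<dots> = M * B" by simp
  finally show ?thesis unfolding eq .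
qed

locale measured_domain = exterior_domain +
  fixes \<mu> :: "complex measure"
  assumes admissible: "admissible_measure E \<mu>"
begin

abbreviation "X \<equiv> msupport \<mu>"

lemma finite_mu: "finite_measure \<mu>" and sets_mu: "sets \<mu> = sets borel"
  and infinite_X: "infinite X" and X_subset: "X \<subseteq> E"
  using admissible by (auto simp: admissible_measure_def)

lemma compact_X: "compact X"
  using compact_Int_closed[OF compact_E closed_msupport, of \<mu>] X_subset by (simp add: Int_absorb1)

lemma sets_X: "X \<in> sets \<mu>"
  using sets_mu closed_msupport by simp

lemma set_integrable_X:
  assumes "continuous_on E f" shows "set_integrable \<mu> X (f :: complex \<Rightarrow> complex)"
  unfolding set_integrable_def
proof -
  have f: "continuous_on X f" using assms X_subset continuous_on_subset by blast
  have "bounded (f ` X)" by (intro compact_imp_bounded compact_continuous_image f compact_X)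
  then obtain B where B: "\<And>z. z \<in> X \<Longrightarrow> norm (f z) \<le> B" unfolding bounded_iff by (meson imageI)
  show "integrable \<mu> (\<lambda>z. indicator X z *\<^sub>R f z)"
  proof (rule integrableI_bounded_set[OF sets_X, where B = B])
    have "(\<lambda>z. indicator X z *\<^sub>R f z) \<in> borel_measurable borel"
      by (rule borel_measurable_continuous_on_indicator[OF _ f]) (use closed_msupport in simp)
    then show "(\<lambda>z. indicator X z *\<^sub>R f z) \<in> borel_measurable \<mu>"
      unfolding measurable_cong_sets[OF sets_mu refl] .
    show "emeasure \<mu> X < \<infinity>" using finite_measure.emeasure_finite[OF finite_mu, of X] by (simp add: less_top)
  qed (use B in \<open>auto simp: indicator_def\<close>)
qed

lemma norm_set_integral_X_le:
  assumes f: "continuous_on E f" and B: "\<And>z. z \<in> E \<Longrightarrow> norm (f z :: complex) \<le> B"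
  shows "norm (LINT z:X|\<mu>. f z) \<le> B * measure \<mu> X"
proof -
  have "norm (LINT z|\<mu>. indicator X z *\<^sub>R f z) \<le> (LINT z|\<mu>. indicator X z *\<^sub>R B)"
  proof (rule order_trans[OF integral_norm_bound integral_mono])
    show "integrable \<mu> (\<lambda>z. norm (indicator X z *\<^sub>R f z))"
      using set_integrable_X[OF f] unfolding set_integrable_def by (rule integrable_norm)
    show "integrable \<mu> (\<lambda>z. indicator X z *\<^sub>R B)"
      using sets_X finite_measure.emeasure_finite[OF finite_mu, of X]
      by (auto simp: integrable_mult_left_iff less_top integrable_real_indicator)
  qed (use B X_subset in \<open>auto simp: indicator_def\<close>)
  also have "\<dots> = B * measure \<mu> X" using sets_X by simp
  finally show ?thesis by (simp add: set_lebesgue_integral_def)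
qed

text \<open>The constant depends only on f and r. With g the conjugate of \<open>p n\<close> the
  transform is the second type function, so one M serves all n.\<close>

lemma Cauchy_transform_bound:
  assumes r: "1 < r" "ereal r < \<rho>" and f: "f holomorphic_on D \<rho>"
  shows "\<exists>M\<ge>0. \<forall>g B. continuous_on E g \<longrightarrow>
     (\<forall>w. w \<notin> E \<and> norm (\<Phi> w) = r \<longrightarrow> norm (LINT z:X|\<mu>. g z / (w - z)) \<le> B) \<longrightarrow>
     norm (LINT z:X|\<mu>. f z * g z) \<le> M * B"
proof -
  obtain b where b: "continuous_on {0..1} b"
    "\<And>z. z \<in> E \<Longrightarrow> ((\<lambda>t. b t / (level_curve r t - z)) has_integral f z) {0..1}"
    using Cauchy_level_curve_integral[OF r f] by blast
  have "bounded (b ` {0..1})" by (intro compact_imp_bounded compact_continuous_image b) auto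
  then obtain M where M: "\<And>t. t \<in> {0..1} \<Longrightarrow> norm (b t) \<le> M" unfolding bounded_iff by (meson imageI)
  have lc: "continuous_on {0..1} (level_curve r)"
    using level_curve(1)[OF r(1)] valid_path_imp_path path_def by blast
  have lcE: "level_curve r t \<notin> E \<and> norm (\<Phi> (level_curve r t)) = r" if "t \<in> {0..1}" for t
  proof -
    have "level_curve r t \<in> path_image (level_curve r)" using that by (simp add: path_image_def)
    then show ?thesis unfolding level_curve(3)[OF r(1)] by simp
  qed
  have "norm (LINT z:X|\<mu>. f z * g z) \<le> M * B"
    if g: "continuous_on E g" and B: "\<forall>w. w \<notin> E \<and> norm (\<Phi> w) = r \<longrightarrow> norm (LINT z:X|\<mu>. g z / (w - z)) \<le> B" for g B
  proof (rule Cauchy_kernel_bound[OF finite_mu sets_mu compact_X b(1) lc])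
    show "level_curve r t \<noteq> z" if "t \<in> {0..1}" "z \<in> X" for t z using lcE[OF that(1)] that(2) X_subset by blast
    show "((\<lambda>t. b t / (level_curve r t - z)) has_integral f z) {0..1}" if "z \<in> X" for z
      using b(2) that X_subset by blast
    show "continuous_on X g" using g X_subset by (rule continuous_on_subset)
    show "norm (LINT z:X|\<mu>. g z / (level_curve r t - z)) \<le> B" if "t \<in> {0..1}" for t
      using lcE[OF that] B by blast
  qed (use M in auto)
  moreover have "M \<ge> 0" using order_trans[OF norm_ge_zero M[of 0]] by simp
  ultimately show ?thesis by blast
qed

end

section \<open>Vanishing of Cauchy transforms and uniqueness for orthogonal expansions\<close>

context measured_domain
begin

lemma set_integral_X_cong:
  assumes "\<And>z. z \<in> E \<Longrightarrow> f z = g z"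
  shows "(LINT z:X|\<mu>. f z) = (LINT z:X|\<mu>. g z)"
  using assms X_subset by (intro set_lebesgue_integral_cong sets_X) auto

lemma set_integral_X_add:
  fixes f g :: "complex \<Rightarrow> complex"
  assumes "continuous_on E f" "continuous_on E g"
  shows "(LINT z:X|\<mu>. f z + g z) = (LINT z:X|\<mu>. f z) + (LINT z:X|\<mu>. g z)"
  by (intro set_integral_add set_integrable_X assms)

lemma set_integral_X_sum:
  fixes f :: "'i \<Rightarrow> complex \<Rightarrow> complex"
  assumes "\<And>i. i \<in> I \<Longrightarrow> continuous_on E (f i)"
  shows "(LINT z:X|\<mu>. \<Sum>i\<in>I. f i z) = (\<Sum>i\<in>I. LINT z:X|\<mu>. f i z)"
  using assms
proof (induction I rule: infinite_finite_induct)
  case (insert i I)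
  then show ?case by (simp add: set_integral_X_add continuous_on_sum)
qed (simp_all add: set_lebesgue_integral_def)

text \<open>Differentiation under the integral, done by hand: the error of the difference quotient
  is an integral whose integrand carries a factor h, and the denominators are bounded below because
  w keeps its distance from E.\<close>

lemma Cauchy_transform_holomorphic:
  assumes g: "continuous_on E g"
  shows "(\<lambda>w. LINT z:X|\<mu>. g z / (w - z)) holomorphic_on - E"
proof -
  obtain G where G: "\<And>z. z \<in> E \<Longrightarrow> norm (g z) \<le> G"
    using compact_imp_bounded[OF compact_continuous_image[OF g compact_E]] unfolding bounded_iff by (meson imageI)
  have G0: "G \<ge> 0" using E_nonempty G norm_ge_zero order_trans by blast
  define C where "C = (\<lambda>w. LINT z:X|\<mu>. g z / (w - z))"
  have "(C has_field_derivative - (LINT z:X|\<mu>. g z / (w - z)\<^sup>2)) (at w)" if w: "w \<notin> E" for w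
  proof -
    \<comment> \<open>The radius 2 e lets both w and w + h keep distance e from E when |h| <
      e.\<close>
    obtain e where e: "e > 0" "ball w (2 * e) \<subseteq> - E"
      using open_compl_E w open_contains_ball[of "- E"] by (metis ComplI mult.commute field_sum_of_halves half_gt_zero mult_2)
    have far: "norm (w + h - z) \<ge> e" "norm (w - z) \<ge> e" if "norm h < e" "z \<in> E" for h z
    proof -
      have "z \<notin> ball w (2 * e)" using e that by blast
      then have d: "norm (w - z) \<ge> 2 * e" by (simp add: dist_norm)
      then show "norm (w - z) \<ge> e" using e by linarith
      have "norm (w - z) - norm h \<le> norm (w + h - z)"
        using norm_triangle_ineq4[of "w + h - z" h] by (simp add: algebra_simps)
      then show "norm (w + h - z) \<ge> e" using d that by linarith
    qed
    have bound: "norm ((C (w + h) - C w) / h - (- (LINT z:X|\<mu>. g z / (w - z)\<^sup>2))) \<le> (G / e ^ 3 * measure \<mu> X) * norm h"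
      if h: "h \<noteq> 0" "norm h < e" for h
    proof -
      have ne: "w + h - z \<noteq> 0" "w - z \<noteq> 0" if "z \<in> E" for z using far[OF h(2) that] e(1) by auto
      have c1: "continuous_on E (\<lambda>z. g z / (w + h - z))" "continuous_on E (\<lambda>z. g z / (w - z))"
        "continuous_on E (\<lambda>z. g z / (w - z)\<^sup>2)" "continuous_on E (\<lambda>z. g z * (h / ((w + h - z) * (w - z)\<^sup>2)))"
        using ne by (auto intro!: continuous_intros g)
      \<comment> \<open>Partial fractions of h / ((u + h) u^2) in u = w - z split the error term
        into the difference quotient and the term of the claimed derivative.\<close>
      have "(LINT z:X|\<mu>. g z * (h / ((w + h - z) * (w - z)\<^sup>2))) =
            (LINT z:X|\<mu>. (1 / h) * (g z / (w + h - z)) + ((- 1 / h) * (g z / (w - z)) + g z / (w - z)\<^sup>2))"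
      proof (rule set_integral_X_cong)
        fix z assume z: "z \<in> E"
        define u where "u = w - z"
        have nu: "u + h \<noteq> 0" "u \<noteq> 0" using ne[OF z] by (simp_all add: u_def algebra_simps)
        have "h / ((u + h) * u\<^sup>2) = (1 / h) * (1 / (u + h)) + ((- 1 / h) * (1 / u) + 1 / u\<^sup>2)"
          using nu h(1) by (simp add: divide_simps power2_eq_square) (simp add: algebra_simps)
        then have "g z * (h / ((u + h) * u\<^sup>2)) = (1 / h) * (g z / (u + h)) + ((- 1 / h) * (g z / u) + g z / u\<^sup>2)"
          by (simp add: ring_distribs)
        moreover have e: "w + h - z = u + h" by (simp add: u_def)
        ultimately show "g z * (h / ((w + h - z) * (w - z)\<^sup>2)) = (1 / h) * (g z / (w + h - z)) + ((- 1 / h) * (g z / (w - z)) + g z / (w - z)\<^sup>2)"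
          unfolding e u_def[symmetric] by simp
      qed
      also have "\<dots> = (1 / h) * C (w + h) + ((- 1 / h) * C w + (LINT z:X|\<mu>. g z / (w - z)\<^sup>2))"
        unfolding C_def
          set_integral_X_add[OF continuous_on_mult_left[OF c1(1)]
            continuous_on_add[OF continuous_on_mult_left[OF c1(2)] c1(3)]]
          set_integral_X_add[OF continuous_on_mult_left[OF c1(2)] c1(3)]
          set_integral_mult_right ..
      also have "\<dots> = (C (w + h) - C w) / h - (- (LINT z:X|\<mu>. g z / (w - z)\<^sup>2))" by (simp add: diff_divide_distrib)
      finally have eq: "(C (w + h) - C w) / h - (- (LINT z:X|\<mu>. g z / (w - z)\<^sup>2)) = (LINT z:X|\<mu>. g z * (h / ((w + h - z) * (w - z)\<^sup>2)))" ..
      have "norm (LINT z:X|\<mu>. g z * (h / ((w + h - z) * (w - z)\<^sup>2))) \<le> (G * (norm h / (e * e\<^sup>2))) * measure \<mu> X"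
      proof (rule norm_set_integral_X_le[OF c1(4)])
        fix z assume z: "z \<in> E"
        have "e * e\<^sup>2 \<le> norm (w + h - z) * (norm (w - z))\<^sup>2"
          using far[OF h(2) z] e(1) by (intro mult_mono power_mono) auto
        then have "norm (h / ((w + h - z) * (w - z)\<^sup>2)) \<le> norm h / (e * e\<^sup>2)"
          using e(1) ne[OF z] by (simp add: norm_divide norm_mult norm_power frac_le)
        then show "norm (g z * (h / ((w + h - z) * (w - z)\<^sup>2))) \<le> G * (norm h / (e * e\<^sup>2))"
          unfolding norm_mult using G[OF z] G0 by (intro mult_mono) auto
      qed
      then show ?thesis unfolding eq by (simp add: power2_eq_square power3_eq_cube mult_ac)
    qed
    have "((\<lambda>h. (C (w + h) - C w) / h - (- (LINT z:X|\<mu>. g z / (w - z)\<^sup>2))) \<longlongrightarrow> 0) (at 0)"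
    proof (rule Lim_null_comparison)
      have "\<forall>\<^sub>F h::complex in at 0. h \<in> ball 0 e - {0}" by (rule eventually_at_in_open) (use e in auto)
      then show "\<forall>\<^sub>F h in at 0. norm ((C (w + h) - C w) / h - (- (LINT z:X|\<mu>. g z / (w - z)\<^sup>2))) \<le> (G / e ^ 3 * measure \<mu> X) * norm h"
        by eventually_elim (rule bound, auto)
      have "((\<lambda>h::complex. (G / e ^ 3 * measure \<mu> X) * norm h) \<longlongrightarrow> (G / e ^ 3 * measure \<mu> X) * norm (0::complex)) (at 0)"
        by (intro tendsto_intros)
      then show "((\<lambda>h::complex. (G / e ^ 3 * measure \<mu> X) * norm h) \<longlongrightarrow> 0) (at 0)" by simp
    qed
    then show ?thesis unfolding DERIV_def by (rule LIM_zero_cancel)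
  qed
  then show ?thesis unfolding C_def[symmetric]
    by (auto simp: holomorphic_on_def field_differentiable_def intro: has_field_derivative_at_within)
qed

text \<open>The Cauchy transform vanishes near infinity, hence on the connected set \<open>- E\<close>.\<close>
lemma Cauchy_transform_zero:
  assumes g: "continuous_on E g" and orth: "\<And>q. (LINT z:X|\<mu>. g z * poly q z) = 0" and w: "w \<notin> E"
  shows "(LINT z:X|\<mu>. g z / (w - z)) = 0"
proof -
  define C where "C = (\<lambda>w. LINT z:X|\<mu>. g z / (w - z))"
  obtain G where G: "\<And>z. z \<in> E \<Longrightarrow> norm (g z) \<le> G"
    using compact_imp_bounded[OF compact_continuous_image[OF g compact_E]] unfolding bounded_iff by (meson imageI)
  have G0: "G \<ge> 0" using E_nonempty G norm_ge_zero order_trans by blast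
  obtain R where R: "R > 0" "\<And>z. z \<in> E \<Longrightarrow> norm z \<le> R"
    using compact_imp_bounded[OF compact_E] bounded_pos by metis
  have C0: "C w = 0" if w: "w \<in> {w. 2 * R < norm w}" for w
  proof -
    have w': "2 * R < norm w" "w \<noteq> 0" using w R(1) by auto
    have wE: "w - z \<noteq> 0" "norm (w - z) \<ge> R" if "z \<in> E" for z
    proof -
      have "norm w - norm z \<le> norm (w - z)" by (rule norm_triangle_ineq2)
      then show "norm (w - z) \<ge> R" using R(2)[OF that] w' by linarith
      then show "w - z \<noteq> 0" using R(1) by auto
    qed
    \<comment> \<open>Truncated geometric expansion of 1 / (w - z): the polynomial terms integrate
      to 0 by orthogonality, and the remainder is of size (1 / 2)^n because 2 |z| \<le> |w| for z in
      E.\<close>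
    have step: "C w = (LINT z:X|\<mu>. g z * ((z / w) ^ n / (w - z)))" for n
    proof (induction n)
      case (Suc n)
      have c: "continuous_on E (\<lambda>z. g z * ((z / w) ^ n / (w - z)))" for n
        using wE w'(2) by (auto intro!: continuous_intros g)
      have "(LINT z:X|\<mu>. g z * ((z / w) ^ n / (w - z))) =
            (LINT z:X|\<mu>. g z * poly (monom (1 / w ^ Suc n) n) z + g z * ((z / w) ^ Suc n / (w - z)))"
      proof (rule set_integral_X_cong)
        fix z assume z: "z \<in> E"
        have "(z / w) ^ n / (w - z) = z ^ n / w ^ Suc n + (z / w) ^ Suc n / (w - z)"
          using wE(1)[OF z] w'(2) by (simp add: field_simps power_divide)
        then show "g z * ((z / w) ^ n / (w - z)) = g z * poly (monom (1 / w ^ Suc n) n) z + g z * ((z / w) ^ Suc n / (w - z))"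
          by (simp add: poly_monom ring_distribs)
      qed
      also have "\<dots> = (LINT z:X|\<mu>. g z * poly (monom (1 / w ^ Suc n) n) z) + (LINT z:X|\<mu>. g z * ((z / w) ^ Suc n / (w - z)))"
        by (intro set_integral_X_add c continuous_intros g)
      finally show ?case using Suc orth by simp
    qed (simp add: C_def)
    have "norm (C w) \<le> (G * ((1 / 2) ^ n / R)) * measure \<mu> X" for n
      unfolding step[of n]
    proof (rule norm_set_integral_X_le)
      show "continuous_on E (\<lambda>z. g z * ((z / w) ^ n / (w - z)))"
        using wE w'(2) by (auto intro!: continuous_intros g)
      fix z assume z: "z \<in> E"
      have "0 < norm w" "norm z \<le> 1 / 2 * norm w" using R(2)[OF z] w' by auto
      then have "norm (z / w) \<le> 1 / 2" unfolding norm_divide by (subst pos_divide_le_eq)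
      then have "norm ((z / w) ^ n / (w - z)) \<le> (1 / 2) ^ n / R"
        unfolding norm_divide[of "(z / w) ^ n"] norm_power using wE(2)[OF z] R(1) by (intro frac_le power_mono) (auto simp: less_imp_le)
      then show "norm (g z * ((z / w) ^ n / (w - z))) \<le> G * ((1 / 2) ^ n / R)"
        unfolding norm_mult using G[OF z] G0 by (intro mult_mono) auto
    qed
    moreover have "(\<lambda>n. (G * ((1 / 2) ^ n / R)) * measure \<mu> X) \<longlonglongrightarrow> (G * (0 / R)) * measure \<mu> X"
      by (intro tendsto_intros LIMSEQ_power_zero) (use R(1) in auto)
    ultimately have "norm (C w) \<le> (G * (0 / R)) * measure \<mu> X"
      by (intro tendsto_lowerbound[of _ _ sequentially]) auto
    then show ?thesis by simp
  qed
  have "C w = 0"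
  proof (rule analytic_continuation_open[of "{w. 2 * R < norm w}" "- E" C "\<lambda>_. 0"])
    show "open {w::complex. 2 * R < norm w}" by (intro open_Collect_less continuous_intros)
    have "of_real (2 * R + 1) \<in> {w::complex. 2 * R < norm w}" using R(1) by (simp only: norm_of_real mem_Collect_eq)
    then show "{w::complex. 2 * R < norm w} \<noteq> {}" by blast
    show "connected (- E)"
    proof -
      have "connected {z. z \<notin> E \<and> 1 < norm (\<Phi> z)}" by (intro connected_level) (auto simp: greaterThan_def[symmetric])
      moreover have "{z. z \<notin> E \<and> 1 < norm (\<Phi> z)} = - E" using Phi_gt_1 by auto
      ultimately show ?thesis by simp
    qed
    show "{w. 2 * R < norm w} \<subseteq> - E" using R by force
    show "C holomorphic_on - E" unfolding C_def by (rule Cauchy_transform_holomorphic[OF g])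
  qed (use open_compl_E w C0 in auto)
  then show ?thesis by (simp add: C_def)
qed

text \<open>Orthogonality makes the Cauchy transform of the conjugate of \<delta> vanish off E, and
  Cauchy's formula for \<delta> then gives it L2-norm 0. So \<delta> vanishes on the support, whose
  infinitely many points accumulate in E, and the identity theorem applies. For holomorphic
  functions this plays the part of completeness of the polynomials.\<close>

lemma zero_of_orthogonal:
  assumes \<rho>: "1 < \<rho>" and \<delta>: "\<delta> holomorphic_on D \<rho>"
    and orth: "\<And>q. (LINT z:X|\<mu>. \<delta> z * cnj (poly q z)) = 0" and z: "z \<in> D \<rho>"
  shows "\<delta> z = 0"
proof -
  obtain r where r: "1 < r" "ereal r < \<rho>"
    using \<rho> ereal_dense2[of 1 \<rho>] by auto
  have cont: "continuous_on E \<delta>"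
    using holomorphic_on_imp_continuous_on[OF \<delta>] E_subset_D continuous_on_subset by blast
  have cg: "continuous_on E (\<lambda>z. cnj (\<delta> z))" by (intro continuous_intros cont)
  have "(LINT z:X|\<mu>. cnj (\<delta> z) * poly q z) = 0" for q
  proof -
    have "(LINT z:X|\<mu>. cnj (\<delta> z) * poly q z) = (LINT z|\<mu>. cnj (indicator X z *\<^sub>R (\<delta> z * cnj (poly q z))))"
      unfolding set_lebesgue_integral_def by (intro Bochner_Integration.integral_cong) (auto simp: indicator_def)
    also have "\<dots> = cnj (LINT z:X|\<mu>. \<delta> z * cnj (poly q z))"
      unfolding set_lebesgue_integral_def by (rule Bochner_Integration.integral_cnj)
    finally show ?thesis using orth by simp
  qed
  then have T0: "(LINT z:X|\<mu>. cnj (\<delta> z) / (w - z)) = 0" if "w \<notin> E" for w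
    using Cauchy_transform_zero[OF cg _ that] by blast
  obtain M where M: "\<And>g B. continuous_on E g \<Longrightarrow>
     (\<forall>w. w \<notin> E \<and> norm (\<Phi> w) = r \<longrightarrow> norm (LINT z:X|\<mu>. g z / (w - z)) \<le> B) \<Longrightarrow>
     norm (LINT z:X|\<mu>. \<delta> z * g z) \<le> M * B"
    using Cauchy_transform_bound[OF r \<delta>] by metis
  have "norm (LINT z:X|\<mu>. \<delta> z * cnj (\<delta> z)) \<le> M * 0" by (rule M[OF cg]) (simp add: T0)
  then have I0: "(LINT z:X|\<mu>. \<delta> z * cnj (\<delta> z)) = 0" by simp
  have "(LINT z:X|\<mu>. \<delta> z * cnj (\<delta> z)) = (LINT z|\<mu>. complex_of_real (indicator X z * (norm (\<delta> z))\<^sup>2))"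
    unfolding set_lebesgue_integral_def
    by (intro Bochner_Integration.integral_cong) (auto simp: indicator_def complex_norm_square simp flip: of_real_power)
  then have I1: "(LINT z|\<mu>. indicator X z * (norm (\<delta> z))\<^sup>2) = 0" using I0 unfolding Bochner_Integration.integral_complex_of_real by simp
  have "set_integrable \<mu> X (\<lambda>z. \<delta> z * cnj (\<delta> z))" by (intro set_integrable_X continuous_intros cont)
  then have "integrable \<mu> (\<lambda>z. norm (indicator X z *\<^sub>R (\<delta> z * cnj (\<delta> z))))"
    unfolding set_integrable_def by (rule integrable_norm)
  moreover have "(\<lambda>z. norm (indicator X z *\<^sub>R (\<delta> z * cnj (\<delta> z)))) = (\<lambda>z. indicator X z * (norm (\<delta> z))\<^sup>2)"
    by (auto simp: indicator_def norm_mult power2_eq_square)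
  ultimately have int: "integrable \<mu> (\<lambda>z. indicator X z * (norm (\<delta> z))\<^sup>2)" by simp
  have AE: "AE z in \<mu>. indicator X z * (norm (\<delta> z))\<^sup>2 = 0"
    using I1 integral_nonneg_eq_0_iff_AE[OF int] by simp
  have X0: "\<delta> z0 = 0" if z0: "z0 \<in> X" for z0
  proof (rule ccontr)
    assume nz: "\<delta> z0 \<noteq> 0"
    define U where "U = D \<rho> \<inter> \<delta> -` (- {0})"
    have U: "open U" unfolding U_def
      using continuous_open_preimage[OF holomorphic_on_imp_continuous_on[OF \<delta>] open_D[OF \<rho>], of "- {0}"] by auto
    have "z0 \<in> U" using nz z0 X_subset E_subset_D[of \<rho>] by (auto simp: U_def)
    then have pos: "0 < emeasure \<mu> U" using z0 U by (auto simp: msupport_def)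
    have "AE z in \<mu>. z \<notin> U \<inter> X" using AE by eventually_elim (auto simp: U_def)
    moreover have "U \<inter> X \<in> sets \<mu>" using U sets_X sets_mu by auto
    ultimately have n1: "U \<inter> X \<in> null_sets \<mu>" using AE_iff_null_sets by blast
    have n2: "- X \<in> null_sets \<mu>" using null_compl_msupport[OF sets_mu] sets_mu closed_msupport by (simp add: null_sets_def)
    have "U \<subseteq> (U \<inter> X) \<union> - X" by auto
    moreover have "(U \<inter> X) \<union> - X \<in> null_sets \<mu>" using n1 n2 by (rule null_sets.Un)
    moreover have "U \<in> sets \<mu>" using U sets_mu by simp
    ultimately have "U \<in> null_sets \<mu>" using null_sets_subset by blast
    then show False using pos by (simp add: null_sets_def)
  qed
  obtain x where x: "x \<in> E" "x islimpt X"
    using compact_E X_subset infinite_X unfolding compact_eq_Bolzano_Weierstrass by metis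
  show ?thesis
    by (rule analytic_continuation[OF \<delta> open_D[OF \<rho>] connected_D[OF \<rho>] _ _ x(2)])
       (use X_subset E_subset_D[of \<rho>] x(1) X0 z in auto)
qed

end

section \<open>Fourier coefficients\<close>

locale regular_domain = exterior_domain +
  fixes \<mu> :: "complex measure" and p :: "nat \<Rightarrow> complex poly"
  assumes orthonormal: "orthonormal_polys \<mu> p" and regular: "Reg12 E \<Phi> p \<mu>"
begin

sublocale measured_domain E \<Phi> \<mu>
  by unfold_locales (use regular in \<open>simp add: Reg12_def\<close>)

definition fourier :: "nat \<Rightarrow> (complex \<Rightarrow> complex) \<Rightarrow> complex" where
  "fourier n f = mu_inner \<mu> f (poly (p n))"

lemma fourier_eq: "fourier n f = (LINT z:X|\<mu>. f z * cnj (poly (p n) z))"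
  by (simp add: fourier_def mu_inner_def)

lemma fourier_cong: "(\<And>z. z \<in> E \<Longrightarrow> f z = g z) \<Longrightarrow> fourier n f = fourier n g"
  unfolding fourier_eq by (rule set_integral_X_cong) simp

lemma fourier_add:
  assumes "continuous_on E f" "continuous_on E g"
  shows "fourier n (\<lambda>z. f z + g z) = fourier n f + fourier n g"
  unfolding fourier_eq
  by (subst set_integral_X_add[symmetric]) (auto intro!: continuous_intros assms set_integral_X_cong simp: ring_distribs)

lemma fourier_cmult: "fourier n (\<lambda>z. c * f z) = c * fourier n f"
  unfolding fourier_eq by (simp add: mult.assoc)

lemma fourier_diff:
  assumes "continuous_on E f" "continuous_on E g"
  shows "fourier n (\<lambda>z. f z - g z) = fourier n f - fourier n g"
proof -
  have "fourier n (\<lambda>z. f z + (- 1) * g z) = fourier n f + (- 1) * fourier n g"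
    by (subst fourier_add) (auto intro!: continuous_intros assms simp only: fourier_cmult)
  then show ?thesis using fourier_cmult[of n "- 1" g] by simp
qed

lemma fourier_sum:
  assumes "\<And>i. i \<in> I \<Longrightarrow> continuous_on E (f i)"
  shows "fourier n (\<lambda>z. \<Sum>i\<in>I. f i z) = (\<Sum>i\<in>I. fourier n (f i))"
  unfolding fourier_eq
  by (subst set_integral_X_sum[symmetric]) (auto intro!: continuous_intros assms set_integral_X_cong simp: sum_distrib_right)

lemma fourier_lim:
  assumes f: "\<And>k. continuous_on E (f k)" "continuous_on E g" and lim: "uniform_limit E f g sequentially"
  shows "(\<lambda>k. fourier n (f k)) \<longlonglongrightarrow> fourier n g"
proof -
  have cp: "continuous_on E (\<lambda>z. cnj (poly (p n) z))" by (intro continuous_intros)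
  obtain B where B: "\<And>z. z \<in> E \<Longrightarrow> norm (cnj (poly (p n) z)) \<le> B"
    using compact_imp_bounded[OF compact_continuous_image[OF cp compact_E]] unfolding bounded_iff by (meson imageI)
  have B0: "B \<ge> 0" using E_nonempty B norm_ge_zero order_trans by blast
  define K where "K = B * measure \<mu> X + 1"
  have K: "K > 0" unfolding K_def using B0 by (simp add: add_nonneg_pos)
  show ?thesis
  proof (rule tendstoI)
    fix e :: real assume e: "e > 0"
    then have "\<forall>\<^sub>F k in sequentially. \<forall>z\<in>E. dist (f k z) (g z) < e / K"
      using lim K unfolding uniform_limit_iff by simp
    then show "\<forall>\<^sub>F k in sequentially. dist (fourier n (f k)) (fourier n g) < e"
    proof eventually_elim
      case (elim k)
      have "fourier n (f k) - fourier n g = (LINT z:X|\<mu>. (f k z - g z) * cnj (poly (p n) z))"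
        using fourier_diff[OF f(1)[of k] f(2), of n] by (simp add: fourier_eq)
      also have "norm \<dots> \<le> (e / K * B) * measure \<mu> X"
      proof (rule norm_set_integral_X_le)
        fix z assume z: "z \<in> E"
        show "norm ((f k z - g z) * cnj (poly (p n) z)) \<le> e / K * B"
          unfolding norm_mult
          using elim z B[OF z] e K by (intro mult_mono) (auto simp: dist_norm less_imp_le)
      qed (intro continuous_intros f)
      also have "\<dots> = e * (B * measure \<mu> X) / K" by simp
      also have "\<dots> < e" using e K by (simp add: K_def divide_less_eq)
      finally show ?case by (simp add: dist_norm)
    qed
  qed
qed

lemma degree_p: "degree (p n) = n" and lead_p: "coeff (p n) n \<noteq> 0"
proof -
  have *: "degree (p n) = n" "0 < Re (lead_coeff (p n))" using orthonormal unfolding orthonormal_polys_def by blast+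
  show "degree (p n) = n" by (rule *)
  show "coeff (p n) n \<noteq> 0" using *(2) unfolding *(1) by auto
qed

lemma fourier_p: "fourier j (poly (p n)) = (if n = j then 1 else 0)"
  unfolding fourier_def using orthonormal by (simp add: orthonormal_polys_def)

lemma p_span: "degree q < n \<or> q = 0 \<Longrightarrow> \<exists>c. q = (\<Sum>j<n. smult (c j) (p j))"
proof (induction n arbitrary: q)
  case (Suc n)
  define a where "a = coeff q n / coeff (p n) n"
  define q' where "q' = q - smult a (p n)"
  have "degree q \<le> n" using Suc.prems by auto
  then have "degree q' \<le> n" unfolding q'_def using degree_p[of n] by (intro degree_diff_le) (auto intro: order_trans[OF degree_smult_le])
  moreover have "coeff q' n = 0" unfolding q'_def a_def using lead_p[of n] by simp
  ultimately have "degree q' < n \<or> q' = 0"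
    by (metis le_neq_implies_less leading_coeff_0_iff)
  then obtain c where c: "q' = (\<Sum>j<n. smult (c j) (p j))" using Suc.IH by blast
  have "q = (\<Sum>j<Suc n. smult ((c(n := a)) j) (p j))"
    using c by (simp add: q'_def diff_eq_eq)
  then show ?case by blast
qed simp

lemma fourier_span: "fourier j (poly (\<Sum>i<n. smult (c i) (p i))) = (if j < n then c j else 0)"
proof -
  have "fourier j (poly (\<Sum>i<n. smult (c i) (p i))) = fourier j (\<lambda>z. \<Sum>i<n. c i * poly (p i) z)"
    by (rule fourier_cong) (simp add: poly_sum)
  also have "\<dots> = (\<Sum>i<n. c i * fourier j (poly (p i)))"
    by (subst fourier_sum) (auto intro!: continuous_intros simp: fourier_cmult)
  also have "\<dots> = (\<Sum>i<n. if i = j then c i else 0)" by (intro sum.cong) (auto simp: fourier_p)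
  also have "\<dots> = (if j < n then c j else 0)" by (simp add: sum.delta)
  finally show ?thesis .
qed

lemma fourier_poly_zero: "degree q < n \<Longrightarrow> fourier n (poly q) = 0"
  using p_span[of q n] fourier_span by fastforce

lemma poly_fourier_expansion:
  assumes "degree q < n" shows "poly q z = (\<Sum>j<n. fourier j (poly q) * poly (p j) z)"
proof -
  obtain c where c: "q = (\<Sum>j<n. smult (c j) (p j))" using p_span assms by blast
  have "fourier j (poly q) = c j" if "j < n" for j unfolding c fourier_span using that by simp
  then show ?thesis by (subst c) (simp add: poly_sum)
qed

text \<open>Regularity speaks only of compact sets off E. It bounds \<open>p n\<close> on a level
  curve, and the maximum principle carries the bound inside, E included; the finitely many small n
  go into C.\<close>

lemma p_bound:
  assumes xy: "1 < x" "x < y"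
  shows "\<exists>C>0. \<forall>n. \<forall>z\<in>D (ereal x). norm (poly (p n) z) \<le> C * y ^ n"
proof -
  define \<Gamma> where "\<Gamma> = {z. z \<notin> E \<and> norm (\<Phi> z) = x}"
  have "\<Gamma> = (E \<union> {z. z \<notin> E \<and> norm (\<Phi> z) \<le> x}) \<inter> {z. z \<notin> E \<and> x \<le> norm (\<Phi> z)}"
    by (auto simp: \<Gamma>_def)
  then have comp: "compact \<Gamma>" using compact_sublevel[of x] closed_upper[OF xy(1)] by (simp add: compact_Int_closed)
  have sub: "\<Gamma> \<subseteq> - E" by (auto simp: \<Gamma>_def)
  have max: "norm (poly q z) \<le> B" if B: "\<And>z. z \<in> \<Gamma> \<Longrightarrow> norm (poly q z) \<le> B" and z: "z \<in> D (ereal x)" for q z B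
  proof (rule maximum_modulus_frontier[of "poly q" "D (ereal x)"])
    have op: "open (D (ereal x))" using xy by (intro open_D) simp
    have cl: "closure (D (ereal x)) \<subseteq> E \<union> {z. z \<notin> E \<and> norm (\<Phi> z) \<le> x}"
      using compact_sublevel[of x] by (intro closure_minimal compact_imp_closed) (auto simp: canon_dom_def)
    fix w assume "w \<in> frontier (D (ereal x))"
    then have "w \<in> closure (D (ereal x))" "w \<notin> D (ereal x)" using op by (auto simp: frontier_def interior_open)
    then have "w \<in> \<Gamma>" using cl by (force simp: \<Gamma>_def canon_dom_def)
    then show "norm (poly q w) \<le> B" by (rule B)
  qed (use z bounded_D in \<open>auto intro!: holomorphic_intros continuous_intros\<close>)
  have "uniform_limit \<Gamma> (\<lambda>n z. root n (norm (poly (p n) z))) (\<lambda>z. norm (\<Phi> z)) sequentially"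
    using regular comp sub unfolding Reg12_def by blast
  then have "\<forall>\<^sub>F n in sequentially. \<forall>z\<in>\<Gamma>. dist (root n (norm (poly (p n) z))) (norm (\<Phi> z)) < y - x"
    using xy unfolding uniform_limit_iff by auto
  then have "\<forall>\<^sub>F n in sequentially. \<forall>z\<in>\<Gamma>. norm (poly (p n) z) \<le> y ^ n"
    using eventually_gt_at_top[of 0]
  proof eventually_elim
    case (elim n)
    show ?case
    proof
      fix z assume z: "z \<in> \<Gamma>"
      then have "root n (norm (poly (p n) z)) < y" using elim(1) by (force simp: \<Gamma>_def dist_real_def)
      then have "root n (norm (poly (p n) z)) ^ n \<le> y ^ n" using elim(2) by (intro power_mono) auto
      then show "norm (poly (p n) z) \<le> y ^ n" using elim(2) by simp
    qed
  qed
  then obtain N where N: "\<And>n z. n \<ge> N \<Longrightarrow> z \<in> \<Gamma> \<Longrightarrow> norm (poly (p n) z) \<le> y ^ n"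
    unfolding eventually_sequentially by blast
  have "\<exists>B. \<forall>z\<in>\<Gamma>. norm (poly (p n) z) \<le> B" for n
  proof -
    have "continuous_on \<Gamma> (poly (p n))" by (intro continuous_intros)
    then show ?thesis
      using compact_imp_bounded[OF compact_continuous_image[of \<Gamma> "poly (p n)", OF _ comp]] unfolding bounded_iff by (meson imageI)
  qed
  then obtain B where B: "\<And>n z. z \<in> \<Gamma> \<Longrightarrow> norm (poly (p n) z) \<le> B n" by metis
  define C where "C = 1 + (\<Sum>n<N. \<bar>B n\<bar> / y ^ n)"
  have C1: "C \<ge> 1" unfolding C_def using xy by (simp add: sum_nonneg)
  have "norm (poly (p n) z) \<le> C * y ^ n" if z: "z \<in> \<Gamma>" for n z
  proof (cases "n < N")
    case True
    have "\<bar>B n\<bar> / y ^ n \<le> (\<Sum>n<N. \<bar>B n\<bar> / y ^ n)" using True xy by (intro member_le_sum) auto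
    then have "\<bar>B n\<bar> / y ^ n \<le> C" by (simp add: C_def)
    then have "\<bar>B n\<bar> \<le> C * y ^ n" using xy by (simp add: divide_le_eq)
    then show ?thesis using B[OF z, of n] by linarith
  next
    case False
    have "1 * y ^ n \<le> C * y ^ n" using C1 xy by (intro mult_right_mono) auto
    then show ?thesis using N[of n z] False z by simp
  qed
  then have "norm (poly (p n) z) \<le> C * y ^ n" if "z \<in> D (ereal x)" for n z using max that by blast
  then show ?thesis using C1 by (intro exI[of _ C]) auto
qed

lemma second_type_bound:
  assumes r: "1 < r" and y: "1 / r < y"
  shows "\<forall>\<^sub>F n in sequentially. \<forall>w. w \<notin> E \<and> norm (\<Phi> w) = r \<longrightarrow> norm (second_type \<mu> p n w) \<le> y ^ n"
proof -
  define \<Gamma> where "\<Gamma> = {z. z \<notin> E \<and> norm (\<Phi> z) = r}"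
  have "\<Gamma> = (E \<union> {z. z \<notin> E \<and> norm (\<Phi> z) \<le> r}) \<inter> {z. z \<notin> E \<and> r \<le> norm (\<Phi> z)}"
    by (auto simp: \<Gamma>_def)
  then have comp: "compact \<Gamma>" using compact_sublevel[of r] closed_upper[OF r] by (simp add: compact_Int_closed)
  have sub: "\<Gamma> \<subseteq> - E" by (auto simp: \<Gamma>_def)
  have "uniform_limit \<Gamma> (\<lambda>n z. root n (norm (second_type \<mu> p n z))) (\<lambda>z. inverse (norm (\<Phi> z))) sequentially"
    using regular comp sub unfolding Reg12_def by blast
  then have "\<forall>\<^sub>F n in sequentially. \<forall>z\<in>\<Gamma>. dist (root n (norm (second_type \<mu> p n z))) (inverse (norm (\<Phi> z))) < y - 1 / r"
    using y unfolding uniform_limit_iff by auto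
  then show ?thesis
    using eventually_gt_at_top[of 0]
  proof eventually_elim
    case (elim n)
    show ?case
    proof (intro allI impI)
      fix z assume z: "z \<notin> E \<and> norm (\<Phi> z) = r"
      then have "dist (root n (norm (second_type \<mu> p n z))) (1 / r) < y - 1 / r"
        using elim(1) by (force simp: \<Gamma>_def inverse_eq_divide)
      then have "root n (norm (second_type \<mu> p n z)) < y" by (simp add: dist_real_def abs_less_iff)
      then have "root n (norm (second_type \<mu> p n z)) ^ n \<le> y ^ n" using elim(2) by (intro power_mono) auto
      then show "norm (second_type \<mu> p n z) \<le> y ^ n" using elim(2) by simp
    qed
  qed
qed

lemma continuous_on_E_of_holomorphic: "f holomorphic_on D r \<Longrightarrow> continuous_on E f"
  using holomorphic_on_imp_continuous_on E_subset_D continuous_on_subset by blast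

text \<open>Moving the integration to the level curve of index r replaces \<open>p n\<close> by the
  second type function, which has n-th root rate 1 / r there.\<close>

lemma fourier_rate:
  assumes f: "f holomorphic_on D \<rho>" and r: "1 < r" "ereal r < \<rho>"
  shows "rate_le (\<lambda>n. fourier n f) (1 / r)"
proof (rule rate_leI_eventually)
  fix y assume y: "1 / r < y"
  obtain M where M: "M \<ge> 0" "\<And>g B. continuous_on E g \<Longrightarrow>
     (\<forall>w. w \<notin> E \<and> norm (\<Phi> w) = r \<longrightarrow> norm (LINT z:X|\<mu>. g z / (w - z)) \<le> B) \<Longrightarrow>
     norm (LINT z:X|\<mu>. f z * g z) \<le> M * B"
    using Cauchy_transform_bound[OF r f] by metis
  have "\<forall>\<^sub>F n in sequentially. norm (fourier n f) \<le> M * y ^ n"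
    using second_type_bound[OF r(1) y]
  proof eventually_elim
    case (elim n)
    then show ?case unfolding fourier_eq second_type_def
      by (intro M(2) continuous_intros) auto
  qed
  then show "\<exists>C. \<forall>\<^sub>F n in sequentially. norm (fourier n f) \<le> C * y ^ n" by blast
qed (use r in simp)

lemma holomorphic_pole_power: "\<xi> \<notin> E \<Longrightarrow> (\<lambda>z. c / (z - \<xi>) ^ s) holomorphic_on D (ereal (norm (\<Phi> \<xi>)))"
  by (intro holomorphic_intros) (auto simp: canon_dom_def)

text \<open>The function is holomorphic up to the circle through \<xi>, so the rate is approached
  through radii r < |\<Phi> \<xi>|.\<close>

lemma fourier_pole_rate:
  assumes "\<xi> \<notin> E" shows "rate_le (\<lambda>n. fourier n (\<lambda>z. 1 / (z - \<xi>) ^ s)) (1 / norm (\<Phi> \<xi>))"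
proof (rule rate_le_dense)
  fix y assume y: "1 / norm (\<Phi> \<xi>) < y"
  have P: "1 < norm (\<Phi> \<xi>)" using Phi_gt_1 assms by blast
  then have y0: "0 < y" using y by (smt (verit) divide_pos_pos)
  have a0: "0 < norm (\<Phi> \<xi>)" using P by linarith
  have "1 < y * norm (\<Phi> \<xi>)" using y by (simp only: pos_divide_less_eq[OF a0])
  then have "1 / y < norm (\<Phi> \<xi>)" by (simp only: pos_divide_less_eq[OF y0] mult.commute)
  then have "max 1 (1 / y) < norm (\<Phi> \<xi>)" using P by simp
  then obtain r where r: "max 1 (1 / y) < r" "r < norm (\<Phi> \<xi>)" using dense by blast
  have "rate_le (\<lambda>n. fourier n (\<lambda>z. 1 / (z - \<xi>) ^ s)) (1 / r)"
    by (rule fourier_rate[OF holomorphic_pole_power[OF assms]]) (use r in auto)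
  moreover have "1 / r \<le> y" using r y0 by (simp add: field_simps)
  ultimately show "rate_le (\<lambda>n. fourier n (\<lambda>z. 1 / (z - \<xi>) ^ s)) y" by (rule rate_le_mono)
qed

text \<open>The coefficient is minus the second type function at \<xi>, where regularity supplies a
  genuine limit of the roots. This lower bound makes the triangular systems solvable without loss of
  rate.\<close>

lemma fourier_simple_pole_lower:
  assumes \<xi>: "\<xi> \<notin> E" and v: "0 < v" "v < 1 / norm (\<Phi> \<xi>)"
  shows "\<forall>\<^sub>F n in sequentially. v ^ n \<le> norm (fourier n (\<lambda>z. 1 / (z - \<xi>) ^ 1))"
proof -
  have "fourier n (\<lambda>z. 1 / (z - \<xi>) ^ 1) = (- 1) * second_type \<mu> p n \<xi>" for n
    unfolding fourier_eq second_type_def set_integral_mult_right[symmetric]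
  proof (rule set_integral_X_cong)
    fix z assume "z \<in> E"
    then have "z - \<xi> \<noteq> 0" "\<xi> - z \<noteq> 0" using \<xi> by auto
    then show "1 / (z - \<xi>) ^ 1 * cnj (poly (p n) z) = - 1 * (cnj (poly (p n) z) / (\<xi> - z))"
      by (simp add: divide_simps) (simp add: algebra_simps)
  qed
  then have eq: "norm (fourier n (\<lambda>z. 1 / (z - \<xi>) ^ 1)) = norm (second_type \<mu> p n \<xi>)" for n by simp
  have "compact {\<xi>}" "{\<xi>} \<subseteq> - E" using \<xi> by auto
  then have "uniform_limit {\<xi>} (\<lambda>n z. root n (norm (second_type \<mu> p n z))) (\<lambda>z. inverse (norm (\<Phi> z))) sequentially"
    using regular unfolding Reg12_def by blast
  then have "\<forall>\<^sub>F n in sequentially. \<forall>z\<in>{\<xi>}. dist (root n (norm (second_type \<mu> p n z))) (inverse (norm (\<Phi> z))) < 1 / norm (\<Phi> \<xi>) - v"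
    using v unfolding uniform_limit_iff by auto
  then show ?thesis
    using eventually_gt_at_top[of 0]
  proof eventually_elim
    case (elim n)
    have "v \<le> root n (norm (second_type \<mu> p n \<xi>))" using elim(1) by (auto simp: dist_real_def inverse_eq_divide)
    then have "v ^ n \<le> root n (norm (second_type \<mu> p n \<xi>)) ^ n" using v by (intro power_mono) auto
    then show ?case unfolding eq using elim(2) by simp
  qed
qed

end

section \<open>Fourier series as analytic continuation, and their remainders\<close>

context regular_domain
begin

text \<open>The rates of the coefficients and of \<open>p j\<close> make the series converge locally
  uniformly on \<open>D \<rho>\<close>. That its sum continues h needs an argument: the difference
  has only zero Fourier coefficients, and \<open>zero_of_orthogonal\<close> applies on the smaller
  of the two domains.\<close>

lemma fourier_series:
  assumes \<rho>0: "1 < \<rho>0" and h: "h holomorphic_on D \<rho>0" and \<rho>: "1 < \<rho>"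
    and rate: "\<And>r. 1 < r \<Longrightarrow> ereal r < \<rho> \<Longrightarrow> rate_le (\<lambda>n. fourier n h) (1 / r)"
  shows "\<exists>h'. h' holomorphic_on D \<rho> \<and> agree_near E h' h \<and>
     (\<forall>x r. 1 < x \<longrightarrow> x < r \<longrightarrow> ereal r < \<rho> \<longrightarrow>
        (\<exists>C. \<forall>n. \<forall>z\<in>D (ereal x). norm (h' z - (\<Sum>j<n. fourier j h * poly (p j) z)) \<le> C * (x / r) ^ n))"
proof -
  define T where "T j z = fourier j h * poly (p j) z" for j z
  define h' where "h' z = (\<Sum>j. T j z)" for z
  have est: "\<exists>K>0. \<forall>j. \<forall>z\<in>D (ereal x). norm (T j z) \<le> K * (x / r) ^ j" if xr: "1 < x" "x < r" "ereal r < \<rho>" for x r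
  proof -
    \<comment> \<open>A radius beyond r leaves slack for both the coefficients and the polynomials,
      so that the product of their enlarged bases stays below x / r.\<close>
    obtain r' where r': "r < r'" "ereal r' < \<rho>" using xr(3) ereal_dense2[of "ereal r" \<rho>] by auto
    have "x * (1 / r') < x / r" using xr r' by (simp add: divide_strict_left_mono)
    then obtain x' y where xy: "x < x'" "1 / r' < y" "x' * y < x / r"
      using real_mult_split[of x "1 / r'" "x / r"] xr r' by auto
    have "rate_le (\<lambda>n. fourier n h) (1 / r')" using rate xr r' by simp
    then obtain A where A: "A > 0" "\<And>n. norm (fourier n h) \<le> A * y ^ n"
      using rate_leD[of "\<lambda>n. fourier n h" "1 / r'" y] xy(2) xr r' by auto
    obtain C where C: "C > 0" "\<And>n z. z \<in> D (ereal x) \<Longrightarrow> norm (poly (p n) z) \<le> C * x' ^ n"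
      using p_bound[OF xr(1) xy(1)] by blast
    have y0: "0 < y" using xy(2) xr r' by (smt (verit) divide_pos_pos)
    have "norm (T j z) \<le> (A * C) * (x / r) ^ j" if z: "z \<in> D (ereal x)" for j z
    proof -
      have "norm (T j z) \<le> (A * y ^ j) * (C * x' ^ j)"
        unfolding T_def norm_mult using A C y0 z by (intro mult_mono) auto
      also have "\<dots> = (A * C) * (x' * y) ^ j" by (simp add: power_mult_distrib)
      also have "\<dots> \<le> (A * C) * (x / r) ^ j"
        using A C xy xr y0 by (intro mult_left_mono power_mono) auto
      finally show ?thesis .
    qed
    then show ?thesis using A C by (intro exI[of _ "A * C"]) auto
  qed
  have tail: "\<exists>C. \<forall>n. \<forall>z\<in>D (ereal x). norm (h' z - (\<Sum>j<n. T j z)) \<le> C * (x / r) ^ n"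
    if xr: "1 < x" "x < r" "ereal r < \<rho>" for x r
  proof -
    obtain K where K: "K > 0" "\<And>j z. z \<in> D (ereal x) \<Longrightarrow> norm (T j z) \<le> K * (x / r) ^ j" using est[OF xr] by blast
    have q: "0 \<le> x / r" "x / r < 1" using xr by auto
    have "norm (h' z - (\<Sum>j<n. T j z)) \<le> (K / (1 - x / r)) * (x / r) ^ n" if z: "z \<in> D (ereal x)" for n z
    proof -
      have sg: "summable (\<lambda>j. K * (x / r) ^ j)" using q by (intro summable_mult summable_geometric) auto
      have sT: "summable (\<lambda>j. T j z)"
        by (rule summable_comparison_test'[OF sg, of 0]) (use K(2)[OF z] in auto)
      have "h' z - (\<Sum>j<n. T j z) = (\<Sum>j. T (j + n) z)"
        unfolding h'_def using suminf_minus_initial_segment[OF sT, of n] by simp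
      also have "norm \<dots> \<le> (\<Sum>j. K * (x / r) ^ (j + n))"
      proof (rule norm_suminf_le)
        show "summable (\<lambda>j. K * (x / r) ^ (j + n))" using sg by (rule summable_ignore_initial_segment)
      qed (use K(2)[OF z] in auto)
      also have "\<dots> = (\<Sum>j. (K * (x / r) ^ n) * (x / r) ^ j)" by (simp add: power_add mult_ac)
      also have "\<dots> = (K * (x / r) ^ n) * (1 / (1 - x / r))"
        using q by (subst suminf_mult) (auto simp: suminf_geometric)
      finally show ?thesis by simp
    qed
    then show ?thesis by blast
  qed
  have ul: "uniform_limit (D (ereal x)) (\<lambda>n z. \<Sum>j<n. T j z) h' sequentially" if x: "1 < x" "ereal x < \<rho>" for x
  proof -
    obtain r where r: "x < r" "ereal r < \<rho>" using x(2) ereal_dense2[of "ereal x" \<rho>] by auto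
    obtain C where C: "\<And>n z. z \<in> D (ereal x) \<Longrightarrow> norm (h' z - (\<Sum>j<n. T j z)) \<le> C * (x / r) ^ n"
      using tail[OF x(1) r] by blast
    have "(\<lambda>n. C * (x / r) ^ n) \<longlonglongrightarrow> C * 0" using x r by (intro tendsto_intros LIMSEQ_power_zero) auto
    then have l0: "(\<lambda>n. C * (x / r) ^ n) \<longlonglongrightarrow> 0" by simp
    show ?thesis
    proof (rule uniform_limitI)
      fix e :: real assume "0 < e"
      then have "\<forall>\<^sub>F n in sequentially. C * (x / r) ^ n < e" using l0 by (intro order_tendstoD(2))
      then show "\<forall>\<^sub>F n in sequentially. \<forall>z\<in>D (ereal x). dist (\<Sum>j<n. T j z) (h' z) < e"
        by eventually_elim (use C in \<open>auto simp: dist_norm norm_minus_commute intro: le_less_trans\<close>)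
    qed
  qed
  have hol: "h' holomorphic_on D \<rho>"
  proof (rule holomorphic_uniform_sequence[OF open_D[OF \<rho>]])
    show "(\<lambda>z. \<Sum>j<n. T j z) holomorphic_on D \<rho>" for n unfolding T_def by (intro holomorphic_intros)
    fix z assume z: "z \<in> D \<rho>"
    obtain x where x: "1 < x" "ereal x < \<rho>" "z \<in> D (ereal x)" using compact_subset_D[OF \<rho>, of "{z}"] z by auto
    have "open (D (ereal x))" using x by (intro open_D) simp
    then obtain d where d: "d > 0" "cball z d \<subseteq> D (ereal x)" using x(3) open_contains_cball by blast
    moreover have "D (ereal x) \<subseteq> D \<rho>" using x by (intro canon_dom_mono) auto
    ultimately show "\<exists>d>0. cball z d \<subseteq> D \<rho> \<and> uniform_limit (cball z d) (\<lambda>n z. \<Sum>j<n. T j z) h' sequentially"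
      using uniform_limit_on_subset[OF ul[OF x(1,2)] d(2)] by blast
  qed
  define \<rho>1 where "\<rho>1 = min \<rho>0 \<rho>"
  have \<rho>1: "1 < \<rho>1" using \<rho> \<rho>0 by (simp add: \<rho>1_def)
  have sub1: "D \<rho>1 \<subseteq> D \<rho>0" "D \<rho>1 \<subseteq> D \<rho>" by (simp_all add: \<rho>1_def canon_dom_mono)
  have cE: "continuous_on E h" "continuous_on E h'"
    using h hol continuous_on_E_of_holomorphic by blast+
  obtain x where x: "1 < x" "ereal x < \<rho>" using \<rho> ereal_dense2[of 1 \<rho>] by auto
  have ulE: "uniform_limit E (\<lambda>n z. \<Sum>j<n. T j z) h' sequentially"
    using uniform_limit_on_subset[OF ul[OF x] E_subset_D] .
  have f0: "fourier i (\<lambda>z. h' z - h z) = 0" for i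
  proof -
    have "(\<lambda>n. fourier i (\<lambda>z. \<Sum>j<n. T j z)) \<longlonglongrightarrow> fourier i h'"
      by (intro fourier_lim ulE cE) (auto simp: T_def intro!: continuous_intros)
    moreover have "fourier i (\<lambda>z. \<Sum>j<n. T j z) = fourier i h" if "n > i" for n
    proof -
      have "fourier i (\<lambda>z. \<Sum>j<n. T j z) = fourier i (poly (\<Sum>j<n. smult (fourier j h) (p j)))"
        by (rule fourier_cong) (simp add: T_def poly_sum)
      then show ?thesis using that by (simp add: fourier_span)
    qed
    then have "\<forall>\<^sub>F n in sequentially. fourier i (\<lambda>z. \<Sum>j<n. T j z) = fourier i h"
      using eventually_gt_at_top[of i] by (rule eventually_mono[rotated])
    then have "(\<lambda>n. fourier i (\<lambda>z. \<Sum>j<n. T j z)) \<longlonglongrightarrow> fourier i h" by (rule tendsto_eventually)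
    ultimately have "fourier i h' = fourier i h" by (rule LIMSEQ_unique)
    then show ?thesis using fourier_diff[OF cE(2,1)] by simp
  qed
  have "h' z - h z = 0" if "z \<in> D \<rho>1" for z
  proof (rule zero_of_orthogonal[OF \<rho>1 _ _ that])
    show "(\<lambda>z. h' z - h z) holomorphic_on D \<rho>1"
      by (intro holomorphic_intros holomorphic_on_subset[OF hol sub1(2)] holomorphic_on_subset[OF h sub1(1)])
    show "(LINT z:X|\<mu>. (h' z - h z) * cnj (poly q z)) = 0" for q
    proof -
      obtain c where c: "q = (\<Sum>j<Suc (degree q). smult (c j) (p j))" using p_span[of q "Suc (degree q)"] by auto
      have "(LINT z:X|\<mu>. (h' z - h z) * cnj (poly q z)) =
          (LINT z:X|\<mu>. \<Sum>j<Suc (degree q). cnj (c j) * ((h' z - h z) * cnj (poly (p j) z)))"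
      proof (rule set_integral_X_cong)
        fix z
        have "poly q z = (\<Sum>j<Suc (degree q). c j * poly (p j) z)" by (subst c) (simp add: poly_sum del: sum.lessThan_Suc)
        then show "(h' z - h z) * cnj (poly q z) = (\<Sum>j<Suc (degree q). cnj (c j) * ((h' z - h z) * cnj (poly (p j) z)))"
          by (simp add: sum_distrib_left mult_ac del: sum.lessThan_Suc)
      qed
      also have "\<dots> = (\<Sum>j<Suc (degree q). cnj (c j) * fourier j (\<lambda>z. h' z - h z))"
        by (subst set_integral_X_sum) (auto intro!: continuous_intros cE simp: fourier_eq simp del: sum.lessThan_Suc)
      finally show ?thesis using f0 by simp
    qed
  qed
  then have "agree_near E h' h"
    unfolding agree_near_def using open_D[OF \<rho>1] E_subset_D[of \<rho>1] by (intro exI[of _ "D \<rho>1"]) auto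
  then show ?thesis using hol tail unfolding T_def by blast
qed

text \<open>The sum of the series continues the germ of h and so coincides with h on
  \<open>D \<rho>\<close>; the estimate for its tail is therefore one for h.\<close>

lemma fourier_tail:
  assumes h: "h holomorphic_on D \<rho>" and xr: "1 < x" "x < r" "ereal r < \<rho>"
  shows "\<exists>C. \<forall>n. \<forall>z\<in>D (ereal x). norm (h z - (\<Sum>j<n. fourier j h * poly (p j) z)) \<le> C * (x / r) ^ n"
proof -
  have "ereal 1 < ereal r" using xr by simp
  then have \<rho>: "1 < \<rho>" using xr(3) by (metis less_trans one_ereal_def)
  obtain h' where h': "h' holomorphic_on D \<rho>" "agree_near E h' h"
     "\<And>x r. 1 < x \<Longrightarrow> x < r \<Longrightarrow> ereal r < \<rho> \<Longrightarrow>
        (\<exists>C. \<forall>n. \<forall>z\<in>D (ereal x). norm (h' z - (\<Sum>j<n. fourier j h * poly (p j) z)) \<le> C * (x / r) ^ n)"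
    using fourier_series[OF \<rho> h \<rho> fourier_rate[OF h]] by blast
  have "h' z = h z" if "z \<in> D (ereal x)" for z
  proof (rule holomorphic_unique[OF \<rho> h'(1) h h'(2)])
    have "ereal x \<le> \<rho>" using xr by (meson ereal_less_eq(3) less_imp_le order_trans)
    then show "z \<in> D \<rho>" using that canon_dom_mono by blast
  qed
  then show ?thesis using h'(3)[OF xr] by simp
qed

text \<open>Beyond the circle through \<open>\<xi>\<close> the partial sums for \<open>1 / (z - \<xi>) ^ s\<close> diverge, but only at the geometric rate
  that the formula for the region of convergence predicts.\<close>
lemma fourier_pole_tail:
  assumes \<xi>: "\<xi> \<notin> E" and K: "compact K" "\<xi> \<notin> K" and x: "1 < x" "K \<subseteq> D (ereal x)" and y: "x < y"
  shows "\<exists>C. \<forall>n. \<forall>z\<in>K. norm (1 / (z - \<xi>) ^ s - (\<Sum>j<n. fourier j (\<lambda>z. 1 / (z - \<xi>) ^ s) * poly (p j) z))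
           \<le> C * (y / norm (\<Phi> \<xi>)) ^ n"
proof -
  define R where "R = norm (\<Phi> \<xi>)"
  have R: "1 < R" using Phi_gt_1[OF \<xi>] by (simp add: R_def)
  define f where "f = (\<lambda>z. 1 / (z - \<xi>) ^ s)"
  have f: "f holomorphic_on D (ereal R)" unfolding f_def R_def by (rule holomorphic_pole_power[OF \<xi>])
  show ?thesis
  proof (cases "x < R")
    case True
    \<comment> \<open>Inside the circle through \<xi> the ordinary remainder estimate suffices, with
      r so close to R that x / r \<le> y / R.\<close>
    have "max x (x * R / y) < R" using True x y by (simp add: pos_divide_less_eq)
    then obtain r where r: "max x (x * R / y) < r" "r < R" using dense by blast
    obtain C where C: "\<And>n z. z \<in> D (ereal x) \<Longrightarrow> norm (f z - (\<Sum>j<n. fourier j f * poly (p j) z)) \<le> C * (x / r) ^ n"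
      using fourier_tail[OF f x(1), of r] r by auto
    have "x * R < r * y" using r x y by (simp add: pos_divide_less_eq)
    then have le: "x / r \<le> y / R" using r x R by (simp add: field_simps)
    have "norm (f z - (\<Sum>j<n. fourier j f * poly (p j) z)) \<le> \<bar>C\<bar> * (y / R) ^ n" if z: "z \<in> K" for n z
    proof -
      have "C * (x / r) ^ n \<le> \<bar>C\<bar> * (y / R) ^ n"
        using le x r by (intro mult_mono power_mono) auto
      then show ?thesis using C[of z n] z x(2) by (meson order_trans subsetD)
    qed
    then show ?thesis unfolding f_def R_def by blast
  next
    case False
    then have Rx: "R \<le> x" "R < y" using y by auto
    have cK: "continuous_on K f" unfolding f_def using K(2) by (intro continuous_intros) auto
    obtain B where B: "\<And>z. z \<in> K \<Longrightarrow> norm (f z) \<le> B"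
      using compact_imp_bounded[OF compact_continuous_image[OF cK K(1)]] unfolding bounded_iff by (meson imageI)
    have "x * (1 / R) < y / R" using y R by (simp add: divide_strict_right_mono)
    then obtain x' q where xq: "x < x'" "1 / R < q" "x' * q < y / R"
      using real_mult_split[of x "1 / R" "y / R"] x R by auto
    have "0 < 1 / R" using R by simp
    then have q0: "0 < q" using xq(2) by linarith
    obtain A where A: "A > 0" "\<And>n. norm (fourier n f) \<le> A * q ^ n"
      using rate_leD[OF fourier_pole_rate[OF \<xi>, of s], of q] xq(2) R unfolding f_def R_def by auto
    obtain C where C: "C > 0" "\<And>n z. z \<in> D (ereal x) \<Longrightarrow> norm (poly (p n) z) \<le> C * x' ^ n"
      using p_bound[OF x(1) xq(1)] by blast
    \<comment> \<open>A ratio above 1: the partial sums are then of the order of t^n, which also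
      dominates the bounded function itself.\<close>
    define t where "t = y / R"
    have t1: "1 < t" using Rx R by (simp add: t_def)
    have part: "norm (\<Sum>j<n. fourier j f * poly (p j) z) \<le> (A * C / (t - 1)) * t ^ n" if z: "z \<in> K" for n z
    proof -
      have "norm (fourier j f * poly (p j) z) \<le> (A * C) * t ^ j" for j
      proof -
        have "norm (fourier j f * poly (p j) z) \<le> (A * q ^ j) * (C * x' ^ j)"
          unfolding norm_mult using A C q0 z x(2) by (intro mult_mono) auto
        also have "\<dots> = (A * C) * (x' * q) ^ j" by (simp add: power_mult_distrib)
        also have "\<dots> \<le> (A * C) * t ^ j"
          using A C xq x q0 by (intro mult_left_mono power_mono) (auto simp: t_def)
        finally show ?thesis .
      qed
      then have "norm (\<Sum>j<n. fourier j f * poly (p j) z) \<le> (\<Sum>j<n. (A * C) * t ^ j)"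
        by (intro sum_norm_le) auto
      also have "\<dots> = (A * C) * ((t ^ n - 1) / (t - 1))"
        using t1 by (simp add: sum_distrib_left[symmetric] geometric_sum)
      also have "\<dots> \<le> (A * C) * (t ^ n / (t - 1))"
        using A C t1 by (intro mult_left_mono divide_right_mono) auto
      finally show ?thesis by simp
    qed
    have "norm (f z - (\<Sum>j<n. fourier j f * poly (p j) z)) \<le> (\<bar>B\<bar> + A * C / (t - 1)) * t ^ n" if z: "z \<in> K" for n z
    proof -
      have "norm (f z) \<le> \<bar>B\<bar> * t ^ n"
      proof -
        have "\<bar>B\<bar> * 1 \<le> \<bar>B\<bar> * t ^ n" using t1 by (intro mult_left_mono) auto
        then show ?thesis using B[OF z] by linarith
      qed
      then show ?thesis
        using norm_triangle_ineq4[of "f z" "\<Sum>j<n. fourier j f * poly (p j) z"] part[OF z, of n]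
        by (simp add: ring_distribs)
    qed
    then show ?thesis unfolding f_def R_def t_def by blast
  qed
qed

end

section \<open>Sole poles and continuation\<close>

context exterior_domain
begin

lemma agree_near_refl: "agree_near E f f"
  unfolding agree_near_def by (intro exI[of _ UNIV]) auto

lemma agree_near_sym: "agree_near E f g \<Longrightarrow> agree_near E g f"
  unfolding agree_near_def by metis

lemma agree_near_trans:
  assumes "agree_near E f g" "agree_near E g h" shows "agree_near E f h"
proof -
  obtain U V where "open U" "E \<subseteq> U" "\<forall>z\<in>U. f z = g z" "open V" "E \<subseteq> V" "\<forall>z\<in>V. g z = h z"
    using assms unfolding agree_near_def by blast
  then show ?thesis unfolding agree_near_def by (intro exI[of _ "U \<inter> V"]) auto
qed

lemma agree_near_on: "agree_near E f g \<Longrightarrow> z \<in> E \<Longrightarrow> f z = g z"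
  unfolding agree_near_def by blast

lemma agree_nearI: "open V \<Longrightarrow> E \<subseteq> V \<Longrightarrow> (\<And>z. z \<in> V \<Longrightarrow> f z = g z) \<Longrightarrow> agree_near E f g"
  unfolding agree_near_def by blast

text \<open>The definition speaks of a neighbourhood of a closure and of a pole order; the later
  computations need explicit coefficients over a canonical domain. The radius s is strictly larger
  than |\<Phi> \<xi>| because the neighbourhood contains the closed sublevel set.\<close>

lemma sole_pole_representation:
  assumes \<xi>: "\<xi> \<notin> E" and G: "sole_pole E \<Phi> \<xi> t G"
  shows "\<exists>s>norm (\<Phi> \<xi>). \<exists>h b. h holomorphic_on D (ereal s) \<and> b t \<noteq> 0 \<and> 1 \<le> t \<and>
     agree_near E G (\<lambda>z. h z + (\<Sum>i=1..t. b i / (z - \<xi>) ^ i))"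
proof -
  obtain U g where U: "open U" "closure (D (ereal (norm (\<Phi> \<xi>)))) \<subseteq> U" "g holomorphic_on (U - {\<xi>})"
     "agree_near E g G" "is_pole g \<xi>" "pole_order g \<xi> = t" using G unfolding sole_pole_def by blast
  have P: "1 < norm (\<Phi> \<xi>)" using Phi_gt_1[OF \<xi>] .
  obtain s where s: "s > norm (\<Phi> \<xi>)" "D (ereal s) \<subseteq> U"
    using D_subset_neighbourhood[OF less_imp_le[OF P] U(1)] sublevel_subset_closure[OF P] U(2) by blast
  have \<xi>D: "\<xi> \<in> D (ereal s)" using s(1) by (simp add: canon_dom_def)
  have o: "open (D (ereal s))" using P s(1) by (intro open_D) simp
  note pf = pole_form_of_pole[OF U(3,1) _ U(5)]
  have \<xi>U: "\<xi> \<in> U" using \<xi>D s(2) by blast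
  have "1 \<le> t" using pf(3)[OF \<xi>U] U(6) by simp
  moreover have "g holomorphic_on D (ereal s) - {\<xi>}" using U(3) s(2) by (auto elim: holomorphic_on_subset)
  ultimately obtain h b where hb: "h holomorphic_on D (ereal s)"
    "\<And>z. z \<in> D (ereal s) - {\<xi>} \<Longrightarrow> g z = h z + (\<Sum>i=1..t. b i / (z - \<xi>) ^ i)" "b t = zor_poly g \<xi> \<xi>"
    using principal_part_single[OF o \<xi>D, of t g "zor_poly g \<xi>"] pf(1)[OF \<xi>U] U(6) by blast
  have "agree_near E g (\<lambda>z. h z + (\<Sum>i=1..t. b i / (z - \<xi>) ^ i))"
    using o hb(2) E_subset_D \<xi> by (intro agree_nearI[of "D (ereal s) - {\<xi>}"]) auto
  then have "agree_near E G (\<lambda>z. h z + (\<Sum>i=1..t. b i / (z - \<xi>) ^ i))"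
    using agree_near_trans[OF agree_near_sym[OF U(4)]] by blast
  moreover have "b t \<noteq> 0" using hb(3) pf(2)[OF \<xi>U] by simp
  ultimately show ?thesis using s(1) hb(1) \<open>1 \<le> t\<close> by blast
qed

text \<open>Converse to the explicit representation: one principal part over \<open>D \<rho>\<close>
  yields both the sole pole and a lower bound for the index. The value 0 at \<xi> makes the
  continuation nicely meromorphic.\<close>

lemma single_pole_extension:
  assumes \<rho>: "1 < \<rho>" and h: "h holomorphic_on D \<rho>" and \<xi>: "\<xi> \<in> D \<rho>" "\<xi> \<notin> E" and t: "1 \<le> t" "b t \<noteq> 0"
    and G: "agree_near E G (\<lambda>z. h z + (\<Sum>i=1..t. b i / (z - \<xi>) ^ i))"
  defines "g \<equiv> \<lambda>z. if z = \<xi> then 0 else h z + (\<Sum>i=1..t. b i / (z - \<xi>) ^ i)"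
  shows "mero_ext E G (D \<rho>) g" "{z \<in> D \<rho>. is_pole g z} = {\<xi>}" "pole_order g \<xi> = t"
    "\<rho> \<le> rho_mero E \<Phi> t G" "sole_pole E \<Phi> \<xi> t G"
proof -
  have eq: "g z = h z + (\<Sum>i=1..t. b i / (z - \<xi>) ^ i)" if "z \<in> D \<rho> - {\<xi>}" for z using that by (simp add: g_def)
  have g0: "g \<xi> = 0" by (simp add: g_def)
  note n = nicely_meromorphic_on_single_pole[where c = b and N = t, OF open_D[OF \<rho>] h t \<xi>(1) eq g0]
  have ag: "agree_near E g G"
  proof (rule agree_near_trans[OF _ agree_near_sym[OF G]])
    show "agree_near E g (\<lambda>z. h z + (\<Sum>i=1..t. b i / (z - \<xi>) ^ i))"
      using \<xi>(2) by (intro agree_nearI[of "- {\<xi>}"]) (auto simp: g_def)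
  qed
  show m: "mero_ext E G (D \<rho>) g" unfolding mero_ext_def using n(1) ag by blast
  show p: "{z \<in> D \<rho>. is_pole g z} = {\<xi>}" by (rule n(2))
  show po: "pole_order g \<xi> = t" using n(3) by simp
  show "\<rho> \<le> rho_mero E \<Phi> t G" unfolding rho_mero_def
    by (rule Sup_upper) (use \<rho> m p po in auto)
  show "sole_pole E \<Phi> \<xi> t G" unfolding sole_pole_def
  proof (intro exI conjI)
    show "open (D \<rho>)" by (rule open_D[OF \<rho>])
    have lt: "ereal (norm (\<Phi> \<xi>)) < \<rho>" using \<xi> by (auto simp: canon_dom_def)
    have "closure (D (ereal (norm (\<Phi> \<xi>)))) \<subseteq> E \<union> {z. z \<notin> E \<and> norm (\<Phi> z) \<le> norm (\<Phi> \<xi>)}"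
      using compact_sublevel by (intro closure_minimal compact_imp_closed) (auto simp: canon_dom_def)
    also have "\<dots> \<subseteq> D \<rho>" using lt by (auto simp: canon_dom_def intro: le_less_trans[OF _ lt])
    finally show "closure (D (ereal (norm (\<Phi> \<xi>)))) \<subseteq> D \<rho>" .
    have "(\<lambda>z. h z + (\<Sum>i=1..t. b i / (z - \<xi>) ^ i)) holomorphic_on D \<rho> - {\<xi>}"
      by (intro holomorphic_intros holomorphic_on_subset[OF h]) auto
    then show "g holomorphic_on D \<rho> - {\<xi>}" by (rule holomorphic_transform) (simp add: g_def)
    show "is_pole g \<xi>" using p by auto
  qed (use ag p po in auto)
qed

text \<open>A continuation of \<open>G\<close> with at most \<open>t\<close> poles spends all of them on the sole pole \<open>\<xi>\<close>.\<close>
lemma sole_pole_rho_representation: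
  assumes \<xi>: "\<xi> \<notin> E" and G: "sole_pole E \<Phi> \<xi> t G" and \<rho>': "norm (\<Phi> \<xi>) < \<rho>'" "ereal \<rho>' < rho_mero E \<Phi> t G"
  shows "\<exists>h b. h holomorphic_on D (ereal \<rho>') \<and> b t \<noteq> 0 \<and> 1 \<le> t \<and>
     agree_near E G (\<lambda>z. h z + (\<Sum>i=1..t. b i / (z - \<xi>) ^ i))"
proof -
  have P: "1 < norm (\<Phi> \<xi>)" using Phi_gt_1[OF \<xi>] .
  obtain \<rho> g where \<rho>: "ereal \<rho>' < \<rho>" "1 < \<rho>" "mero_ext E G (D \<rho>) g" and fin: "finite {z \<in> D \<rho>. is_pole g z}"
    and le: "(\<Sum>z\<in>{z \<in> D \<rho>. is_pole g z}. pole_order g z) \<le> t"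
    using \<rho>'(2) unfolding rho_mero_def less_Sup_iff by auto
  have g: "g nicely_meromorphic_on D \<rho>" "agree_near E g G" using \<rho>(3) by (auto simp: mero_ext_def)
  obtain s h0 b0 where s: "s > norm (\<Phi> \<xi>)" "h0 holomorphic_on D (ereal s)" "b0 t \<noteq> 0" "1 \<le> t"
    and ag0: "agree_near E G (\<lambda>z. h0 z + (\<Sum>i=1..t. b0 i / (z - \<xi>) ^ i))"
    using sole_pole_representation[OF \<xi> G] by blast
  \<comment> \<open>On this common domain the given continuation coincides with the explicit one, so
    its order at \<xi> is exactly t.\<close>
  define s' where "s' = min (ereal s) \<rho>"
  have s'1: "1 < s'" "ereal (norm (\<Phi> \<xi>)) < s'"
  proof -
    have "ereal (norm (\<Phi> \<xi>)) < ereal \<rho>'" using \<rho>' by simp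
    then have "ereal (norm (\<Phi> \<xi>)) < \<rho>" using \<rho>(1) by (rule less_trans)
    then show "ereal (norm (\<Phi> \<xi>)) < s'" using s(1) by (simp add: s'_def)
    show "1 < s'" using \<rho>(2) s(1) P by (simp add: s'_def)
  qed
  have sub: "D s' \<subseteq> D (ereal s)" "D s' \<subseteq> D \<rho>" by (simp_all add: s'_def canon_dom_mono)
  have \<xi>s: "\<xi> \<in> D s'" using s'1 by (simp add: canon_dom_def)
  define g0 where "g0 = (\<lambda>z. if z = \<xi> then 0 else h0 z + (\<Sum>i=1..t. b0 i / (z - \<xi>) ^ i))"
  note ext = single_pole_extension[OF s'1(1) holomorphic_on_subset[OF s(2) sub(1)] \<xi>s \<xi> s(4) _ ag0, folded g0_def, OF s(3)]
  have eq: "g z = g0 z" if "z \<in> D s'" for z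
  proof (rule nicely_meromorphic_unique[OF s'1(1) _ _ _ that])
    show "g nicely_meromorphic_on D s'" using g(1) sub(2) by (rule nicely_meromorphic_on_subset)
    show "g0 nicely_meromorphic_on D s'" "agree_near E g g0"
      using ext(1) agree_near_trans[OF g(2) agree_near_sym] by (auto simp: mero_ext_def)
  qed
  have ev: "\<forall>\<^sub>F z in at \<xi>. g z = g0 z"
    using eventually_at_in_open'[OF open_D[OF s'1(1)] \<xi>s] by eventually_elim (rule eq)
  have "is_pole g0 \<xi>" using ext(2) by auto
  then have pole: "is_pole g \<xi>" using is_pole_cong[OF ev refl] by simp
  have "zorder g \<xi> = zorder g0 \<xi>" by (rule zorder_cong[OF ev refl])
  then have ord: "pole_order g \<xi> = t" using ext(3) pole \<open>is_pole g0 \<xi>\<close> by (simp add: pole_order_def)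
  obtain h c where hc: "h holomorphic_on D \<rho>"
    "\<And>z. z \<in> D \<rho> - {z \<in> D \<rho>. is_pole g z} \<Longrightarrow>
       g z = h z + (\<Sum>\<xi>\<in>{z \<in> D \<rho>. is_pole g z}. \<Sum>i=1..pole_order g \<xi>. c \<xi> i / (z - \<xi>) ^ i)"
    "\<And>\<xi>. \<xi> \<in> {z \<in> D \<rho>. is_pole g z} \<Longrightarrow> c \<xi> (pole_order g \<xi>) \<noteq> 0 \<and> 1 \<le> pole_order g \<xi>"
    using nicely_meromorphic_principal_parts[OF open_D[OF \<rho>(2)] g(1) fin] by auto
  have \<xi>in: "\<xi> \<in> {z \<in> D \<rho>. is_pole g z}" using pole \<xi>s sub by auto
  have only: "{z \<in> D \<rho>. is_pole g z} = {\<xi>}"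
  proof (rule ccontr)
    assume "{z \<in> D \<rho>. is_pole g z} \<noteq> {\<xi>}"
    then obtain \<eta> where \<eta>: "\<eta> \<in> {z \<in> D \<rho>. is_pole g z}" "\<eta> \<noteq> \<xi>" using \<xi>in by blast
    have "(\<Sum>z\<in>{\<xi>, \<eta>}. pole_order g z) \<le> (\<Sum>z\<in>{z \<in> D \<rho>. is_pole g z}. pole_order g z)"
      using \<eta> \<xi>in fin by (intro sum_mono2) auto
    moreover have "1 \<le> pole_order g \<eta>" using hc(3)[OF \<eta>(1)] by simp
    ultimately show False using le ord \<eta>(2) by simp
  qed
  have "agree_near E g (\<lambda>z. h z + (\<Sum>i=1..t. c \<xi> i / (z - \<xi>) ^ i))"
  proof (rule agree_nearI)
    show "open (D \<rho> - {\<xi>})" using open_D[OF \<rho>(2)] by (rule open_delete)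
    show "E \<subseteq> D \<rho> - {\<xi>}" using \<xi> E_subset_D by blast
    show "g z = h z + (\<Sum>i=1..t. c \<xi> i / (z - \<xi>) ^ i)" if "z \<in> D \<rho> - {\<xi>}" for z
      using hc(2)[unfolded only, OF that] ord by simp
  qed
  then have "agree_near E G (\<lambda>z. h z + (\<Sum>i=1..t. c \<xi> i / (z - \<xi>) ^ i))"
    by (rule agree_near_trans[OF agree_near_sym[OF g(2)]])
  moreover have "h holomorphic_on D (ereal \<rho>')"
    using hc(1) by (rule holomorphic_on_subset) (use \<rho>(1) in \<open>simp add: canon_dom_mono\<close>)
  moreover have "c \<xi> t \<noteq> 0" using hc(3)[OF \<xi>in] ord by simp
  ultimately show ?thesis using s(4) by blast
qed

end

text \<open>Only the first i Taylor coefficients of q produce negative powers. What is left is a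
  polynomial of degree at most M, so that its Fourier coefficients of index n > M vanish.\<close>

lemma poly_pole_division:
  fixes q :: "complex poly" and \<xi> :: complex
  assumes "degree q \<le> M"
  shows "\<exists>r. degree r \<le> M \<and> (\<forall>z. z \<noteq> \<xi> \<longrightarrow>
     poly q z / (z - \<xi>) ^ i = (\<Sum>l<i. tcoeff q \<xi> l * (1 / (z - \<xi>) ^ (i - l))) + poly r z)"
proof -
  define r where "r = (\<Sum>l\<in>{i..M}. smult (tcoeff q \<xi> l) ([:- \<xi>, 1:] ^ (l - i)))"
  have "degree r \<le> M" unfolding r_def
  proof (rule degree_sum_le)
    fix l assume "l \<in> {i..M}"
    then show "degree (smult (tcoeff q \<xi> l) ([:- \<xi>, 1:] ^ (l - i))) \<le> M"
      by (auto intro!: order_trans[OF degree_smult_le] simp: degree_linear_power)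
  qed simp
  moreover have "poly q z / (z - \<xi>) ^ i = (\<Sum>l<i. tcoeff q \<xi> l * (1 / (z - \<xi>) ^ (i - l))) + poly r z" if "z \<noteq> \<xi>" for z
  proof -
    have nz: "z - \<xi> \<noteq> 0" using that by simp
    \<comment> \<open>The range is enlarged so that it can be split at i even if i > M; the extra
      coefficients are 0.\<close>
    have "poly q z = (\<Sum>l\<le>M + i. tcoeff q \<xi> l * (z - \<xi>) ^ l)" using assms by (intro poly_tcoeff) simp
    then have "poly q z / (z - \<xi>) ^ i = (\<Sum>l\<le>M + i. tcoeff q \<xi> l * (z - \<xi>) ^ l / (z - \<xi>) ^ i)"
      by (simp add: sum_divide_distrib)
    also have "{..M + i} = {..<i} \<union> {i..M + i}" by auto
    also have "(\<Sum>l\<in>{..<i} \<union> {i..M + i}. tcoeff q \<xi> l * (z - \<xi>) ^ l / (z - \<xi>) ^ i) =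
      (\<Sum>l<i. tcoeff q \<xi> l * (z - \<xi>) ^ l / (z - \<xi>) ^ i) + (\<Sum>l\<in>{i..M + i}. tcoeff q \<xi> l * (z - \<xi>) ^ l / (z - \<xi>) ^ i)"
      by (rule sum.union_disjoint) auto
    also have "(\<Sum>l<i. tcoeff q \<xi> l * (z - \<xi>) ^ l / (z - \<xi>) ^ i) = (\<Sum>l<i. tcoeff q \<xi> l * (1 / (z - \<xi>) ^ (i - l)))"
      using nz by (intro sum.cong) (auto simp: power_diff)
    also have "(\<Sum>l\<in>{i..M + i}. tcoeff q \<xi> l * (z - \<xi>) ^ l / (z - \<xi>) ^ i) = (\<Sum>l\<in>{i..M}. tcoeff q \<xi> l * (z - \<xi>) ^ l / (z - \<xi>) ^ i)"
    proof (rule sum.mono_neutral_right)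
      have "tcoeff q \<xi> l = 0" if "M < l" for l
        unfolding tcoeff_def using assms that by (intro coeff_eq_0) (simp add: degree_pcompose)
      then show "\<forall>l\<in>{i..M + i} - {i..M}. tcoeff q \<xi> l * (z - \<xi>) ^ l / (z - \<xi>) ^ i = 0" by auto
    qed auto
    also have "\<dots> = poly r z"
      unfolding r_def poly_sum
    proof (intro sum.cong refl)
      fix l assume "l \<in> {i..M}"
      then have "(z - \<xi>) ^ l = (z - \<xi>) ^ (l - i) * (z - \<xi>) ^ i" by (simp flip: power_add)
      then show "tcoeff q \<xi> l * (z - \<xi>) ^ l / (z - \<xi>) ^ i = poly (smult (tcoeff q \<xi> l) ([:- \<xi>, 1:] ^ (l - i))) z"
        using nz by (simp add: poly_power)
    qed
    finally show ?thesis .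
  qed
  ultimately show ?thesis by blast
qed

section \<open>Fourier coefficients of products with varying polynomials\<close>

context regular_domain
begin

lemma fourier_poly_pole:
  assumes q: "degree q \<le> M" "M < n" and \<xi>: "\<xi> \<notin> E"
  shows "fourier n (\<lambda>z. poly q z / (z - \<xi>) ^ i) = (\<Sum>l<i. tcoeff q \<xi> l * fourier n (\<lambda>z. 1 / (z - \<xi>) ^ (i - l)))"
proof -
  obtain r where r: "degree r \<le> M" "\<And>z. z \<noteq> \<xi> \<Longrightarrow>
     poly q z / (z - \<xi>) ^ i = (\<Sum>l<i. tcoeff q \<xi> l * (1 / (z - \<xi>) ^ (i - l))) + poly r z"
    using poly_pole_division[OF q(1), of \<xi> i] by blast
  have c: "continuous_on E (\<lambda>z. 1 / (z - \<xi>) ^ s)" for s using \<xi> by (intro continuous_intros) auto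
  have "fourier n (\<lambda>z. poly q z / (z - \<xi>) ^ i) = fourier n (\<lambda>z. (\<Sum>l<i. tcoeff q \<xi> l * (1 / (z - \<xi>) ^ (i - l))) + poly r z)"
    by (rule fourier_cong) (metis r(2) \<xi>)
  also have "\<dots> = (\<Sum>l<i. tcoeff q \<xi> l * fourier n (\<lambda>z. 1 / (z - \<xi>) ^ (i - l))) + fourier n (poly r)"
  proof -
    have "fourier n (\<lambda>z. \<Sum>l<i. tcoeff q \<xi> l * (1 / (z - \<xi>) ^ (i - l))) =
        (\<Sum>l<i. fourier n (\<lambda>z. tcoeff q \<xi> l * (1 / (z - \<xi>) ^ (i - l))))"
      by (rule fourier_sum) (intro continuous_on_mult_left c)
    then have "fourier n (\<lambda>z. \<Sum>l<i. tcoeff q \<xi> l * (1 / (z - \<xi>) ^ (i - l))) =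
        (\<Sum>l<i. tcoeff q \<xi> l * fourier n (\<lambda>z. 1 / (z - \<xi>) ^ (i - l)))"
      by (simp only: fourier_cmult)
    moreover have "fourier n (\<lambda>z. (\<Sum>l<i. tcoeff q \<xi> l * (1 / (z - \<xi>) ^ (i - l))) + poly r z) =
        fourier n (\<lambda>z. \<Sum>l<i. tcoeff q \<xi> l * (1 / (z - \<xi>) ^ (i - l))) + fourier n (poly r)"
      by (intro fourier_add continuous_on_sum continuous_on_mult_left c continuous_intros)
    ultimately show ?thesis by simp
  qed
  also have "fourier n (poly r) = 0" using r(1) q(2) by (intro fourier_poly_zero) simp
  finally show ?thesis by simp
qed

lemma fourier_poly_mult:
  assumes "degree q \<le> M" "continuous_on E h"
  shows "fourier n (\<lambda>z. poly q z * h z) = (\<Sum>k\<le>M. coeff q k * fourier n (\<lambda>z. z ^ k * h z))"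
proof -
  have "poly q z = (\<Sum>k\<le>M. coeff q k * z ^ k)" for z
    unfolding poly_altdef by (rule sum.mono_neutral_left) (use assms in \<open>auto simp: coeff_eq_0\<close>)
  then have "fourier n (\<lambda>z. poly q z * h z) = fourier n (\<lambda>z. \<Sum>k\<le>M. coeff q k * (z ^ k * h z))"
    by (intro fourier_cong) (simp add: sum_distrib_right mult.assoc)
  also have "\<dots> = (\<Sum>k\<le>M. coeff q k * fourier n (\<lambda>z. z ^ k * h z))"
    by (subst fourier_sum) (auto intro!: continuous_intros assms simp: fourier_cmult)
  finally show ?thesis .
qed

text \<open>Expanding \<open>q n\<close> in powers of z separates its coefficients from Fourier
  coefficients of finitely many fixed functions, and the rates multiply.\<close>

lemma fourier_poly_mult_rate:
  assumes q: "\<And>n. degree (q n) \<le> M" "\<And>i. rate_le (\<lambda>n. coeff (q n) i) \<theta>" "0 \<le> \<theta>"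
    and h: "h holomorphic_on D \<rho>" and r: "1 < r" "ereal r < \<rho>"
  shows "rate_le (\<lambda>n. fourier n (\<lambda>z. poly (q n) z * h z)) (\<theta> * (1 / r))"
proof -
  have "rate_le (\<lambda>n. \<Sum>k\<le>M. coeff (q n) k * fourier n (\<lambda>z. z ^ k * h z)) (\<theta> * (1 / r))"
    using q r by (intro rate_le_sum rate_le_mult fourier_rate[of _ \<rho>] holomorphic_intros h) auto
  then show ?thesis using fourier_poly_mult[OF q(1) continuous_on_E_of_holomorphic[OF h]] by simp
qed

end

section \<open>Convergence of the denominators\<close>

locale hermite_pade = regular_domain +
  fixes d :: nat and F :: "nat \<Rightarrow> complex \<Rightarrow> complex" and m :: "nat \<Rightarrow> nat"
  assumes d_pos: "1 \<le> d" and F_analytic: "\<And>i. i \<in> {1..d} \<Longrightarrow> F i analytic_on E"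
    and m_pos: "\<And>i. i \<in> {1..d} \<Longrightarrow> 1 \<le> m i"
    and finite_poles: "finite (system_poles E \<Phi> d F m)"
    and sum_orders: "(\<Sum>\<xi>\<in>system_poles E \<Phi> d F m. system_order E \<Phi> d F m \<xi>) = multi_size d m"
begin

abbreviation "S \<equiv> system_poles E \<Phi> d F m"
abbreviation "\<tau> \<equiv> system_order E \<Phi> d F m"
abbreviation "M \<equiv> multi_size d m"
abbreviation "PC \<equiv> poly_comb d F m"
abbreviation "Q\<^sub>F \<equiv> system_poly E \<Phi> d F m"

text \<open>Two orders with the defining maximality bound each other, so the definite description in
  \<open>system_order\<close> denotes an actual order.\<close>

lemma system_pole_order: "\<xi> \<in> S \<Longrightarrow> system_pole E \<Phi> d F m \<xi> (\<tau> \<xi>)"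
proof -
  assume "\<xi> \<in> S"
  then obtain t where t: "system_pole E \<Phi> d F m \<xi> t" unfolding system_poles_def by blast
  have le: "a \<le> b" if "system_pole E \<Phi> d F m \<xi> a" "system_pole E \<Phi> d F m \<xi> b" for a b
  proof -
    have *: "\<forall>t\<in>{1..a}. \<exists>G\<in>PC. sole_pole E \<Phi> \<xi> t G" using that(1) unfolding system_pole_def by (elim conjE)
    have "\<forall>\<tau>'. (\<forall>t\<in>{1..\<tau>'}. \<exists>G\<in>PC. sole_pole E \<Phi> \<xi> t G) \<longrightarrow> \<tau>' \<le> b"
      using that(2) unfolding system_pole_def by (elim conjE)
    from spec[OF this, of a] show ?thesis using * by (rule mp)
  qed
  have "(THE t. system_pole E \<Phi> d F m \<xi> t) = t"
    by (rule the_equality[where P = "system_pole E \<Phi> d F m \<xi>", OF t]) (rule order_antisym[OF le[OF _ t] le[OF t]])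
  then show ?thesis using t unfolding system_order_def by simp
qed

lemma system_pole_notin: "\<xi> \<in> S \<Longrightarrow> \<xi> \<notin> E"
  by (drule system_pole_order) (unfold system_pole_def, elim conjE)

lemma system_order_pos: "\<xi> \<in> S \<Longrightarrow> 1 \<le> \<tau> \<xi>"
  by (drule system_pole_order) (unfold system_pole_def, elim conjE)

lemma system_pole_comb:
  assumes "\<xi> \<in> S" "1 \<le> t" "t \<le> \<tau> \<xi>" shows "\<exists>G\<in>PC. sole_pole E \<Phi> \<xi> t G"
proof -
  have "\<forall>t\<in>{1..\<tau> \<xi>}. \<exists>G\<in>PC. sole_pole E \<Phi> \<xi> t G"
    using system_pole_order[OF assms(1)] unfolding system_pole_def by (elim conjE)
  then show ?thesis by (rule bspec) (use assms in simp)
qed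

lemma continuous_F: "i \<in> {1..d} \<Longrightarrow> continuous_on E (F i)"
  using F_analytic analytic_imp_holomorphic holomorphic_on_imp_continuous_on by blast

lemma PC_continuous: "G \<in> PC \<Longrightarrow> continuous_on E G"
  unfolding poly_comb_def by (auto intro!: continuous_intros continuous_F)

lemma PC_lincomb:
  assumes "G \<in> PC" "H \<in> PC" shows "(\<lambda>z. G z + c * H z) \<in> PC"
proof -
  obtain v w where v: "G = (\<lambda>z. \<Sum>i=1..d. poly (v i) z * F i z)" "\<And>i. i \<in> {1..d} \<Longrightarrow> degree (v i) < m i"
    and w: "H = (\<lambda>z. \<Sum>i=1..d. poly (w i) z * F i z)" "\<And>i. i \<in> {1..d} \<Longrightarrow> degree (w i) < m i"
    using assms unfolding poly_comb_def by blast
  have "(\<lambda>z. G z + c * H z) = (\<lambda>z. \<Sum>i=1..d. poly (v i + smult c (w i)) z * F i z)"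
    by (simp add: v(1) w(1) sum_distrib_left sum.distrib ring_distribs mult.assoc)
  moreover have "degree (v i + smult c (w i)) < m i" if "i \<in> {1..d}" for i
    using v(2)[OF that] w(2)[OF that] by (intro degree_add_less le_less_trans[OF degree_smult_le])
  ultimately show ?thesis unfolding poly_comb_def by (intro CollectI exI[of _ "\<lambda>i. v i + smult c (w i)"]) auto
qed

lemma PC_zero: "(\<lambda>z. 0) \<in> PC"
  unfolding poly_comb_def using m_pos by (intro CollectI exI[of _ "\<lambda>_. 0"]) (auto intro: less_le_trans[of 0 1])

lemma PC_cmult: "G \<in> PC \<Longrightarrow> (\<lambda>z. c * G z) \<in> PC"
  using PC_lincomb[OF PC_zero, of G c] by simp

lemma PC_sum:
  assumes "\<And>i. i \<in> I \<Longrightarrow> G i \<in> PC" shows "(\<lambda>z. \<Sum>i\<in>I. G i z) \<in> PC"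
  using assms
proof (induction I rule: infinite_finite_induct)
  case (insert i I)
  then show ?case using PC_lincomb[of "\<lambda>z. \<Sum>i\<in>I. G i z" "G i" 1] by (simp add: add.commute)
qed (simp_all add: PC_zero)

text \<open>The orthogonality relation of index j = n, where the numerator, of degree below n, has
  dropped out. Being linear in q, it passes to multiples and differences of denominators.\<close>

definition annihilates :: "nat \<Rightarrow> complex poly \<Rightarrow> bool" where
  "annihilates n q \<longleftrightarrow> (\<forall>G\<in>PC. fourier n (\<lambda>z. poly q z * G z) = 0)"

lemma HP_numerator_fourier:
  assumes "HP_numerator \<mu> p f n q k P" "continuous_on E f" "j \<le> n"
  shows "fourier j (\<lambda>z. poly q z * (z ^ k * f z)) = fourier j (poly P)"
proof -
  have "fourier j (\<lambda>z. poly q z * z ^ k * f z - poly P z) = 0"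
    using assms unfolding HP_numerator_def fourier_def by blast
  then have "fourier j (\<lambda>z. poly q z * z ^ k * f z) - fourier j (poly P) = 0"
    by (subst (asm) fourier_diff) (auto intro!: continuous_intros assms)
  then show ?thesis by (simp add: mult.assoc)
qed

lemma HP_denominator_annihilates:
  assumes "HP_denominator \<mu> p d F m n q" "1 \<le> n" shows "annihilates n q"
  unfolding annihilates_def
proof
  fix G assume "G \<in> PC"
  then obtain v where v: "G = (\<lambda>z. \<Sum>i=1..d. poly (v i) z * F i z)" "\<And>i. i \<in> {1..d} \<Longrightarrow> degree (v i) < m i"
    unfolding poly_comb_def by blast
  have z: "fourier n (\<lambda>z. poly q z * (z ^ k * F i z)) = 0" if i: "i \<in> {1..d}" "k < m i" for i k
  proof -
    obtain P where P: "HP_numerator \<mu> p (F i) n q k P" using assms i unfolding HP_denominator_def by blast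
    then have "degree P < n" using assms(2) unfolding HP_numerator_def by auto
    then show ?thesis using HP_numerator_fourier[OF P continuous_F[OF i(1)], of n] fourier_poly_zero by simp
  qed
  have "fourier n (\<lambda>z. poly q z * G z) = fourier n (\<lambda>z. \<Sum>i=1..d. poly (v i) z * (poly q z * F i z))"
    by (rule fourier_cong) (simp add: v(1) sum_distrib_left mult_ac)
  also have "\<dots> = (\<Sum>i=1..d. fourier n (\<lambda>z. poly (v i) z * (poly q z * F i z)))"
    by (rule fourier_sum) (intro continuous_intros continuous_F)
  also have "\<dots> = (\<Sum>i=1..d. 0)"
  proof (rule sum.cong[OF refl])
    fix i assume i: "i \<in> {1..d}"
    have "fourier n (\<lambda>z. poly (v i) z * (poly q z * F i z)) =
        (\<Sum>k\<le>m i - 1. coeff (v i) k * fourier n (\<lambda>z. z ^ k * (poly q z * F i z)))"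
      using v(2)[OF i] by (intro fourier_poly_mult continuous_intros continuous_F i) auto
    also have "\<dots> = (\<Sum>k\<le>m i - 1. 0)"
    proof (rule sum.cong[OF refl])
      fix k assume "k \<in> {..m i - 1}"
      then have "k < m i" using m_pos[OF i] by auto
      then show "coeff (v i) k * fourier n (\<lambda>z. z ^ k * (poly q z * F i z)) = 0"
        using z[OF i] by (simp add: mult_ac)
    qed
    finally show "fourier n (\<lambda>z. poly (v i) z * (poly q z * F i z)) = 0" by simp
  qed
  finally show "fourier n (\<lambda>z. poly q z * G z) = 0" by simp
qed

lemma annihilates_smult: "annihilates n q \<Longrightarrow> annihilates n (smult c q)"
  unfolding annihilates_def by (simp add: fourier_cmult mult.assoc)

lemma annihilates_diff:
  assumes "annihilates n q" "annihilates n r" shows "annihilates n (q - r)"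
  unfolding annihilates_def
proof
  fix G assume G: "G \<in> PC"
  have "fourier n (\<lambda>z. poly (q - r) z * G z) = fourier n (\<lambda>z. poly q z * G z - poly r z * G z)"
    by (rule fourier_cong) (simp add: algebra_simps)
  also have "\<dots> = fourier n (\<lambda>z. poly q z * G z) - fourier n (\<lambda>z. poly r z * G z)"
    by (intro fourier_diff continuous_intros PC_continuous[OF G])
  also have "\<dots> = 0" using assms G unfolding annihilates_def by simp
  finally show "fourier n (\<lambda>z. poly (q - r) z * G z) = 0" .
qed

lemma brho_pole_le_rho_pole: "1 \<le> k \<Longrightarrow> k \<le> t \<Longrightarrow> brho_pole E \<Phi> d F m \<xi> t \<le> rho_pole E \<Phi> d F m \<xi> k"
  unfolding brho_pole_def by (intro Min_le) auto

lemma brho_pole_antimono: "1 \<le> t \<Longrightarrow> t \<le> t' \<Longrightarrow> brho_pole E \<Phi> d F m \<xi> t' \<le> brho_pole E \<Phi> d F m \<xi> t"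
  unfolding brho_pole_def by (intro Min_antimono) auto

text \<open>A combination with a sole pole at \<xi> is defined on a neighbourhood of a closed
  domain, so every index lies strictly beyond the circle of \<xi>. This strictness makes \<Theta>
  less than 1.\<close>

lemma brho_pole_gt:
  assumes \<xi>: "\<xi> \<in> S" and t: "1 \<le> t" "t \<le> \<tau> \<xi>"
  shows "ereal (norm (\<Phi> \<xi>)) < brho_pole E \<Phi> d F m \<xi> t"
proof -
  have "ereal (norm (\<Phi> \<xi>)) < rho_pole E \<Phi> d F m \<xi> k" if k: "k \<in> {1..t}" for k
  proof -
    have \<xi>E: "\<xi> \<notin> E" by (rule system_pole_notin[OF \<xi>])
    have kt: "1 \<le> k" "k \<le> \<tau> \<xi>" using k t by auto
    obtain G where G: "G \<in> PC" "sole_pole E \<Phi> \<xi> k G" using system_pole_comb[OF \<xi> kt] by blast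
    obtain s h b where s: "s > norm (\<Phi> \<xi>)" "h holomorphic_on D (ereal s)" "b k \<noteq> 0" "1 \<le> k"
      "agree_near E G (\<lambda>z. h z + (\<Sum>i=1..k. b i / (z - \<xi>) ^ i))"
      using sole_pole_representation[OF \<xi>E G(2)] by blast
    have "\<xi> \<in> D (ereal s)" "1 < ereal s" using s(1) Phi_gt_1[OF \<xi>E] by (auto simp: canon_dom_def)
    then have "ereal s \<le> rho_mero E \<Phi> k G"
      using single_pole_extension(4)[OF _ s(2) _ \<xi>E s(4) _ s(5)] s(3) by blast
    also have "\<dots> \<le> rho_pole E \<Phi> d F m \<xi> k" unfolding rho_pole_def using G by (intro SUP_upper) auto
    finally show ?thesis using s(1) by (metis less_ereal.simps(1) less_le_trans)
  qed
  then show ?thesis unfolding brho_pole_def using t by (subst Min_gr_iff) auto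
qed

text \<open>The sum of the residue terms of \<open>q\<^sub>n G\<close> at \<open>\<xi>\<close> is triangular in the Taylor coefficients of \<open>q\<^sub>n\<close>:
  a combination with a pole of order \<open>l + 1\<close> controls the coefficient of index \<open>l\<close> through the previous ones.\<close>
lemma tcoeff_rate:
  assumes q: "\<And>n. degree (q n) \<le> M" "\<And>i. rate_le (\<lambda>n. coeff (q n) i) 1"
    and ann: "\<And>n. 1 \<le> n \<Longrightarrow> annihilates n (q n)" and \<xi>: "\<xi> \<in> S"
  shows "l < \<tau> \<xi> \<Longrightarrow> norm (\<Phi> \<xi>) < \<rho>' \<Longrightarrow> ereal \<rho>' < brho_pole E \<Phi> d F m \<xi> (Suc l) \<Longrightarrow>
     rate_le (\<lambda>n. tcoeff (q n) \<xi> l) (norm (\<Phi> \<xi>) / \<rho>')"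
proof (induction l rule: less_induct)
  case (less l)
  define R where "R = norm (\<Phi> \<xi>)"
  have \<xi>E: "\<xi> \<notin> E" by (rule system_pole_notin[OF \<xi>])
  have R: "1 < R" "R < \<rho>'" using Phi_gt_1[OF \<xi>E] less.prems by (auto simp: R_def)
  \<comment> \<open>The estimate for the holomorphic part integrates over the curve of index \<rho>'
    and so needs holomorphy on a strictly larger domain.\<close>
  obtain \<rho>'' where \<rho>'': "\<rho>' < \<rho>''" "ereal \<rho>'' < brho_pole E \<Phi> d F m \<xi> (Suc l)"
    using less.prems(3) ereal_dense2[of "ereal \<rho>'"] by auto
  have "brho_pole E \<Phi> d F m \<xi> (Suc l) \<le> rho_pole E \<Phi> d F m \<xi> (Suc l)" by (rule brho_pole_le_rho_pole) auto
  then have "ereal \<rho>'' < rho_pole E \<Phi> d F m \<xi> (Suc l)" using \<rho>''(2) by (rule less_le_trans[rotated])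
  then obtain G where G: "G \<in> PC" "sole_pole E \<Phi> \<xi> (Suc l) G" "ereal \<rho>'' < rho_mero E \<Phi> (Suc l) G"
    unfolding rho_pole_def less_SUP_iff by blast
  have "norm (\<Phi> \<xi>) < \<rho>''" using less.prems(2) \<rho>''(1) by simp
  then obtain h b where hb: "h holomorphic_on D (ereal \<rho>'')" "b (Suc l) \<noteq> 0"
    "agree_near E G (\<lambda>z. h z + (\<Sum>i=1..Suc l. b i / (z - \<xi>) ^ i))"
    using sole_pole_rho_representation[OF \<xi>E G(2) _ G(3)] by blast
  define e where "e s n = fourier n (\<lambda>z. 1 / (z - \<xi>) ^ s)" for s n
  define A where "A n = fourier n (\<lambda>z. poly (q n) z * h z)" for n
  define T where "T j n = tcoeff (q n) \<xi> j" for j n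
  define W where "W n = (\<Sum>i=1..l. b i * (\<Sum>j<i. T j n * e (i - j) n)) + b (Suc l) * (\<Sum>j<l. T j n * e (Suc l - j) n)" for n
  have c: "continuous_on E (\<lambda>z. 1 / (z - \<xi>) ^ s)" "continuous_on E (\<lambda>z. poly r z / (z - \<xi>) ^ s)" for s r
    using \<xi>E by (auto intro!: continuous_intros)
  have ch: "continuous_on E h" using continuous_on_E_of_holomorphic[OF hb(1)] .
  \<comment> \<open>For n > M the polynomial parts drop out. The Taylor coefficient of index l
    occurs once only, with the top coefficient \<open>b (Suc l)\<close> and the simple-pole factor
    \<open>e 1 n\<close>.\<close>
  have main: "b (Suc l) * (T l n * e 1 n) = - A n - W n" if n: "M < n" for n
  proof -
    have "0 = fourier n (\<lambda>z. poly (q n) z * G z)"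
      using ann[of n] n G(1) unfolding annihilates_def by auto
    also have "\<dots> = fourier n (\<lambda>z. poly (q n) z * h z + (\<Sum>i=1..Suc l. b i * (poly (q n) z / (z - \<xi>) ^ i)))"
    proof (rule fourier_cong)
      fix z assume "z \<in> E"
      have "G z = h z + (\<Sum>i=1..Suc l. b i / (z - \<xi>) ^ i)" using agree_near_on[OF hb(3) \<open>z \<in> E\<close>] .
      then show "poly (q n) z * G z = poly (q n) z * h z + (\<Sum>i=1..Suc l. b i * (poly (q n) z / (z - \<xi>) ^ i))"
        by (simp only: ring_distribs sum_distrib_left) (simp add: mult_ac)
    qed
    also have "\<dots> = A n + fourier n (\<lambda>z. \<Sum>i=1..Suc l. b i * (poly (q n) z / (z - \<xi>) ^ i))"
      unfolding A_def by (intro fourier_add continuous_on_sum continuous_on_mult_left c continuous_intros ch)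
    also have "fourier n (\<lambda>z. \<Sum>i=1..Suc l. b i * (poly (q n) z / (z - \<xi>) ^ i)) =
        (\<Sum>i=1..Suc l. fourier n (\<lambda>z. b i * (poly (q n) z / (z - \<xi>) ^ i)))"
      by (rule fourier_sum) (intro continuous_on_mult_left c)
    also have "\<dots> = (\<Sum>i=1..Suc l. b i * (\<Sum>j<i. T j n * e (i - j) n))"
      unfolding fourier_cmult T_def e_def using fourier_poly_pole[OF q(1) n \<xi>E] by simp
    also have "\<dots> = W n + b (Suc l) * (T l n * e 1 n)"
      by (simp add: W_def ring_distribs)
    finally show ?thesis by (simp add: algebra_simps add_eq_0_iff)
  qed
  have rT: "rate_le (T j) (R / \<rho>')" if "j < l" for j
    unfolding T_def R_def
  proof (rule less.IH[OF that])
    show "j < \<tau> \<xi>" "norm (\<Phi> \<xi>) < \<rho>'" using that less.prems by auto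
    have "brho_pole E \<Phi> d F m \<xi> (Suc l) \<le> brho_pole E \<Phi> d F m \<xi> (Suc j)"
      using that by (intro brho_pole_antimono) auto
    then show "ereal \<rho>' < brho_pole E \<Phi> d F m \<xi> (Suc j)" using less.prems(3) by (rule less_le_trans[rotated])
  qed
  have re: "rate_le (e s) (1 / R)" for s unfolding e_def R_def by (rule fourier_pole_rate[OF \<xi>E])
  \<comment> \<open>The factor R in the rate of a Taylor coefficient cancels against the rate 1 / R
    of the pole, which leaves the rate 1 / \<rho>' of the holomorphic part.\<close>
  have rTe: "rate_le (\<lambda>n. T j n * e s n) (1 / \<rho>')" if "j < l" for j s
    using rate_le_mult[OF rT[OF that] re] R by simp
  have const: "rate_le (\<lambda>n. b' * a n) x" if "rate_le a x" "0 \<le> x" for b' :: complex and a x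
    by (rule rate_le_mult_bounded[of "\<lambda>_. b'" "norm b'"]) (use that in auto)
  have "rate_le A (1 * (1 / \<rho>'))" unfolding A_def
    by (rule fourier_poly_mult_rate[OF q(1,2) _ hb(1)]) (use R \<rho>'' in auto)
  then have rA: "rate_le A (1 / \<rho>')" by simp
  have rW: "rate_le W (1 / \<rho>')" unfolding W_def
    by (intro rate_le_add rate_le_sum const rTe) (use R in auto)
  have "rate_le (\<lambda>n. - A n + - W n) (1 / \<rho>')"
    by (intro rate_le_add) (use rA rW R in \<open>auto simp: rate_le_uminus\<close>)
  then have r1: "rate_le (\<lambda>n. (1 / b (Suc l)) * (- A n + - W n)) (1 / \<rho>')" using R by (intro const) auto
  have ev: "\<forall>\<^sub>F n in sequentially. T l n * e 1 n = (1 / b (Suc l)) * (- A n + - W n)"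
    using eventually_gt_at_top[of M]
  proof eventually_elim
    case (elim n)
    have "T l n * e 1 n = (1 / b (Suc l)) * (b (Suc l) * (T l n * e 1 n))" using hb(2) by simp
    also have "\<dots> = (1 / b (Suc l)) * (- A n + - W n)" unfolding main[OF elim] by simp
    finally show ?case .
  qed
  have "rate_le (\<lambda>n. T l n * e 1 n) (1 / \<rho>')" by (rule rate_le_cong[OF r1 _ ev]) (use R in simp)
  \<comment> \<open>Division by \<open>e 1 n\<close>, whose lower rate is 1 / R, restores the factor
    R.\<close>
  then have "rate_le (T l) ((1 / \<rho>') / (1 / R))"
  proof (rule rate_le_cancel)
    show "\<forall>\<^sub>F n in sequentially. v ^ n \<le> norm (e 1 n)" if "0 < v" "v < 1 / R" for v
      using that unfolding e_def R_def by (rule fourier_simple_pole_lower[OF \<xi>E])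
  qed (use R in auto)
  then show ?case by (simp add: T_def[abs_def] R_def)
qed

section \<open>From Taylor data at the system poles to the denominators\<close>

definition \<Theta> :: ereal where
  "\<Theta> = (MAX \<xi>\<in>S. ereal (norm (\<Phi> \<xi>)) / brho E \<Phi> d F m \<xi>)"

lemma M_pos: "1 \<le> M"
proof -
  have "m 1 \<le> M" unfolding multi_size_def using d_pos by (intro member_le_sum) auto
  then show ?thesis using m_pos[of 1] d_pos by simp
qed

lemma S_nonempty: "S \<noteq> {}"
  using sum_orders M_pos by (metis not_one_le_zero sum.empty)

lemma brho_gt: "\<xi> \<in> S \<Longrightarrow> ereal (norm (\<Phi> \<xi>)) < brho E \<Phi> d F m \<xi>"
  unfolding brho_def using brho_pole_gt system_order_pos by blast

lemma Theta_ge: "\<xi> \<in> S \<Longrightarrow> ereal (norm (\<Phi> \<xi>)) / brho E \<Phi> d F m \<xi> \<le> \<Theta>"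
  unfolding \<Theta>_def using finite_poles by (intro Max_ge) auto

lemma Phi_div_brho:
  assumes "\<xi> \<in> S" shows "0 \<le> ereal (norm (\<Phi> \<xi>)) / brho E \<Phi> d F m \<xi>" "ereal (norm (\<Phi> \<xi>)) / brho E \<Phi> d F m \<xi> < 1"
proof -
  have "1 < norm (\<Phi> \<xi>)" using Phi_gt_1 system_pole_notin assms by blast
  then show "0 \<le> ereal (norm (\<Phi> \<xi>)) / brho E \<Phi> d F m \<xi>" "ereal (norm (\<Phi> \<xi>)) / brho E \<Phi> d F m \<xi> < 1"
    using brho_gt[OF assms] by (cases "brho E \<Phi> d F m \<xi>"; simp add: field_simps)+
qed

lemma Theta_bounds: "0 \<le> \<Theta>" "\<Theta> < 1"
proof -
  obtain \<xi> where "\<xi> \<in> S" using S_nonempty by blast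
  then show "0 \<le> \<Theta>" using Theta_ge Phi_div_brho(1) order_trans by blast
  show "\<Theta> < 1" unfolding \<Theta>_def using finite_poles S_nonempty Phi_div_brho by (subst Max_less_iff) auto
qed

text \<open>Turns a bound on the extended real quotient, which is 0 for an infinite index, into a
  real radius that \<open>tcoeff_rate\<close> accepts.\<close>

lemma Theta_less_index:
  assumes "\<Theta> < ereal y" "\<xi> \<in> S"
  shows "\<exists>\<rho>'. norm (\<Phi> \<xi>) < \<rho>' \<and> ereal \<rho>' < brho E \<Phi> d F m \<xi> \<and> norm (\<Phi> \<xi>) / \<rho>' \<le> y"
proof -
  define R where "R = norm (\<Phi> \<xi>)"
  have R: "1 < R" unfolding R_def using Phi_gt_1 system_pole_notin assms by blast
  have lt: "ereal R / brho E \<Phi> d F m \<xi> < ereal y"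
    unfolding R_def using Theta_ge[OF assms(2)] assms(1) by (rule le_less_trans)
  have y: "0 < y" using Theta_bounds(1) assms(1) by (metis le_less_trans zero_ereal_def less_ereal.simps(1))
  show ?thesis
  proof (cases "brho E \<Phi> d F m \<xi>")
    case (real b)
    have b: "R < b" using brho_gt[OF assms(2)] real by (simp add: R_def)
    then have "R / b < y" using lt real R by simp
    then have "R / y < b" using b R y by (simp add: field_simps)
    then obtain \<rho>' where "max R (R / y) < \<rho>'" "\<rho>' < b" using b dense[of "max R (R / y)" b] by auto
    then show ?thesis using real y R by (intro exI[of _ \<rho>']) (auto simp: R_def[symmetric] field_simps)
  next
    case PInf
    define \<rho>' where "\<rho>' = max (R + 1) (R / y)"
    have "R < \<rho>'" "R / y \<le> \<rho>'" by (auto simp: \<rho>'_def)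
    then show ?thesis using PInf y R by (intro exI[of _ \<rho>']) (auto simp: R_def[symmetric] field_simps)
  next
    case MInf then show ?thesis using brho_gt[OF assms(2)] by simp
  qed
qed

lemma degree_system_poly: "degree Q\<^sub>F = M" and monic_system_poly: "coeff Q\<^sub>F M = 1"
proof -
  have "degree (\<Prod>\<xi>\<in>S. [:- \<xi>, 1:] ^ \<tau> \<xi>) = (\<Sum>\<xi>\<in>S. degree ([:- \<xi>, 1:] ^ \<tau> \<xi>))"
    by (rule degree_prod_eq_sum_degree) simp
  then show deg: "degree Q\<^sub>F = M" unfolding system_poly_def by (simp add: degree_linear_power sum_orders)
  have "lead_coeff Q\<^sub>F = 1" unfolding system_poly_def lead_coeff_prod lead_coeff_power by simp
  then show "coeff Q\<^sub>F M = 1" using deg by simp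
qed

lemma system_poly_dvd: "\<xi> \<in> S \<Longrightarrow> [:- \<xi>, 1:] ^ \<tau> \<xi> dvd Q\<^sub>F"
  unfolding system_poly_def using finite_poles by (intro dvd_prodI)

lemma poly_system_poly_eq_0_iff: "poly Q\<^sub>F z = 0 \<longleftrightarrow> z \<in> S"
proof -
  have "poly Q\<^sub>F z = (\<Prod>\<xi>\<in>S. (z - \<xi>) ^ \<tau> \<xi>)" unfolding system_poly_def by (simp add: poly_prod poly_power)
  also have "\<dots> = 0 \<longleftrightarrow> (\<exists>\<xi>\<in>S. (z - \<xi>) ^ \<tau> \<xi> = 0)" by (rule prod_zero_iff[OF finite_poles])
  also have "\<dots> \<longleftrightarrow> (\<exists>\<xi>\<in>S. z = \<xi>)"
  proof (rule bex_cong[OF refl])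
    fix \<xi> assume "\<xi> \<in> S"
    then have "0 < \<tau> \<xi>" using system_order_pos[of \<xi>] by simp
    then show "(z - \<xi>) ^ \<tau> \<xi> = 0 \<longleftrightarrow> z = \<xi>" by simp
  qed
  finally show ?thesis by simp
qed

text \<open>Subtracting the multiple of \<open>Q\<^sub>F\<close> with the same coefficient of degree
  M leaves degree below M, and does not change the Taylor data, since \<open>Q\<^sub>F\<close>
  vanishes at each system pole to its order. The data number exactly M, so Hermite interpolation
  controls the difference. The coefficient of degree M may still be 0 here.\<close>

lemma normalized_denominator_rate:
  assumes q: "\<And>n. degree (q n) \<le> M" "\<And>i. rate_le (\<lambda>n. coeff (q n) i) 1"
    and ann: "\<And>n. 1 \<le> n \<Longrightarrow> annihilates n (q n)" and y: "\<Theta> < ereal y"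
  shows "rate_le (\<lambda>n. coeff (q n - smult (coeff (q n) M) Q\<^sub>F) i) y"
proof -
  have y0: "0 < y" using Theta_bounds(1) y by (metis le_less_trans zero_ereal_def less_ereal.simps(1))
  define r where "r n = q n - smult (coeff (q n) M) Q\<^sub>F" for n
  have "degree (r n) \<le> M" for n
    unfolding r_def using q(1) degree_system_poly by (intro degree_diff_le order_trans[OF degree_smult_le]) auto
  moreover have "coeff (r n) M = 0" for n by (simp add: r_def monic_system_poly)
  ultimately have deg: "degree (r n) < (\<Sum>\<xi>\<in>S. \<tau> \<xi>) \<or> r n = 0" for n
    unfolding sum_orders by (metis le_neq_implies_less leading_coeff_0_iff)
  obtain C where C: "C \<ge> 0" "\<And>n \<epsilon> i. (\<forall>\<xi>\<in>S. \<forall>l<\<tau> \<xi>. norm (tcoeff (r n) \<xi> l) \<le> \<epsilon>) \<Longrightarrow> 0 \<le> \<epsilon> \<Longrightarrow> norm (coeff (r n) i) \<le> C * \<epsilon>"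
    using hermite_bound[OF finite_poles, of \<tau>] deg by meson
  have tr: "tcoeff (r n) \<xi> l = tcoeff (q n) \<xi> l" if "\<xi> \<in> S" "l < \<tau> \<xi>" for n \<xi> l
    using tcoeff_dvd[OF system_poly_dvd[OF that(1)] that(2)] by (simp add: r_def tcoeff_diff tcoeff_smult)
  define \<epsilon> where "\<epsilon> n = (\<Sum>\<xi>\<in>S. \<Sum>l<\<tau> \<xi>. norm (tcoeff (q n) \<xi> l))" for n
  have r\<epsilon>: "rate_le \<epsilon> y" unfolding \<epsilon>_def
  proof (intro rate_le_sum)
    fix \<xi> l assume \<xi>: "\<xi> \<in> S" and l: "l \<in> {..<\<tau> \<xi>}"
    obtain \<rho>' where \<rho>': "norm (\<Phi> \<xi>) < \<rho>'" "ereal \<rho>' < brho E \<Phi> d F m \<xi>" "norm (\<Phi> \<xi>) / \<rho>' \<le> y"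
      using Theta_less_index[OF y \<xi>] by blast
    have "brho E \<Phi> d F m \<xi> \<le> brho_pole E \<Phi> d F m \<xi> (Suc l)"
      unfolding brho_def using l by (intro brho_pole_antimono) auto
    then have "ereal \<rho>' < brho_pole E \<Phi> d F m \<xi> (Suc l)" using \<rho>'(2) by (rule less_le_trans[rotated])
    then have "rate_le (\<lambda>n. tcoeff (q n) \<xi> l) (norm (\<Phi> \<xi>) / \<rho>')"
      using l by (intro tcoeff_rate[OF q ann \<xi> _ \<rho>'(1)]) auto
    then have "rate_le (\<lambda>n. tcoeff (q n) \<xi> l) y" using \<rho>'(3) by (rule rate_le_mono)
    then show "rate_le (\<lambda>n. norm (tcoeff (q n) \<xi> l)) y" by (simp only: rate_le_norm)
  qed (use y0 in auto)
  have bd: "norm (coeff (r n) i) \<le> C * norm (\<epsilon> n)" for n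
  proof -
    have e0: "\<epsilon> n \<ge> 0" unfolding \<epsilon>_def by (intro sum_nonneg) auto
    have "norm (coeff (r n) i) \<le> C * \<epsilon> n"
    proof (rule C(2)[OF _ e0], intro ballI allI impI)
      fix \<xi> l assume \<xi>: "\<xi> \<in> S" and l: "l < \<tau> \<xi>"
      have "norm (tcoeff (q n) \<xi> l) \<le> (\<Sum>l<\<tau> \<xi>. norm (tcoeff (q n) \<xi> l))"
        using l by (intro member_le_sum) auto
      also have "\<dots> \<le> \<epsilon> n" unfolding \<epsilon>_def using \<xi> finite_poles
        by (intro member_le_sum[of \<xi> S "\<lambda>\<xi>. \<Sum>l<\<tau> \<xi>. norm (tcoeff (q n) \<xi> l)"]) (auto intro: sum_nonneg)
      finally show "norm (tcoeff (r n) \<xi> l) \<le> \<epsilon> n" using tr[OF \<xi> l] by simp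
    qed
    then show ?thesis using e0 by simp
  qed
  show ?thesis unfolding r_def[symmetric]
    by (rule rate_le_norm_mono[OF r\<epsilon> _ always_eventually C(1)]) (use y0 bd in auto)
qed

text \<open>Scaling to coefficient sum 1 supplies the bounded coefficients that the Taylor estimates
  ask for. The scaled polynomials approach multiples of \<open>Q\<^sub>F\<close>, so their
  coefficients of degree M stay away from 0; this gives full degree and lets the scaling be
  undone.\<close>

lemma denominator_rate:
  assumes q: "\<And>n. degree (q n) \<le> M" "\<And>n. q n \<noteq> 0" and ann: "\<And>n. 1 \<le> n \<Longrightarrow> annihilates n (q n)"
  shows "\<forall>\<^sub>F n in sequentially. coeff (q n) M \<noteq> 0"
    and "\<Theta> < ereal y \<Longrightarrow> rate_le (\<lambda>n. coeff (smult (1 / coeff (q n) M) (q n) - Q\<^sub>F) i) y"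
proof -
  define N where "N n = (\<Sum>i\<le>M. norm (coeff (q n) i))" for n
  have N0: "N n > 0" for n
  proof -
    have "0 < norm (coeff (q n) (degree (q n)))" using q(2) by simp
    also have "\<dots> \<le> N n" unfolding N_def using q(1)[of n] by (intro member_le_sum) auto
    finally show ?thesis .
  qed
  define u where "u n = smult (of_real (1 / N n)) (q n)" for n
  have u1: "degree (u n) \<le> M" for n unfolding u_def using q(1) by (intro order_trans[OF degree_smult_le])
  have ucoeff: "norm (coeff (u n) i) = norm (coeff (q n) i) / N n" for n i
    unfolding u_def using N0[of n] by (simp add: norm_mult norm_divide)
  have ub: "norm (coeff (u n) i) \<le> 1" for n i
  proof (cases "i \<le> M")
    case True
    then have "norm (coeff (q n) i) \<le> N n" unfolding N_def by (intro member_le_sum) auto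
    then show ?thesis unfolding ucoeff using N0[of n] by simp
  next
    case False
    then have "coeff (u n) i = 0" using u1[of n] by (intro coeff_eq_0) simp
    then show ?thesis by simp
  qed
  have u2: "rate_le (\<lambda>n. coeff (u n) i) 1" for i by (rule rate_le_bounded[of _ 1]) (use ub in simp)
  have u3: "annihilates n (u n)" if "1 \<le> n" for n unfolding u_def using annihilates_smult ann that by blast
  define l where "l n = coeff (u n) M" for n
  define r where "r n = u n - smult (l n) Q\<^sub>F" for n
  have rr: "rate_le (\<lambda>n. coeff (r n) i) y" if "\<Theta> < ereal y" for y i
    unfolding r_def l_def by (rule normalized_denominator_rate[OF u1 u2 u3 that])
  define W where "W = (\<Sum>i\<le>M. norm (coeff Q\<^sub>F i))"
  have W: "1 \<le> W"
  proof -
    have "norm (coeff Q\<^sub>F M) \<le> W" unfolding W_def by (intro member_le_sum) auto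
    then show ?thesis by (simp add: monic_system_poly)
  qed
  obtain y1 where y1: "\<Theta> < ereal y1" "y1 < 1" using Theta_bounds(2) ereal_dense2[of \<Theta> 1] by auto
  have y10: "0 < y1" using Theta_bounds(1) y1(1) by (metis le_less_trans zero_ereal_def less_ereal.simps(1))
  have "(\<lambda>n. \<Sum>i\<le>M. norm (coeff (r n) i)) \<longlonglongrightarrow> 0"
    by (rule rate_le_tendsto_zero[of _ y1]) (use y1 y10 rr in \<open>auto intro!: rate_le_sum simp: rate_le_norm\<close>)
  then have "\<forall>\<^sub>F n in sequentially. (\<Sum>i\<le>M. norm (coeff (r n) i)) < 1 / 2" by (rule order_tendstoD) simp
  \<comment> \<open>The coefficient sum 1 is at most \<open>norm (l n) * W\<close> plus the sum for
    \<open>r n\<close>; once the latter is below 1 / 2, the multiple of \<open>Q\<^sub>F\<close>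
    must contribute the rest.\<close>
  then have lower: "\<forall>\<^sub>F n in sequentially. 1 / (2 * W) \<le> norm (l n)"
  proof eventually_elim
    case (elim n)
    have "1 = (\<Sum>i\<le>M. norm (coeff (u n) i))"
      unfolding ucoeff sum_divide_distrib[symmetric] N_def[symmetric] using N0[of n] by simp
    also have "\<dots> \<le> (\<Sum>i\<le>M. norm (l n) * norm (coeff Q\<^sub>F i) + norm (coeff (r n) i))"
    proof (rule sum_mono)
      fix i
      have "coeff (u n) i = l n * coeff Q\<^sub>F i + coeff (r n) i" by (simp add: r_def)
      then show "norm (coeff (u n) i) \<le> norm (l n) * norm (coeff Q\<^sub>F i) + norm (coeff (r n) i)"
        using norm_triangle_ineq[of "l n * coeff Q\<^sub>F i" "coeff (r n) i"] by (simp add: norm_mult)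
    qed
    also have "\<dots> = norm (l n) * W + (\<Sum>i\<le>M. norm (coeff (r n) i))"
      by (simp add: sum.distrib sum_distrib_left W_def)
    finally have "1 / 2 \<le> norm (l n) * W" using elim by simp
    then show ?case using W by (simp add: field_simps)
  qed
  then show "\<forall>\<^sub>F n in sequentially. coeff (q n) M \<noteq> 0"
  proof eventually_elim
    case (elim n)
    have "0 < 1 / (2 * W)" using W by simp
    then have "l n \<noteq> 0" using elim by auto
    then show ?case by (simp add: l_def u_def)
  qed
  assume y: "\<Theta> < ereal y"
  have y0: "0 < y" using Theta_bounds(1) y by (metis le_less_trans zero_ereal_def less_ereal.simps(1))
  show "rate_le (\<lambda>n. coeff (smult (1 / coeff (q n) M) (q n) - Q\<^sub>F) i) y"
  proof (rule rate_le_norm_mono[OF rr[OF y, of i], of _ "2 * W"])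
    show "\<forall>\<^sub>F n in sequentially. norm (coeff (smult (1 / coeff (q n) M) (q n) - Q\<^sub>F) i) \<le> 2 * W * norm (coeff (r n) i)"
      using lower
    proof eventually_elim
      case (elim n)
      have "0 < 1 / (2 * W)" using W by simp
      then have ln: "l n \<noteq> 0" using elim by auto
      have "smult (1 / coeff (q n) M) (q n) = smult (1 / l n) (u n)"
        using N0[of n] by (simp add: l_def u_def)
      then have "smult (1 / coeff (q n) M) (q n) - Q\<^sub>F = smult (1 / l n) (r n)"
        using ln by (simp add: r_def smult_diff_right)
      then have "norm (coeff (smult (1 / coeff (q n) M) (q n) - Q\<^sub>F) i) = norm (coeff (r n) i) / norm (l n)"
        by (simp add: norm_divide)
      also have "\<dots> \<le> norm (coeff (r n) i) / (1 / (2 * W))"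
        using elim W ln by (intro divide_left_mono) auto
      finally show ?case by (simp add: mult.commute)
    qed
  qed (use y0 W in auto)
qed

end

section \<open>Sharpness of the rate\<close>

context exterior_domain
begin

definition extends_to :: "ereal \<Rightarrow> (complex \<Rightarrow> complex) \<Rightarrow> bool" where
  "extends_to \<rho> f \<longleftrightarrow> (\<exists>h. h holomorphic_on D \<rho> \<and> agree_near E f h)"

lemma extends_to_lincomb:
  assumes "extends_to \<rho> f" "extends_to \<rho> g" shows "extends_to \<rho> (\<lambda>z. f z + c * g z)"
proof -
  obtain h k where h: "h holomorphic_on D \<rho>" "agree_near E f h" and k: "k holomorphic_on D \<rho>" "agree_near E g k"
    using assms unfolding extends_to_def by blast
  obtain U V where "open U" "E \<subseteq> U" "\<And>z. z \<in> U \<Longrightarrow> f z = h z" "open V" "E \<subseteq> V" "\<And>z. z \<in> V \<Longrightarrow> g z = k z"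
    using h(2) k(2) unfolding agree_near_def by blast
  then have "agree_near E (\<lambda>z. f z + c * g z) (\<lambda>z. h z + c * k z)"
    by (intro agree_nearI[of "U \<inter> V"]) auto
  moreover have "(\<lambda>z. h z + c * k z) holomorphic_on D \<rho>" by (intro holomorphic_intros h k)
  ultimately show ?thesis unfolding extends_to_def by blast
qed

lemma extends_to_zero: "extends_to \<rho> (\<lambda>z. 0)"
  unfolding extends_to_def by (intro exI[of _ "\<lambda>z. 0"]) (auto intro: agree_near_refl)

lemma extends_to_cmult: "extends_to \<rho> f \<Longrightarrow> extends_to \<rho> (\<lambda>z. c * f z)"
  using extends_to_lincomb[OF extends_to_zero, of \<rho> f c] by simp

lemma extends_to_sum:
  assumes "\<And>i. i \<in> I \<Longrightarrow> extends_to \<rho> (f i)" shows "extends_to \<rho> (\<lambda>z. \<Sum>i\<in>I. f i z)"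
  using assms
proof (induction I rule: infinite_finite_induct)
  case (insert i I)
  then show ?case using extends_to_lincomb[of \<rho> "\<lambda>z. \<Sum>i\<in>I. f i z" "f i" 1] by (simp add: add.commute)
qed (simp_all add: extends_to_zero)

end

lemma coeff_norm_nonneg: "0 \<le> coeff_norm q"
  unfolding coeff_norm_def by (intro sum_nonneg) auto

lemma norm_coeff_le_coeff_norm: "norm (coeff q i) \<le> coeff_norm q"
proof (cases "i \<le> degree q")
  case True then show ?thesis unfolding coeff_norm_def by (intro member_le_sum) auto
next
  case False then show ?thesis using coeff_norm_nonneg[of q] by (simp add: coeff_eq_0)
qed

lemma coeff_norm_le: "degree q \<le> N \<Longrightarrow> coeff_norm q \<le> (\<Sum>i\<le>N. norm (coeff q i))"
  unfolding coeff_norm_def by (intro sum_mono2) auto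

section \<open>Uniqueness of the denominators and both bounds for their rate\<close>

context hermite_pade
begin

text \<open>If uniqueness fails at n, then a solution of degree below M, or the difference of two
  monic solutions of degree M, is a nonzero annihilating polynomial of degree below M. Collecting
  such polynomials, wherever they exist, into one sequence and applying
  \<open>denominator_rate\<close> to it shows that this happens for finitely many n only.\<close>

lemma unique_denominator:
  assumes Q: "\<And>n. 1 \<le> n \<Longrightarrow> HP_denominator \<mu> p d F m n (Q n)"
  shows "\<forall>\<^sub>F n in sequentially. \<exists>!q. HP_denominator \<mu> p d F m n q"
proof -
  define bad where "bad n r \<longleftrightarrow> r \<noteq> 0 \<and> degree r < M \<and> annihilates n r" for n r
  \<comment> \<open>At n = 0 nothing is known about \<open>Q\<close>, so 1 serves as a
    placeholder.\<close>
  define W where "W n = (if n = 0 then 1 else if \<exists>r. bad n r then SOME r. bad n r else Q n)" for n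
  have Qp: "Q n \<noteq> 0" "degree (Q n) \<le> M" "annihilates n (Q n)" if "1 \<le> n" for n
    using Q[OF that] HP_denominator_annihilates[OF Q[OF that] that] unfolding HP_denominator_def by auto
  have Wb: "bad n (W n)" if "n \<noteq> 0" "\<exists>r. bad n r" for n
    using someI_ex[OF that(2)] that by (simp add: W_def)
  have W: "W n \<noteq> 0 \<and> degree (W n) \<le> M \<and> (1 \<le> n \<longrightarrow> annihilates n (W n))" for n
  proof (cases "n \<noteq> 0 \<and> (\<exists>r. bad n r)")
    case True then show ?thesis using Wb[of n] by (auto simp: bad_def)
  next
    case False then show ?thesis using Qp[of n] by (cases "n = 0") (auto simp: W_def)
  qed
  have "\<forall>\<^sub>F n in sequentially. coeff (W n) M \<noteq> 0"
    by (rule denominator_rate(1)) (use W in auto)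
  then show ?thesis using eventually_ge_at_top[of 1]
  proof eventually_elim
    case (elim n)
    have nb: "\<not> bad n r" for r
    proof
      assume "bad n r"
      then have "degree (W n) < M" using Wb[of n] elim by (auto simp: bad_def)
      then show False using elim coeff_eq_0 by blast
    qed
    have den: "degree q = M \<and> coeff q M = 1 \<and> annihilates n q" if "HP_denominator \<mu> p d F m n q" for q
    proof -
      have q: "q \<noteq> 0" "lead_coeff q = 1" "degree q \<le> M" using that unfolding HP_denominator_def by auto
      have "annihilates n q" using that elim HP_denominator_annihilates by blast
      moreover from this have "degree q = M" using nb[of q] q unfolding bad_def by linarith
      ultimately show ?thesis using q by auto
    qed
    show ?case
    proof (rule ex1I[of _ "Q n"])
      show h: "HP_denominator \<mu> p d F m n (Q n)" using Q elim by blast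
      fix q assume q: "HP_denominator \<mu> p d F m n q"
      show "q = Q n"
      proof (rule ccontr)
        assume "q \<noteq> Q n"
        then have nz: "q - Q n \<noteq> 0" by simp
        have "degree (q - Q n) \<le> M" using den[OF q] den[OF h] by (intro degree_diff_le) auto
        moreover have "coeff (q - Q n) M = 0" using den[OF q] den[OF h] by simp
        ultimately have "degree (q - Q n) < M" using nz by (metis le_neq_implies_less leading_coeff_0_iff)
        moreover have "annihilates n (q - Q n)" using den[OF q] den[OF h] by (intro annihilates_diff) auto
        ultimately show False using nb[of "q - Q n"] nz by (simp add: bad_def)
      qed
    qed
  qed
qed

lemma denominator_coeff_rate:
  assumes Q: "\<And>n. 1 \<le> n \<Longrightarrow> HP_denominator \<mu> p d F m n (Q n)" and y: "\<Theta> < ereal y"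
  shows "rate_le (\<lambda>n. coeff (Q n - Q\<^sub>F) i) y"
proof -
  have y0: "0 < y" using Theta_bounds(1) y by (metis le_less_trans zero_ereal_def less_ereal.simps(1))
  define q where "q n = (if n = 0 then 1 else Q n)" for n
  have q: "degree (q n) \<le> M" "q n \<noteq> 0" for n
    using Q[of n] unfolding q_def HP_denominator_def by auto
  have ann: "annihilates n (q n)" if "1 \<le> n" for n
    using HP_denominator_annihilates[OF Q[OF that] that] that by (simp add: q_def)
  have r: "rate_le (\<lambda>n. coeff (smult (1 / coeff (q n) M) (q n) - Q\<^sub>F) i) y"
    by (rule denominator_rate(2)[OF q ann y])
  have "\<forall>\<^sub>F n in sequentially. coeff (q n) M \<noteq> 0" by (rule denominator_rate(1)[OF q ann])
  then have ev: "\<forall>\<^sub>F n in sequentially. coeff (Q n - Q\<^sub>F) i = coeff (smult (1 / coeff (q n) M) (q n) - Q\<^sub>F) i"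
    using eventually_ge_at_top[of 1]
  proof eventually_elim
    case (elim n)
    then have qQ: "q n = Q n" by (simp add: q_def)
    have "degree (Q n) = M" using elim q(1)[of n] le_degree[of "Q n" M] unfolding qQ by simp
    moreover have "lead_coeff (Q n) = 1" using Q[of n] elim unfolding HP_denominator_def by blast
    ultimately have "coeff (Q n) M = 1" by simp
    then show ?case unfolding qQ by simp
  qed
  show ?thesis by (rule rate_le_cong[OF r _ ev]) (use y0 in simp)
qed

lemma denominator_limsup_le:
  assumes Q: "\<And>n. 1 \<le> n \<Longrightarrow> HP_denominator \<mu> p d F m n (Q n)"
  shows "limsup (\<lambda>n. ereal (root n (coeff_norm (Q n - Q\<^sub>F)))) \<le> \<Theta>"
proof -
  obtain \<theta> where \<theta>: "\<Theta> = ereal \<theta>" using Theta_bounds by (cases \<Theta>) auto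
  have \<theta>0: "0 \<le> \<theta>" using Theta_bounds(1) \<theta> by simp
  have "rate_le (\<lambda>n. coeff_norm (Q n - Q\<^sub>F)) \<theta>"
  proof (rule rate_le_dense)
    fix y assume y: "\<theta> < y"
    have r: "rate_le (\<lambda>n. \<Sum>i\<le>M. norm (coeff (Q n - Q\<^sub>F) i)) y"
    proof (rule rate_le_sum)
      show "rate_le (\<lambda>n. norm (coeff (Q n - Q\<^sub>F) i)) y" for i
        unfolding rate_le_norm by (rule denominator_coeff_rate[OF Q]) (use y \<theta> in auto)
    qed (use y \<theta>0 in simp)
    show "rate_le (\<lambda>n. coeff_norm (Q n - Q\<^sub>F)) y"
    proof (rule rate_le_norm_mono[OF r, of _ 1])
      show "\<forall>\<^sub>F n in sequentially. norm (coeff_norm (Q n - Q\<^sub>F)) \<le> 1 * norm (\<Sum>i\<le>M. norm (coeff (Q n - Q\<^sub>F) i))"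
        using eventually_ge_at_top[of 1]
      proof eventually_elim
        case (elim n)
        have "degree (Q n) \<le> M" using Q[OF elim] unfolding HP_denominator_def by blast
        then have "degree (Q n - Q\<^sub>F) \<le> M" using degree_system_poly by (intro degree_diff_le) auto
        then have "coeff_norm (Q n - Q\<^sub>F) \<le> (\<Sum>i\<le>M. norm (coeff (Q n - Q\<^sub>F) i))" by (rule coeff_norm_le)
        moreover have "0 \<le> (\<Sum>i\<le>M. norm (coeff (Q n - Q\<^sub>F) i))" by (intro sum_nonneg) auto
        ultimately show ?case using coeff_norm_nonneg[of "Q n - Q\<^sub>F"] by simp
      qed
    qed (use y \<theta>0 in auto)
  qed
  from rate_le_limsup[OF this \<theta>0] show ?thesis
    unfolding \<theta> using coeff_norm_nonneg by (simp add: abs_of_nonneg)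
qed

text \<open>Fast convergence of the denominators forces \<open>Q\<^sub>F G\<close> to continue further than \<open>G\<close>, since
  \<open>Q\<^sub>n G\<close> is orthogonal to \<open>p\<^sub>n\<close>.\<close>
lemma system_poly_mult_extends:
  assumes Q: "\<And>n. 1 \<le> n \<Longrightarrow> HP_denominator \<mu> p d F m n (Q n)"
    and rate: "\<And>i. rate_le (\<lambda>n. coeff (Q n - Q\<^sub>F) i) \<theta>" and \<theta>: "0 < \<theta>" "\<theta> < 1"
    and G: "G \<in> PC" and r: "1 < r" and g: "g holomorphic_on D (ereal r)" "agree_near E G g"
  shows "\<exists>H. H holomorphic_on D (ereal (r / \<theta>)) \<and> agree_near E H (\<lambda>z. poly Q\<^sub>F z * g z)"
proof -
  have h0: "(\<lambda>z. poly Q\<^sub>F z * g z) holomorphic_on D (ereal r)" by (intro holomorphic_intros g)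
  have cg: "continuous_on E g" by (rule continuous_on_E_of_holomorphic[OF g(1)])
  have r\<theta>: "1 < r / \<theta>" using r \<theta> by (simp add: less_divide_eq)
  define q where "q n = (if n = 0 then 0 else Q n - Q\<^sub>F)" for n
  have "degree (Q n) \<le> M" if "1 \<le> n" for n using Q[OF that] unfolding HP_denominator_def by blast
  then have q: "degree (q n) \<le> M" for n
    using degree_system_poly unfolding q_def by (auto intro!: degree_diff_le)
  have qr: "rate_le (\<lambda>n. coeff (q n) i) \<theta>" for i
  proof (rule rate_le_cong[OF rate[of i]])
    show "\<forall>\<^sub>F n in sequentially. coeff (q n) i = coeff (Q n - Q\<^sub>F) i"
      using eventually_gt_at_top[of 0] by eventually_elim (simp add: q_def)
  qed (use \<theta> in simp)
  \<comment> \<open>Because \<open>Q n\<close> annihilates G, the Fourier coefficient of the product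
    with \<open>Q\<^sub>F\<close> is carried by the small difference \<open>q n\<close>; this gains
    the factor \<theta> and moves the radius from r to r / \<theta>.\<close>
  have eq: "fourier n (\<lambda>z. poly Q\<^sub>F z * g z) = - fourier n (\<lambda>z. poly (q n) z * g z)" if n: "1 \<le> n" for n
  proof -
    have "0 = fourier n (\<lambda>z. poly (Q n) z * G z)"
      using HP_denominator_annihilates[OF Q[OF n] n] G unfolding annihilates_def by simp
    also have "\<dots> = fourier n (\<lambda>z. poly (q n) z * g z + poly Q\<^sub>F z * g z)"
    proof (rule fourier_cong)
      fix z assume "z \<in> E"
      then have "G z = g z" by (rule agree_near_on[OF g(2)])
      then show "poly (Q n) z * G z = poly (q n) z * g z + poly Q\<^sub>F z * g z" using n by (simp add: q_def algebra_simps)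
    qed
    also have "\<dots> = fourier n (\<lambda>z. poly (q n) z * g z) + fourier n (\<lambda>z. poly Q\<^sub>F z * g z)"
      by (intro fourier_add continuous_intros cg)
    finally show ?thesis by (simp add: eq_neg_iff_add_eq_0 add.commute)
  qed
  have "\<exists>h'. h' holomorphic_on D (ereal (r / \<theta>)) \<and> agree_near E h' (\<lambda>z. poly Q\<^sub>F z * g z) \<and>
     (\<forall>x s. 1 < x \<longrightarrow> x < s \<longrightarrow> ereal s < ereal (r / \<theta>) \<longrightarrow>
        (\<exists>C. \<forall>n. \<forall>z\<in>D (ereal x). norm (h' z - (\<Sum>j<n. fourier j (\<lambda>z. poly Q\<^sub>F z * g z) * poly (p j) z)) \<le> C * (x / s) ^ n))"
  proof (rule fourier_series[OF _ h0])
    fix s assume s: "1 < s" "ereal s < ereal (r / \<theta>)"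
    then have "s * \<theta> < r" using \<theta> by (simp add: less_divide_eq)
    then obtain t where t: "max 1 (s * \<theta>) < t" "t < r" using r dense[of "max 1 (s * \<theta>)" r] by auto
    have "rate_le (\<lambda>n. fourier n (\<lambda>z. poly (q n) z * g z)) (\<theta> * (1 / t))"
      by (rule fourier_poly_mult_rate[OF q qr _ g(1)]) (use t \<theta> in auto)
    moreover have "\<theta> * (1 / t) \<le> 1 / s" using t s \<theta> by (simp add: field_simps)
    ultimately have "rate_le (\<lambda>n. fourier n (\<lambda>z. poly (q n) z * g z)) (1 / s)" by (rule rate_le_mono)
    then have r2: "rate_le (\<lambda>n. - fourier n (\<lambda>z. poly (q n) z * g z)) (1 / s)" by (simp only: rate_le_uminus)
    have "\<forall>\<^sub>F n in sequentially. fourier n (\<lambda>z. poly Q\<^sub>F z * g z) = - fourier n (\<lambda>z. poly (q n) z * g z)"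
      using eventually_ge_at_top[of 1] by eventually_elim (rule eq)
    then show "rate_le (\<lambda>n. fourier n (\<lambda>z. poly Q\<^sub>F z * g z)) (1 / s)"
      by (rule rate_le_cong[OF r2, rotated]) (use s in simp)
  qed (use r r\<theta> in auto)
  then show ?thesis by blast
qed

text \<open>Let G have its sole pole, of order i, at \<xi>. The product with
  \<open>Q\<^sub>F\<close> continues to \<open>D (ereal \<rho>)\<close>, so G continues with poles
  at system poles only. Other system poles on the circle of \<xi> do not occur, since G is
  holomorphic near the closed domain except at \<xi>. What remains are poles strictly farther out,
  removed by \<open>later\<close>, and lower orders at \<xi>, removed by \<open>earlier\<close>;
  division by \<open>b i\<close> normalises.\<close>

lemma combination_with_unit_principal_part:
  assumes Q: "\<And>n. 1 \<le> n \<Longrightarrow> HP_denominator \<mu> p d F m n (Q n)"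
    and rate: "\<And>i. rate_le (\<lambda>n. coeff (Q n - Q\<^sub>F) i) \<theta>" and \<theta>: "0 < \<theta>" "\<theta> < 1"
    and later: "\<And>\<xi>' k. \<xi>' \<in> S \<Longrightarrow> norm (\<Phi> \<xi>) < norm (\<Phi> \<xi>') \<Longrightarrow> norm (\<Phi> \<xi>') < \<rho> \<Longrightarrow> k \<in> {1..\<tau> \<xi>'} \<Longrightarrow>
       \<exists>G\<in>PC. extends_to (ereal \<rho>) (\<lambda>z. G z - 1 / (z - \<xi>') ^ k)"
    and earlier: "\<And>k. k \<in> {1..<i} \<Longrightarrow> \<exists>G\<in>PC. extends_to (ereal \<rho>) (\<lambda>z. G z - 1 / (z - \<xi>) ^ k)"
    and \<xi>: "\<xi> \<in> S" "norm (\<Phi> \<xi>) < \<rho>" "\<rho> * \<theta> \<le> norm (\<Phi> \<xi>)" and i: "i \<in> {1..\<tau> \<xi>}"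
  shows "\<exists>G\<in>PC. extends_to (ereal \<rho>) (\<lambda>z. G z - 1 / (z - \<xi>) ^ i)"
proof -
  define R where "R = norm (\<Phi> \<xi>)"
  have \<xi>E: "\<xi> \<notin> E" by (rule system_pole_notin[OF \<xi>(1)])
  have R: "1 < R" "R < \<rho>" using Phi_gt_1[OF \<xi>E] \<xi>(2) by (auto simp: R_def)
  have i': "1 \<le> i" "i \<le> \<tau> \<xi>" using i by auto
  obtain G where G: "G \<in> PC" "sole_pole E \<Phi> \<xi> i G" using system_pole_comb[OF \<xi>(1) i'] by blast
  obtain s0 h0 b where s0: "s0 > R" "h0 holomorphic_on D (ereal s0)" "b i \<noteq> 0"
    and ag0: "agree_near E G (\<lambda>z. h0 z + (\<Sum>k=1..i. b k / (z - \<xi>) ^ k))"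
    using sole_pole_representation[OF \<xi>E G(2)] unfolding R_def by blast
  define B where "B z = (\<Sum>k=1..i. b k / (z - \<xi>) ^ k)" for z
  define s where "s = min s0 \<rho>"
  have s: "R < s" "s \<le> \<rho>" "1 < s" using s0(1) R by (auto simp: s_def)
  have h0: "h0 holomorphic_on D (ereal s)"
    using s0(2) by (rule holomorphic_on_subset) (auto simp: s_def intro!: canon_dom_mono)
  have hB: "B holomorphic_on A" if "\<xi> \<notin> A" for A unfolding B_def
    by (intro holomorphic_intros) (use that in auto)
  have gR: "(\<lambda>z. h0 z + B z) holomorphic_on D (ereal R)"
  proof (intro holomorphic_intros hB)
    show "h0 holomorphic_on D (ereal R)" by (rule holomorphic_on_subset[OF h0]) (use s in \<open>simp add: canon_dom_mono\<close>)
    show "\<xi> \<notin> D (ereal R)" using \<xi>E by (simp add: canon_dom_def R_def)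
  qed
  obtain H where H: "H holomorphic_on D (ereal (R / \<theta>))" "agree_near E H (\<lambda>z. poly Q\<^sub>F z * (h0 z + B z))"
    using system_poly_mult_extends[OF Q rate \<theta> G(1) R(1) gR] ag0 unfolding B_def by blast
  have "\<rho> \<le> R / \<theta>" using \<xi>(3) \<theta> by (simp add: le_divide_eq R_def)
  then have H\<rho>: "H holomorphic_on D (ereal \<rho>)"
    using H(1) by (elim holomorphic_on_subset) (simp add: canon_dom_mono)
  have \<rho>1: "1 < ereal \<rho>" and s1: "1 < ereal s" using R s by auto
  have subs: "D (ereal s) \<subseteq> D (ereal \<rho>)" using s by (simp add: canon_dom_mono)
  \<comment> \<open>The continuation of G obtained by dividing by \<open>Q\<^sub>F\<close>, with the
    principal part at \<xi> taken away.\<close>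
  define K where "K z = H z / poly Q\<^sub>F z - B z" for z
  have eqK: "h0 z = K z" if z: "z \<in> D (ereal s) - S" for z
  proof -
    \<comment> \<open>Cleared of denominators, both sides are holomorphic on
      \<open>D (ereal s)\<close>, so their agreement near E propagates.\<close>
    define L where "L z = (z - \<xi>) ^ i * H z - poly Q\<^sub>F z * (\<Sum>k=1..i. b k * (z - \<xi>) ^ (i - k))" for z
    have BL: "(z - \<xi>) ^ i * B z = (\<Sum>k=1..i. b k * (z - \<xi>) ^ (i - k))" if "z \<noteq> \<xi>" for z
      unfolding B_def sum_distrib_left using that by (intro sum.cong) (simp_all add: power_diff)
    have "poly Q\<^sub>F z * ((z - \<xi>) ^ i * h0 z) = L z"
    proof (rule holomorphic_unique[OF s1, where f = "\<lambda>z. poly Q\<^sub>F z * ((z - \<xi>) ^ i * h0 z)" and g = L])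
      show "(\<lambda>z. poly Q\<^sub>F z * ((z - \<xi>) ^ i * h0 z)) holomorphic_on D (ereal s)" by (intro holomorphic_intros h0)
      show "L holomorphic_on D (ereal s)" unfolding L_def
        by (intro holomorphic_intros holomorphic_on_subset[OF H\<rho> subs])
      obtain V where V: "open V" "E \<subseteq> V" "\<And>z. z \<in> V \<Longrightarrow> H z = poly Q\<^sub>F z * (h0 z + B z)"
        using H(2) unfolding agree_near_def by blast
      show "agree_near E (\<lambda>z. poly Q\<^sub>F z * ((z - \<xi>) ^ i * h0 z)) L"
      proof (rule agree_nearI[of "V - {\<xi>}"])
        fix z assume z: "z \<in> V - {\<xi>}"
        have "L z = (z - \<xi>) ^ i * (poly Q\<^sub>F z * (h0 z + B z)) - poly Q\<^sub>F z * ((z - \<xi>) ^ i * B z)"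
          unfolding L_def using V(3)[of z] BL[of z] z by simp
        then show "poly Q\<^sub>F z * ((z - \<xi>) ^ i * h0 z) = L z" by (simp add: algebra_simps)
      qed (use V \<xi>E in \<open>auto intro: open_delete\<close>)
      show "z \<in> D (ereal s)" using z by simp
    qed
    moreover have nz: "z \<noteq> \<xi>" "poly Q\<^sub>F z \<noteq> 0" using z \<xi>(1) poly_system_poly_eq_0_iff by auto
    moreover have "L z = poly Q\<^sub>F z * ((z - \<xi>) ^ i * K z)"
      unfolding L_def BL[OF nz(1), symmetric] K_def using nz(2) by (simp add: algebra_simps)
    ultimately show ?thesis by simp
  qed
  define S' where "S' = {\<eta> \<in> S. s \<le> norm (\<Phi> \<eta>) \<and> norm (\<Phi> \<eta>) < \<rho>}"
  have S': "finite S'" "S' \<subseteq> D (ereal \<rho>)" "S' \<subseteq> S" using finite_poles by (auto simp: S'_def canon_dom_def)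
  \<comment> \<open>On \<open>D (ereal s)\<close> the function h0 fills in the removable
    singularities of K at system poles, \<xi> among them; hence only the poles in S' remain.\<close>
  define g where "g z = (if z \<in> D (ereal s) then h0 z else K z)" for z
  have gK: "g z = K z" if "z \<in> D (ereal \<rho>) - S" for z using eqK[of z] that by (auto simp: g_def)
  have oS: "open (D (ereal \<rho>) - S)" using open_D[OF \<rho>1] finite_poles by (auto intro: open_Diff finite_imp_closed)
  have "g holomorphic_on D (ereal s) \<union> (D (ereal \<rho>) - S)"
  proof (rule holomorphic_on_Un)
    show "g holomorphic_on D (ereal s)" using h0 by (rule holomorphic_transform) (simp add: g_def)
    have "K holomorphic_on D (ereal \<rho>) - S" unfolding K_def
      using \<xi>(1) poly_system_poly_eq_0_iff
      by (intro holomorphic_intros holomorphic_on_subset[OF H\<rho>] hB) auto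
    then show "g holomorphic_on D (ereal \<rho>) - S" by (rule holomorphic_transform) (simp add: gK)
  qed (use open_D[OF s1] oS in auto)
  moreover have "D (ereal \<rho>) - S' \<subseteq> D (ereal s) \<union> (D (ereal \<rho>) - S)"
    by (auto simp: S'_def canon_dom_def)
  ultimately have gh: "g holomorphic_on D (ereal \<rho>) - S'" by (rule holomorphic_on_subset)
  \<comment> \<open>The numerator over \<open>(z - \<eta>) ^ \<tau> \<eta>\<close>. It may vanish at
    \<eta>, which \<open>pole_form\<close> permits: only an upper bound for the order is
    required.\<close>
  define k where "k \<eta> z = (H z - poly Q\<^sub>F z * B z) / (\<Prod>\<zeta>\<in>S - {\<eta>}. (z - \<zeta>) ^ \<tau> \<zeta>)" for \<eta> z
  have pf: "pole_form g \<eta> (\<tau> \<eta>) (k \<eta>)" if \<eta>: "\<eta> \<in> S'" for \<eta>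
  proof -
    have "open (D (ereal \<rho>) - (S - {\<eta>}))"
      using open_D[OF \<rho>1] finite_poles by (auto intro: open_Diff finite_imp_closed)
    moreover have "\<eta> \<in> D (ereal \<rho>) - (S - {\<eta>})" using \<eta> S' by auto
    ultimately obtain e where e: "e > 0" "ball \<eta> e \<subseteq> D (ereal \<rho>) - (S - {\<eta>})" unfolding open_contains_ball by blast
    have "\<eta> \<noteq> \<xi>" using \<eta> s(1) by (auto simp: S'_def R_def)
    then have \<xi>e: "\<xi> \<notin> ball \<eta> e" using e(2) \<xi>(1) by auto
    have "(\<Prod>\<zeta>\<in>S - {\<eta>}. (z - \<zeta>) ^ \<tau> \<zeta>) \<noteq> 0" if "z \<in> ball \<eta> e" for z
      using e(2) that finite_poles by (auto simp: prod_zero_iff)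
    then have "k \<eta> holomorphic_on ball \<eta> e" unfolding k_def
      using e(2) by (intro holomorphic_intros holomorphic_on_subset[OF H\<rho>] hB \<xi>e) auto
    moreover have "g z = k \<eta> z / (z - \<eta>) ^ \<tau> \<eta>" if z: "z \<in> ball \<eta> e - {\<eta>}" for z
    proof -
      have zS: "z \<in> D (ereal \<rho>) - S" using z e(2) by auto
      have "poly Q\<^sub>F z = (\<Prod>\<zeta>\<in>S. (z - \<zeta>) ^ \<tau> \<zeta>)" unfolding system_poly_def by (simp add: poly_prod poly_power)
      also have "\<dots> = (z - \<eta>) ^ \<tau> \<eta> * (\<Prod>\<zeta>\<in>S - {\<eta>}. (z - \<zeta>) ^ \<tau> \<zeta>)"
        using finite_poles \<eta> S'(3) by (intro prod.remove) auto
      finally have QF: "poly Q\<^sub>F z = (z - \<eta>) ^ \<tau> \<eta> * (\<Prod>\<zeta>\<in>S - {\<eta>}. (z - \<zeta>) ^ \<tau> \<zeta>)" .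
      have "poly Q\<^sub>F z \<noteq> 0" using zS poly_system_poly_eq_0_iff by auto
      then have "g z = (H z - poly Q\<^sub>F z * B z) / poly Q\<^sub>F z" using gK[OF zS] by (simp add: K_def diff_divide_distrib)
      also have "\<dots> = k \<eta> z / (z - \<eta>) ^ \<tau> \<eta>" unfolding k_def using QF by (simp add: mult.commute)
      finally show ?thesis .
    qed
    ultimately show ?thesis unfolding pole_form_def using e(1) by blast
  qed
  have \<tau>1: "1 \<le> \<tau> \<eta>" if "\<eta> \<in> S'" for \<eta> using that S'(3) system_order_pos by blast
  obtain h c where hc: "h holomorphic_on D (ereal \<rho>)"
    "\<And>z. z \<in> D (ereal \<rho>) - S' \<Longrightarrow> g z = h z + (\<Sum>\<eta>\<in>S'. \<Sum>k=1..\<tau> \<eta>. c \<eta> k / (z - \<eta>) ^ k)"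
    using principal_parts[OF S'(1) open_D[OF \<rho>1] S'(2) gh \<tau>1 pf] by blast
  have GE: "extends_to (ereal \<rho>) (\<lambda>z. G z - B z - (\<Sum>\<eta>\<in>S'. \<Sum>k=1..\<tau> \<eta>. c \<eta> k / (z - \<eta>) ^ k))"
    unfolding extends_to_def
  proof (intro exI conjI)
    show "h holomorphic_on D (ereal \<rho>)" by (rule hc)
    obtain V where V: "open V" "E \<subseteq> V" "\<And>z. z \<in> V \<Longrightarrow> G z = h0 z + B z"
      using ag0 unfolding agree_near_def B_def by blast
    show "agree_near E (\<lambda>z. G z - B z - (\<Sum>\<eta>\<in>S'. \<Sum>k=1..\<tau> \<eta>. c \<eta> k / (z - \<eta>) ^ k)) h"
    proof (rule agree_nearI[of "V \<inter> D (ereal s)"])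
      fix z assume z: "z \<in> V \<inter> D (ereal s)"
      then have "z \<notin> S'" using system_pole_notin by (auto simp: S'_def canon_dom_def)
      then have "h0 z = h z + (\<Sum>\<eta>\<in>S'. \<Sum>k=1..\<tau> \<eta>. c \<eta> k / (z - \<eta>) ^ k)"
        using hc(2)[of z] z subs by (auto simp: g_def)
      then show "G z - B z - (\<Sum>\<eta>\<in>S'. \<Sum>k=1..\<tau> \<eta>. c \<eta> k / (z - \<eta>) ^ k) = h z" using V(3)[of z] z by simp
    qed (use V open_D[OF s1] E_subset_D in auto)
  qed
  have "\<exists>U\<in>PC. extends_to (ereal \<rho>) (\<lambda>z. U z - 1 / (z - \<eta>) ^ k)" if "\<eta> \<in> S'" "k \<in> {1..\<tau> \<eta>}" for \<eta> k
    using later[of \<eta> k] that s(1) by (auto simp: S'_def R_def)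
  then obtain U where U: "\<And>\<eta> k. \<eta> \<in> S' \<Longrightarrow> k \<in> {1..\<tau> \<eta>} \<Longrightarrow> U \<eta> k \<in> PC"
    "\<And>\<eta> k. \<eta> \<in> S' \<Longrightarrow> k \<in> {1..\<tau> \<eta>} \<Longrightarrow> extends_to (ereal \<rho>) (\<lambda>z. U \<eta> k z - 1 / (z - \<eta>) ^ k)" by metis
  obtain V where V: "\<And>k. k \<in> {1..<i} \<Longrightarrow> V k \<in> PC"
    "\<And>k. k \<in> {1..<i} \<Longrightarrow> extends_to (ereal \<rho>) (\<lambda>z. V k z - 1 / (z - \<xi>) ^ k)" using earlier by metis
  define G1 where "G1 z = (\<Sum>\<eta>\<in>S'. \<Sum>k=1..\<tau> \<eta>. c \<eta> k * U \<eta> k z)" for z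
  define G2 where "G2 z = (\<Sum>k\<in>{1..<i}. b k * V k z)" for z
  define E1 where "E1 z = (\<Sum>\<eta>\<in>S'. \<Sum>k=1..\<tau> \<eta>. c \<eta> k * (U \<eta> k z - 1 / (z - \<eta>) ^ k))" for z
  define E2 where "E2 z = (\<Sum>k\<in>{1..<i}. b k * (V k z - 1 / (z - \<xi>) ^ k))" for z
  have "G1 \<in> PC" "G2 \<in> PC" unfolding G1_def G2_def by (intro PC_sum PC_cmult U V; assumption)+
  then have "(\<lambda>z. (1 / b i) * ((G z + (- 1) * G1 z) + (- 1) * G2 z)) \<in> PC"
    by (intro PC_cmult PC_lincomb G)
  moreover have "extends_to (ereal \<rho>) (\<lambda>z. (1 / b i) * (((G z - B z - (\<Sum>\<eta>\<in>S'. \<Sum>k=1..\<tau> \<eta>. c \<eta> k / (z - \<eta>) ^ k)) + (- 1) * E1 z) + (- 1) * E2 z))"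
    unfolding E1_def E2_def by (intro extends_to_cmult extends_to_lincomb extends_to_sum GE U V; assumption)
  moreover have "(1 / b i) * (((G z - B z - (\<Sum>\<eta>\<in>S'. \<Sum>k=1..\<tau> \<eta>. c \<eta> k / (z - \<eta>) ^ k)) + (- 1) * E1 z) + (- 1) * E2 z)
      = (1 / b i) * ((G z + (- 1) * G1 z) + (- 1) * G2 z) - 1 / (z - \<xi>) ^ i" for z
  proof -
    have e1: "E1 z = G1 z - (\<Sum>\<eta>\<in>S'. \<Sum>k=1..\<tau> \<eta>. c \<eta> k / (z - \<eta>) ^ k)"
      unfolding E1_def G1_def by (simp add: right_diff_distrib sum_subtractf)
    have e2: "E2 z = G2 z - (\<Sum>k\<in>{1..<i}. b k / (z - \<xi>) ^ k)"
      unfolding E2_def G2_def by (simp add: right_diff_distrib sum_subtractf)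
    have "{1..i} = insert i {1..<i}" using i' by auto
    then have B: "B z = b i / (z - \<xi>) ^ i + (\<Sum>k\<in>{1..<i}. b k / (z - \<xi>) ^ k)" unfolding B_def by simp
    show ?thesis unfolding e1 e2 B using s0(3) by (simp add: algebra_simps)
  qed
  ultimately show ?thesis by (intro bexI[of _ "\<lambda>z. (1 / b i) * ((G z + (- 1) * G1 z) + (- 1) * G2 z)"]) simp_all
qed

text \<open>Outer induction on the number of system poles strictly farther out, inner induction on
  the order; the outer hypothesis covers all orders at those poles. The bound \<rho> \<theta> \<le>
  |\<Phi> \<xi>| is inherited by them because |\<Phi>| only increases.\<close>

lemma unit_principal_parts:
  assumes Q: "\<And>n. 1 \<le> n \<Longrightarrow> HP_denominator \<mu> p d F m n (Q n)"
    and rate: "\<And>i. rate_le (\<lambda>n. coeff (Q n - Q\<^sub>F) i) \<theta>" and \<theta>: "0 < \<theta>" "\<theta> < 1"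
    and \<xi>: "\<xi> \<in> S" "norm (\<Phi> \<xi>) < \<rho>" "\<rho> * \<theta> \<le> norm (\<Phi> \<xi>)" and i: "i \<in> {1..\<tau> \<xi>}"
  shows "\<exists>G\<in>PC. extends_to (ereal \<rho>) (\<lambda>z. G z - 1 / (z - \<xi>) ^ i)"
  using \<xi> i
proof (induction "card {\<eta> \<in> S. norm (\<Phi> \<xi>) < norm (\<Phi> \<eta>)}" arbitrary: \<xi> i rule: less_induct)
  case less
  note IH = less.hyps and \<xi> = less.prems(1-3)
  have later: "\<exists>G\<in>PC. extends_to (ereal \<rho>) (\<lambda>z. G z - 1 / (z - \<eta>) ^ k)"
    if \<eta>: "\<eta> \<in> S" "norm (\<Phi> \<xi>) < norm (\<Phi> \<eta>)" "norm (\<Phi> \<eta>) < \<rho>" "k \<in> {1..\<tau> \<eta>}" for \<eta> k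
  proof (rule IH[OF _ \<eta>(1,3) _ \<eta>(4)])
    show "card {\<zeta> \<in> S. norm (\<Phi> \<eta>) < norm (\<Phi> \<zeta>)} < card {\<zeta> \<in> S. norm (\<Phi> \<xi>) < norm (\<Phi> \<zeta>)}"
      using finite_poles \<eta> by (intro psubset_card_mono) auto
    show "\<rho> * \<theta> \<le> norm (\<Phi> \<eta>)" using \<xi>(3) \<eta>(2) by simp
  qed
  show ?case using less.prems(4)
  proof (induction i rule: less_induct)
    case (less i)
    show ?case
    proof (rule combination_with_unit_principal_part[OF Q rate \<theta> later _ \<xi> less.prems])
      show "\<exists>G\<in>PC. extends_to (ereal \<rho>) (\<lambda>z. G z - 1 / (z - \<xi>) ^ k)" if "k \<in> {1..<i}" for k
        using that less.prems by (intro less.IH) auto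
    qed
  qed
qed

text \<open>A smaller upper limit gives a rate \<theta> < \<Theta>. At a pole attaining the maximum,
  a combination with pure principal part of the critical order t then continues to index |\<Phi>
  \<xi>| / \<theta>, beyond the supremum that defines its characteristic index.\<close>

lemma denominator_limsup_ge:
  assumes Q: "\<And>n. 1 \<le> n \<Longrightarrow> HP_denominator \<mu> p d F m n (Q n)"
  shows "\<Theta> \<le> limsup (\<lambda>n. ereal (root n (coeff_norm (Q n - Q\<^sub>F))))"
proof (rule ccontr)
  define L where "L = limsup (\<lambda>n. ereal (root n (coeff_norm (Q n - Q\<^sub>F))))"
  assume "\<not> \<Theta> \<le> limsup (\<lambda>n. ereal (root n (coeff_norm (Q n - Q\<^sub>F))))"
  then have lt: "L < \<Theta>" by (simp add: L_def)
  have "ereal 0 \<le> L" unfolding L_def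
    by (rule le_Limsup) (auto simp: coeff_norm_nonneg real_root_ge_zero intro!: always_eventually)
  then have L0: "0 \<le> L" by (simp add: zero_ereal_def)
  obtain \<theta> where \<theta>: "L < ereal \<theta>" "ereal \<theta> < \<Theta>" using lt ereal_dense2 by blast
  have \<theta>0: "0 < \<theta>" using L0 \<theta>(1) by (metis le_less_trans zero_ereal_def less_ereal.simps(1))
  have "ereal \<theta> < 1" using \<theta>(2) Theta_bounds(2) by (rule less_trans)
  then have \<theta>1: "\<theta> < 1" by simp
  have "limsup (\<lambda>n. ereal (root n (norm (coeff_norm (Q n - Q\<^sub>F))))) \<le> ereal \<theta>"
    using \<theta>(1) coeff_norm_nonneg by (simp add: L_def abs_of_nonneg less_imp_le)
  then have rn: "rate_le (\<lambda>n. coeff_norm (Q n - Q\<^sub>F)) \<theta>" using \<theta>0 by (intro limsup_rate_le) auto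
  have rate: "rate_le (\<lambda>n. coeff (Q n - Q\<^sub>F) i) \<theta>" for i
  proof (rule rate_le_norm_mono[OF rn _ always_eventually])
    show "\<forall>n. norm (coeff (Q n - Q\<^sub>F) i) \<le> 1 * norm (coeff_norm (Q n - Q\<^sub>F))"
      using norm_coeff_le_coeff_norm[of "Q _ - Q\<^sub>F" i] coeff_norm_nonneg[of "Q _ - Q\<^sub>F"] by (simp del: coeff_diff)
  qed (use \<theta>0 in auto)
  have "\<Theta> \<in> (\<lambda>\<xi>. ereal (norm (\<Phi> \<xi>)) / brho E \<Phi> d F m \<xi>) ` S"
    unfolding \<Theta>_def using finite_poles S_nonempty by (intro Max_in) auto
  then obtain \<xi> where \<xi>: "\<xi> \<in> S" "\<Theta> = ereal (norm (\<Phi> \<xi>)) / brho E \<Phi> d F m \<xi>" by blast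
  have \<xi>E: "\<xi> \<notin> E" by (rule system_pole_notin[OF \<xi>(1)])
  define R where "R = norm (\<Phi> \<xi>)"
  have R: "1 < R" using Phi_gt_1[OF \<xi>E] by (simp add: R_def)
  \<comment> \<open>The index is finite, since otherwise the quotient \<Theta> would be 0.\<close>
  obtain b where b: "brho E \<Phi> d F m \<xi> = ereal b"
    using \<xi> \<theta> \<theta>0 brho_gt[OF \<xi>(1)] by (cases "brho E \<Phi> d F m \<xi>") auto
  have Rb: "R < b" using brho_gt[OF \<xi>(1)] b by (simp add: R_def)
  have "\<theta> < R / b" using \<theta>(2) \<xi>(2) b Rb R by (simp add: R_def)
  \<comment> \<open>The largest radius with \<rho> \<theta> \<le> |\<Phi> \<xi>|; it exceeds b
    because \<theta> < R / b.\<close>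
  define \<rho> where "\<rho> = R / \<theta>"
  have \<rho>: "b < \<rho>" "\<rho> * \<theta> = R" using \<open>\<theta> < R / b\<close> Rb R \<theta>0 by (simp_all add: \<rho>_def field_simps)
  have "brho E \<Phi> d F m \<xi> \<in> rho_pole E \<Phi> d F m \<xi> ` {1..\<tau> \<xi>}"
    unfolding brho_def brho_pole_def using system_order_pos[OF \<xi>(1)] by (intro Min_in) auto
  then obtain t where t: "t \<in> {1..\<tau> \<xi>}" "rho_pole E \<Phi> d F m \<xi> t = ereal b" using b by auto
  obtain G where G: "G \<in> PC" "extends_to (ereal \<rho>) (\<lambda>z. G z - 1 / (z - \<xi>) ^ t)"
    using unit_principal_parts[OF Q rate \<theta>0 \<theta>1 \<xi>(1) _ _ t(1), of \<rho>] \<rho> Rb by (auto simp: R_def)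
  obtain h V where h: "h holomorphic_on D (ereal \<rho>)" "open V" "E \<subseteq> V" "\<And>z. z \<in> V \<Longrightarrow> G z - 1 / (z - \<xi>) ^ t = h z"
    using G(2) unfolding extends_to_def agree_near_def by blast
  define c where "c = (\<lambda>k. if k = t then 1 else 0 :: complex)"
  have cs: "(\<Sum>k=1..t. c k / (z - \<xi>) ^ k) = 1 / (z - \<xi>) ^ t" for z
  proof -
    have "(\<Sum>k=1..t. c k / (z - \<xi>) ^ k) = (\<Sum>k\<in>{t}. c k / (z - \<xi>) ^ k)"
      using t(1) by (intro sum.mono_neutral_right) (auto simp: c_def)
    then show ?thesis by (simp add: c_def)
  qed
  have "agree_near E G (\<lambda>z. h z + (\<Sum>k=1..t. c k / (z - \<xi>) ^ k))"
  proof (rule agree_nearI[OF h(2,3)])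
    fix z assume "z \<in> V"
    from h(4)[OF this] show "G z = h z + (\<Sum>k=1..t. c k / (z - \<xi>) ^ k)" unfolding cs by (simp add: algebra_simps)
  qed
  moreover have "1 < ereal \<rho>" "\<xi> \<in> D (ereal \<rho>)" using R Rb \<rho> by (auto simp: canon_dom_def R_def)
  moreover have "1 \<le> t" "c t \<noteq> 0" using t(1) by (auto simp: c_def)
  ultimately have "ereal \<rho> \<le> rho_mero E \<Phi> t G" "sole_pole E \<Phi> \<xi> t G"
    using single_pole_extension(4,5)[OF _ h(1) _ \<xi>E] by blast+
  then have "ereal \<rho> \<le> rho_pole E \<Phi> d F m \<xi> t"
    unfolding rho_pole_def using G(1) by (intro SUP_upper2[of G]) auto
  then show False using t(2) \<rho>(1) by simp
qed

end

section \<open>Convergence of the approximants\<close>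

text \<open>The supremum over an empty set is -\<infinity>, whose root is 0 by convention and still
  below the bound.\<close>

lemma ereal_root_le:
  assumes "x \<le> ereal b" "0 \<le> b" "0 < n" shows "ereal_root n x \<le> ereal (root n b)"
proof (cases x)
  case (real r)
  then show ?thesis using assms by (simp add: ereal_root_def)
next
  case MInf
  then show ?thesis using assms by (simp add: ereal_root_def real_root_ge_zero)
qed (use assms in simp)

text \<open>Being nicely meromorphic is a pointwise condition on germs together with the value at
  the point, so it survives the gluing of continuations.\<close>

lemma nicely_meromorphic_on_cong_local:
  assumes "\<And>z. z \<in> A \<Longrightarrow> \<exists>U g. open U \<and> z \<in> U \<and> (\<forall>w\<in>U. f w = g w) \<and> g nicely_meromorphic_on {z}"
  shows "f nicely_meromorphic_on A"
proof -
  have "f nicely_meromorphic_on {z}" if z: "z \<in> A" for z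
  proof -
    obtain U g where U: "open U" "z \<in> U" "\<And>w. w \<in> U \<Longrightarrow> f w = g w" and g: "g nicely_meromorphic_on {z}"
      using assms[OF z] by blast
    have ev: "\<forall>\<^sub>F w in at z. f w = g w"
      using eventually_at_in_open'[OF U(1,2)] by eventually_elim (rule U(3))
    have fz: "f z = g z" by (rule U(3)[OF U(2)])
    have "f meromorphic_on {z}"
    proof -
      have "g meromorphic_on {z}" using g by (simp add: nicely_meromorphic_on_def)
      moreover have "f meromorphic_on {z} \<longleftrightarrow> g meromorphic_on {z}"
        by (rule meromorphic_on_cong) (use ev in auto)
      ultimately show ?thesis by simp
    qed
    then show ?thesis
      using g is_pole_cong[OF ev refl] tendsto_cong[OF ev] fz by (simp add: nicely_meromorphic_on_def)
  qed
  then show ?thesis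
    unfolding nicely_meromorphic_on_def using meromorphic_on_meromorphic_at by blast
qed

lemma pole_order_cong:
  assumes "\<forall>\<^sub>F w in at z. f w = g w" shows "pole_order f z = pole_order g z"
  using zorder_cong[OF assms refl] is_pole_cong[OF assms refl] by (simp add: pole_order_def)

context hermite_pade
begin

text \<open>The supremum in \<open>rho_comp\<close> is attained: the continuations to admissible
  domains agree on overlaps by uniqueness and glue to one on \<open>D \<rho>c\<close>. As
  \<open>ext_comp\<close> is merely some continuation, its poles and orders are compared with the
  pieces by uniqueness once more.\<close>

lemma ext_comp_properties:
  fixes i k :: nat
  assumes i: "i \<in> {1..d}"
  defines "\<rho>c \<equiv> rho_comp E \<Phi> d F m i k" and "g \<equiv> ext_comp E \<Phi> d F m i k"
  shows "1 < \<rho>c" "g nicely_meromorphic_on D \<rho>c" "agree_near E g (\<lambda>z. z ^ k * F i z)"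
    "\<And>\<xi>. \<xi> \<in> D \<rho>c \<Longrightarrow> is_pole g \<xi> \<Longrightarrow> \<xi> \<in> S \<and> pole_order g \<xi> \<le> \<tau> \<xi>"
proof -
  define f where "f = (\<lambda>z. z ^ k * F i z)"
  define ok where "ok \<rho> h \<longleftrightarrow> mero_ext E f (D \<rho>) h \<and>
     (\<forall>\<xi>\<in>D \<rho>. is_pole h \<xi> \<longrightarrow> \<xi> \<in> S \<and> pole_order h \<xi> \<le> \<tau> \<xi>)" for \<rho> h
  define A where "A = {\<rho>. 1 < \<rho> \<and> (\<exists>h. ok \<rho> h)}"
  have \<rho>c: "\<rho>c = Sup A" unfolding \<rho>c_def rho_comp_def A_def ok_def f_def ..
  obtain U where U: "open U" "E \<subseteq> U" "F i holomorphic_on U"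
    using F_analytic[OF i] unfolding analytic_on_holomorphic by blast
  obtain s where s: "s > 1" "D (ereal s) \<subseteq> U" using D_near_E[OF U(1,2)] by blast
  have s1: "1 < ereal s" using s by simp
  have "f holomorphic_on D (ereal s)" unfolding f_def
    by (intro holomorphic_intros holomorphic_on_subset[OF U(3) s(2)])
  then have an: "f analytic_on D (ereal s)" using open_D[OF s1] by (simp add: analytic_on_open)
  have "ok (ereal s) f" unfolding ok_def mero_ext_def
  proof (intro conjI ballI impI agree_near_refl)
    show "f nicely_meromorphic_on D (ereal s)" using an by (rule analytic_on_imp_nicely_meromorphic_on)
    fix \<xi> assume "\<xi> \<in> D (ereal s)" "is_pole f \<xi>"
    then have False using an analytic_at_imp_no_pole analytic_on_analytic_at by blast
    then show "\<xi> \<in> S" "pole_order f \<xi> \<le> \<tau> \<xi>" by auto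
  qed
  then have sA: "ereal s \<in> A" using s1 by (auto simp: A_def)
  then have "ereal s \<le> \<rho>c" unfolding \<rho>c by (rule Sup_upper)
  with s1 show "1 < \<rho>c" by (rule less_le_trans)
  have "\<exists>h. ok \<rho> h" if "\<rho> \<in> A" for \<rho> using that by (simp add: A_def)
  then obtain h where h: "\<And>\<rho>. \<rho> \<in> A \<Longrightarrow> ok \<rho> (h \<rho>)" by metis
  have A1: "1 < \<rho>" if "\<rho> \<in> A" for \<rho> using that by (simp add: A_def)
  have hm: "h \<rho> nicely_meromorphic_on D \<rho>" "agree_near E (h \<rho>) f" if "\<rho> \<in> A" for \<rho>
    using h[OF that] by (auto simp: ok_def mero_ext_def)
  have inA: "\<exists>\<rho>\<in>A. z \<in> D \<rho>" if "z \<in> D \<rho>c" for z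
  proof (cases "z \<in> E")
    case True then show ?thesis using sA E_subset_D by blast
  next
    case False
    then have "ereal (norm (\<Phi> z)) < Sup A" using that \<rho>c by (auto simp: canon_dom_def)
    then obtain \<rho> where "\<rho> \<in> A" "ereal (norm (\<Phi> z)) < \<rho>" unfolding less_Sup_iff by blast
    then show ?thesis using False by (intro bexI[of _ \<rho>]) (auto simp: canon_dom_def)
  qed
  have Dmin: "D (min a b) = D a \<inter> D b" for a b by (auto simp: canon_dom_def)
  have agree: "h a z = h b z" if ab: "a \<in> A" "b \<in> A" "z \<in> D a" "z \<in> D b" for a b z
  proof (rule nicely_meromorphic_unique[of "min a b" "h a" "h b"])
    show "1 < min a b" using A1 ab by simp
    show "h a nicely_meromorphic_on D (min a b)" "h b nicely_meromorphic_on D (min a b)"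
      unfolding Dmin by (rule nicely_meromorphic_on_subset[OF hm(1)], use ab in auto)+
    show "agree_near E (h a) (h b)"
      by (rule agree_near_trans[OF hm(2)[OF ab(1)] agree_near_sym[OF hm(2)[OF ab(2)]]])
  qed (use ab Dmin in auto)
  define G where "G z = h (SOME \<rho>. \<rho> \<in> A \<and> z \<in> D \<rho>) z" for z
  have Gh: "G z = h \<rho> z" if "\<rho> \<in> A" "z \<in> D \<rho>" for z \<rho>
  proof -
    have "(SOME \<rho>. \<rho> \<in> A \<and> z \<in> D \<rho>) \<in> A \<and> z \<in> D (SOME \<rho>. \<rho> \<in> A \<and> z \<in> D \<rho>)"
      by (rule someI[of _ \<rho>]) (use that in simp)
    then show ?thesis unfolding G_def using that by (intro agree) auto
  qed
  have "G nicely_meromorphic_on D \<rho>c"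
  proof (rule nicely_meromorphic_on_cong_local)
    fix z assume "z \<in> D \<rho>c"
    then obtain \<rho> where \<rho>: "\<rho> \<in> A" "z \<in> D \<rho>" using inA by blast
    show "\<exists>U g. open U \<and> z \<in> U \<and> (\<forall>w\<in>U. G w = g w) \<and> g nicely_meromorphic_on {z}"
      by (rule exI[of _ "D \<rho>"], rule exI[of _ "h \<rho>"])
         (use \<rho> open_D[OF A1[OF \<rho>(1)]] Gh nicely_meromorphic_on_subset[OF hm(1)[OF \<rho>(1)], of "{z}"] in auto)
  qed
  moreover have "agree_near E G f"
  proof (rule agree_near_trans[OF _ hm(2)[OF sA]])
    show "agree_near E G (h (ereal s))"
      by (rule agree_nearI[OF open_D[OF s1] E_subset_D]) (rule Gh[OF sA])
  qed
  ultimately have "mero_ext E f (D \<rho>c) G" by (simp add: mero_ext_def)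
  then have "mero_ext E f (D \<rho>c) g"
    unfolding g_def ext_comp_def continuation_def dom_comp_def f_def[symmetric] \<rho>c_def[symmetric] by (rule someI[of "mero_ext E f (D \<rho>c)"])
  then show gm: "g nicely_meromorphic_on D \<rho>c" and ga: "agree_near E g (\<lambda>z. z ^ k * F i z)"
    by (auto simp: mero_ext_def f_def)
  fix \<xi> assume \<xi>: "\<xi> \<in> D \<rho>c" "is_pole g \<xi>"
  obtain \<rho> where \<rho>: "\<rho> \<in> A" "\<xi> \<in> D \<rho>" using inA[OF \<xi>(1)] by blast
  have sub: "D \<rho> \<subseteq> D \<rho>c" unfolding \<rho>c using \<rho>(1) by (intro canon_dom_mono Sup_upper)
  have eq: "g w = h \<rho> w" if "w \<in> D \<rho>" for w
  proof (rule nicely_meromorphic_unique[OF A1[OF \<rho>(1)] nicely_meromorphic_on_subset[OF gm sub] hm(1)[OF \<rho>(1)] _ that])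
    show "agree_near E g (h \<rho>)"
      using agree_near_trans[OF ga] agree_near_sym[OF hm(2)[OF \<rho>(1)]] unfolding f_def by blast
  qed
  have ev: "\<forall>\<^sub>F w in at \<xi>. g w = h \<rho> w"
    using eventually_at_in_open'[OF open_D[OF A1[OF \<rho>(1)]] \<rho>(2)] by eventually_elim (rule eq)
  have "is_pole (h \<rho>) \<xi>" using \<xi>(2) is_pole_cong[OF ev refl] by simp
  then have "\<xi> \<in> S \<and> pole_order (h \<rho>) \<xi> \<le> \<tau> \<xi>" using h[OF \<rho>(1)] \<rho>(2) unfolding ok_def by blast
  then show "\<xi> \<in> S \<and> pole_order g \<xi> \<le> \<tau> \<xi>" using pole_order_cong[OF ev] by simp
qed

end

section \<open>Remainders of Fourier series\<close>

context regular_domain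
begin

text \<open>The partial sum runs over j < n, so for n \<ge> 1 its degree is at most n - 1, the bound
  imposed on the numerators.\<close>

definition remainder :: "nat \<Rightarrow> (complex \<Rightarrow> complex) \<Rightarrow> complex \<Rightarrow> complex" where
  "remainder n u z = u z - (\<Sum>j<n. fourier j u * poly (p j) z)"

lemma remainder_add:
  "continuous_on E u \<Longrightarrow> continuous_on E v \<Longrightarrow> remainder n (\<lambda>z. u z + v z) z = remainder n u z + remainder n v z"
  unfolding remainder_def by (simp add: fourier_add ring_distribs sum.distrib)

lemma remainder_cmult: "remainder n (\<lambda>z. c * u z) z = c * remainder n u z"
  unfolding remainder_def by (simp add: fourier_cmult right_diff_distrib sum_distrib_left mult.assoc)

lemma remainder_sum:
  assumes "\<And>i. i \<in> I \<Longrightarrow> continuous_on E (u i)"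
  shows "remainder n (\<lambda>z. \<Sum>i\<in>I. u i z) z = (\<Sum>i\<in>I. remainder n (u i) z)"
  using assms
proof (induction I rule: infinite_finite_induct)
  case (insert i I)
  have "continuous_on E (\<lambda>z. \<Sum>i\<in>I. u i z)" using insert.prems by (intro continuous_on_sum) auto
  then show ?case using insert remainder_add[of "u i" "\<lambda>z. \<Sum>i\<in>I. u i z"] by simp
qed (simp_all add: remainder_def fourier_eq set_lebesgue_integral_def)

lemma remainder_poly: "degree q < n \<Longrightarrow> remainder n (poly q) z = 0"
  unfolding remainder_def using poly_fourier_expansion[of q n z] by simp

text \<open>Fourier coefficients see only E, while z may lie outside; hence the separate hypothesis
  at z.\<close>

lemma remainder_cong:
  assumes "\<And>w. w \<in> E \<Longrightarrow> u w = v w" "u z = v z" shows "remainder n u z = remainder n v z"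
  unfolding remainder_def using fourier_cong[OF assms(1)] assms(2) by simp

lemma remainder_poly_mult:
  assumes "degree q \<le> N" "continuous_on E h"
  shows "remainder n (\<lambda>z. poly q z * h z) z = (\<Sum>a\<le>N. coeff q a * remainder n (\<lambda>z. z ^ a * h z) z)"
proof -
  have q: "poly q z = (\<Sum>a\<le>N. coeff q a * z ^ a)" for z
    unfolding poly_altdef by (rule sum.mono_neutral_left) (use assms in \<open>auto simp: coeff_eq_0\<close>)
  have "remainder n (\<lambda>z. poly q z * h z) z = remainder n (\<lambda>z. \<Sum>a\<le>N. coeff q a * (z ^ a * h z)) z"
    by (rule remainder_cong) (simp_all add: q sum_distrib_right mult.assoc)
  also have "\<dots> = (\<Sum>a\<le>N. remainder n (\<lambda>z. coeff q a * (z ^ a * h z)) z)"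
    by (rule remainder_sum) (intro continuous_intros assms)
  finally show ?thesis by (simp only: remainder_cmult)
qed

lemma remainder_poly_pole:
  assumes q: "degree q \<le> N" "N < n" and \<xi>: "\<xi> \<notin> E" "z \<noteq> \<xi>"
  shows "remainder n (\<lambda>z. poly q z / (z - \<xi>) ^ s) z =
     (\<Sum>l<s. tcoeff q \<xi> l * remainder n (\<lambda>z. 1 / (z - \<xi>) ^ (s - l)) z)"
proof -
  obtain r where r: "degree r \<le> N" "\<And>z. z \<noteq> \<xi> \<Longrightarrow>
     poly q z / (z - \<xi>) ^ s = (\<Sum>l<s. tcoeff q \<xi> l * (1 / (z - \<xi>) ^ (s - l))) + poly r z"
    using poly_pole_division[OF q(1), of \<xi> s] by blast
  have c: "continuous_on E (\<lambda>z. 1 / (z - \<xi>) ^ t)" for t using \<xi> by (intro continuous_intros) auto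
  have "remainder n (\<lambda>z. poly q z / (z - \<xi>) ^ s) z =
      remainder n (\<lambda>z. (\<Sum>l<s. tcoeff q \<xi> l * (1 / (z - \<xi>) ^ (s - l))) + poly r z) z"
    by (rule remainder_cong) (metis r(2) \<xi>(1), rule r(2)[OF \<xi>(2)])
  also have "\<dots> = remainder n (\<lambda>z. \<Sum>l<s. tcoeff q \<xi> l * (1 / (z - \<xi>) ^ (s - l))) z + remainder n (poly r) z"
    by (intro remainder_add continuous_on_sum continuous_on_mult_left c continuous_intros)
  also have "remainder n (poly r) z = 0" using r(1) q(2) by (intro remainder_poly) simp
  also have "remainder n (\<lambda>z. \<Sum>l<s. tcoeff q \<xi> l * (1 / (z - \<xi>) ^ (s - l))) z =
      (\<Sum>l<s. remainder n (\<lambda>z. tcoeff q \<xi> l * (1 / (z - \<xi>) ^ (s - l))) z)"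
    by (rule remainder_sum) (intro continuous_on_mult_left c)
  finally show ?thesis by (simp only: remainder_cmult add_0_right)
qed

end

context hermite_pade
begin

text \<open>The numerator has degree below n and shares the Fourier coefficients j < n with the
  product, so it is exactly the partial sum. The identity of polynomials extends this from E to
  every z.\<close>

lemma numerator_remainder:
  assumes n: "1 \<le> n" and P: "HP_numerator \<mu> p (F i) n q k P" and i: "i \<in> {1..d}"
    and g: "\<And>w. w \<in> E \<Longrightarrow> g w = w ^ k * F i w"
  shows "poly q z * g z - poly P z = remainder n (\<lambda>z. poly q z * g z) z"
proof -
  have "degree P < n" using P n unfolding HP_numerator_def by auto
  then have "poly P z = (\<Sum>j<n. fourier j (poly P) * poly (p j) z)" by (rule poly_fourier_expansion)
  also have "\<dots> = (\<Sum>j<n. fourier j (\<lambda>z. poly q z * g z) * poly (p j) z)"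
  proof (rule sum.cong[OF refl])
    fix j assume "j \<in> {..<n}"
    then have "fourier j (poly P) = fourier j (\<lambda>z. poly q z * (z ^ k * F i z))"
      using HP_numerator_fourier[OF P continuous_F[OF i], of j] by simp
    also have "\<dots> = fourier j (\<lambda>z. poly q z * g z)" by (rule fourier_cong) (simp add: g)
    finally show "fourier j (poly P) * poly (p j) z = fourier j (\<lambda>z. poly q z * g z) * poly (p j) z" by simp
  qed
  finally show ?thesis by (simp add: remainder_def)
qed

end

lemma rate_le_power: "0 \<le> x \<Longrightarrow> rate_le (\<lambda>n. x ^ n :: real) x"
  unfolding rate_le_def by (auto intro!: exI[of _ 1] power_mono)

section \<open>Error of the approximants\<close>

context hermite_pade
begin

text \<open>The poles are among the finitely many system poles, so the infimum is a minimum, or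
  infinite when there are none, and strict bounds below by 1 survive.\<close>

lemma rho_star_properties:
  fixes i k :: nat
  assumes i: "i \<in> {1..d}"
  defines "g \<equiv> ext_comp E \<Phi> d F m i k" and "\<rho>c \<equiv> rho_comp E \<Phi> d F m i k"
  shows "finite {z \<in> D \<rho>c. is_pole g z}" "rho_star E \<Phi> d F m i k \<le> \<rho>c"
    "\<And>\<xi>. \<xi> \<in> {z \<in> D \<rho>c. is_pole g z} \<Longrightarrow>
       \<xi> \<in> S \<and> pole_order g \<xi> \<le> \<tau> \<xi> \<and> rho_star E \<Phi> d F m i k \<le> brho_pole E \<Phi> d F m \<xi> (pole_order g \<xi>)"
    "1 < rho_star E \<Phi> d F m i k"
proof -
  note ec = ext_comp_properties[where k = k, OF i, folded g_def \<rho>c_def]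
  define PS where "PS = {z \<in> D \<rho>c. is_pole g z}"
  have PS: "\<xi> \<in> S \<and> pole_order g \<xi> \<le> \<tau> \<xi>" if "\<xi> \<in> PS" for \<xi> using ec(4)[of \<xi>] that by (simp add: PS_def)
  then have "PS \<subseteq> S" by blast
  then show fin: "finite {z \<in> D \<rho>c. is_pole g z}" using finite_poles finite_subset unfolding PS_def by blast
  have star: "rho_star E \<Phi> d F m i k = min \<rho>c (INF \<xi>\<in>PS. brho_pole E \<Phi> d F m \<xi> (pole_order g \<xi>))"
    unfolding rho_star_def dom_comp_def g_def[symmetric] \<rho>c_def[symmetric] PS_def ..
  show "rho_star E \<Phi> d F m i k \<le> \<rho>c" unfolding star by simp
  show "\<xi> \<in> S \<and> pole_order g \<xi> \<le> \<tau> \<xi> \<and> rho_star E \<Phi> d F m i k \<le> brho_pole E \<Phi> d F m \<xi> (pole_order g \<xi>)"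
    if "\<xi> \<in> {z \<in> D \<rho>c. is_pole g z}" for \<xi>
  proof -
    have \<xi>: "\<xi> \<in> PS" using that by (simp add: PS_def)
    have "(INF \<xi>\<in>PS. brho_pole E \<Phi> d F m \<xi> (pole_order g \<xi>)) \<le> brho_pole E \<Phi> d F m \<xi> (pole_order g \<xi>)"
      using \<xi> by (rule INF_lower)
    then show ?thesis using PS[OF \<xi>] unfolding star by (simp add: min.coboundedI2)
  qed
  have order1: "1 \<le> pole_order g \<xi>" if "\<xi> \<in> PS" for \<xi>
    using nicely_meromorphic_principal_parts[OF open_D[OF ec(1)] ec(2) fin] that unfolding PS_def by blast
  have gt: "1 < brho_pole E \<Phi> d F m \<xi> (pole_order g \<xi>)" if \<xi>: "\<xi> \<in> PS" for \<xi>
  proof -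
    have "1 < ereal (norm (\<Phi> \<xi>))" using Phi_gt_1[OF system_pole_notin] PS[OF \<xi>] by simp
    also have "\<dots> < brho_pole E \<Phi> d F m \<xi> (pole_order g \<xi>)"
      using PS[OF \<xi>] order1[OF \<xi>] by (intro brho_pole_gt) auto
    finally show ?thesis .
  qed
  have "1 < (INF \<xi>\<in>PS. brho_pole E \<Phi> d F m \<xi> (pole_order g \<xi>))"
  proof (cases "PS = {}")
    case False
    have "finite PS" using fin by (simp add: PS_def)
    then have "(INF \<xi>\<in>PS. brho_pole E \<Phi> d F m \<xi> (pole_order g \<xi>)) = Min ((\<lambda>\<xi>. brho_pole E \<Phi> d F m \<xi> (pole_order g \<xi>)) ` PS)"
      using False by (intro Min_Inf[symmetric]) auto
    also have "1 < \<dots>" using \<open>finite PS\<close> False gt by (subst Min_gr_iff) auto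
    finally show ?thesis .
  qed (simp add: top_ereal_def)
  then show "1 < rho_star E \<Phi> d F m i k" unfolding star using ec(1) by simp
qed

lemma denominator_coeff_bounded:
  assumes Q: "\<And>n. 1 \<le> n \<Longrightarrow> HP_denominator \<mu> p d F m n (Q n)"
  shows "rate_le (\<lambda>n. coeff (Q n) i) 1"
proof -
  obtain y where y: "\<Theta> < ereal y" "y < 1" using Theta_bounds(2) ereal_dense2[of \<Theta> 1] by auto
  have "rate_le (\<lambda>n. coeff (Q n - Q\<^sub>F) i) 1"
    by (rule rate_le_mono[OF denominator_coeff_rate[OF Q y(1)]]) (use y in auto)
  moreover have "rate_le (\<lambda>n. coeff Q\<^sub>F i) 1" by (rule rate_le_bounded[of _ "norm (coeff Q\<^sub>F i)"]) simp
  ultimately have "rate_le (\<lambda>n. coeff (Q n - Q\<^sub>F) i + coeff Q\<^sub>F i) 1" by (rule rate_le_add) simp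
  then show ?thesis by simp
qed

text \<open>After splitting off principal parts, a pole \<xi> contributes Taylor coefficients of
  rate |\<Phi> \<xi>| / r times remainders of 1 / (z - \<xi>)^s of rate x' / |\<Phi> \<xi>|. The
  factors |\<Phi> \<xi>| cancel, so even the divergence of the series beyond the circle of \<xi>
  does no harm.\<close>

lemma numerator_error_rate:
  assumes Q: "\<And>n. 1 \<le> n \<Longrightarrow> HP_denominator \<mu> p d F m n (Q n)"
    and P: "\<And>n. 1 \<le> n \<Longrightarrow> HP_numerator \<mu> p (F i) n (Q n) k (P n)" and i: "i \<in> {1..d}"
    and K: "compact K" "K \<inter> S = {}" "K \<subseteq> D (ereal x)"
    and x: "1 < x" "x < x'" "x' < r" "ereal r < rho_star E \<Phi> d F m i k"
  shows "\<exists>B :: nat \<Rightarrow> real. rate_le B (x' / r) \<and> (\<forall>\<^sub>F n in sequentially. \<forall>z\<in>K.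
     norm (poly (Q n) z * ext_comp E \<Phi> d F m i k z - poly (P n) z) \<le> B n)"
proof -
  define g where "g = ext_comp E \<Phi> d F m i k"
  define \<rho>c where "\<rho>c = rho_comp E \<Phi> d F m i k"
  define PS where "PS = {z \<in> D \<rho>c. is_pole g z}"
  define N where "N = pole_order g"
  note ec = ext_comp_properties[where k = k, OF i, folded g_def \<rho>c_def]
  note rs = rho_star_properties[where k = k, OF i, folded g_def \<rho>c_def, folded PS_def N_def]
  obtain h c where hc: "h holomorphic_on D \<rho>c"
    "\<And>z. z \<in> D \<rho>c - PS \<Longrightarrow> g z = h z + (\<Sum>\<xi>\<in>PS. \<Sum>s=1..N \<xi>. c \<xi> s / (z - \<xi>) ^ s)"
    using nicely_meromorphic_principal_parts[OF open_D[OF ec(1)] ec(2) rs(1)[unfolded PS_def]]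
    unfolding PS_def[symmetric] N_def by blast
  have PSE: "\<xi> \<notin> E" if "\<xi> \<in> PS" for \<xi> using rs(3)[OF that] system_pole_notin by blast
  have r\<rho>: "ereal r < \<rho>c" using x(4) rs(2) by (rule less_le_trans)
  have KD: "z \<in> D \<rho>c - PS" if "z \<in> K" for z
  proof -
    have "ereal x < ereal r" using x by simp
    from less_trans[OF this r\<rho>] have "ereal x \<le> \<rho>c" by (rule less_imp_le)
    then have "z \<in> D \<rho>c" using that K(3) canon_dom_mono by blast
    moreover have "z \<notin> PS" using that K(2) rs(3) by blast
    ultimately show ?thesis by simp
  qed
  have EPS: "z \<in> D \<rho>c - PS" if "z \<in> E" for z using that E_subset_D PSE by blast
  define q where "q n = (if n = 0 then 1 else Q n)" for n
  have qdeg: "degree (q n) \<le> M" for n using Q[of n] unfolding q_def HP_denominator_def by auto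
  have qr: "rate_le (\<lambda>n. coeff (q n) a) 1" for a
  proof (rule rate_le_cong[OF denominator_coeff_bounded[OF Q]])
    show "\<forall>\<^sub>F n in sequentially. coeff (q n) a = coeff (Q n) a"
      using eventually_gt_at_top[of 0] by eventually_elim (simp add: q_def)
  qed auto
  have ann: "annihilates n (q n)" if "1 \<le> n" for n
    using HP_denominator_annihilates[OF Q[OF that] that] that by (simp add: q_def)
  have tr: "rate_le (\<lambda>n. tcoeff (q n) \<xi> l) (norm (\<Phi> \<xi>) / r)" if \<xi>: "\<xi> \<in> PS" and l: "l < N \<xi>" for \<xi> l
  proof -
    have \<xi>S: "\<xi> \<in> S" "N \<xi> \<le> \<tau> \<xi>" "rho_star E \<Phi> d F m i k \<le> brho_pole E \<Phi> d F m \<xi> (N \<xi>)" using rs(3)[OF \<xi>] by auto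
    have le: "brho_pole E \<Phi> d F m \<xi> (N \<xi>) \<le> brho_pole E \<Phi> d F m \<xi> (Suc l)" using l by (intro brho_pole_antimono) auto
    have b1: "ereal r < brho_pole E \<Phi> d F m \<xi> (Suc l)" using less_le_trans[OF less_le_trans[OF x(4) \<xi>S(3)] le] .
    have b2: "ereal (norm (\<Phi> \<xi>)) < brho_pole E \<Phi> d F m \<xi> (Suc l)" using l \<xi>S(2) by (intro brho_pole_gt[OF \<xi>S(1)]) auto
    \<comment> \<open>\<open>tcoeff_rate\<close> asks for a radius beyond the circle of \<xi>, which
      r need not be. A radius r' beyond both gives an even better rate than the one claimed with
      r.\<close>
    have "ereal (max r (norm (\<Phi> \<xi>))) < brho_pole E \<Phi> d F m \<xi> (Suc l)" using b1 b2 by (simp add: max_def)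
    then obtain r' where r': "max r (norm (\<Phi> \<xi>)) < r'" "ereal r' < brho_pole E \<Phi> d F m \<xi> (Suc l)"
      using ereal_dense2 less_ereal.simps(1) by blast
    have "l < \<tau> \<xi>" "norm (\<Phi> \<xi>) < r'" using l \<xi>S(2) r'(1) by auto
    then have "rate_le (\<lambda>n. tcoeff (q n) \<xi> l) (norm (\<Phi> \<xi>) / r')"
      using tcoeff_rate[OF qdeg qr ann \<xi>S(1)] r'(2) by blast
    moreover have "norm (\<Phi> \<xi>) / r' \<le> norm (\<Phi> \<xi>) / r" using r'(1) x by (intro divide_left_mono) auto
    ultimately show ?thesis by (rule rate_le_mono)
  qed
  have "\<exists>C. \<forall>n. \<forall>z\<in>D (ereal x). norm (remainder n (\<lambda>z. z ^ a * h z) z) \<le> C * (x / r) ^ n" for a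
    unfolding remainder_def using x r\<rho> by (intro fourier_tail[of _ \<rho>c] holomorphic_intros hc) auto
  then obtain C1 where C1: "\<And>a n z. z \<in> D (ereal x) \<Longrightarrow> norm (remainder n (\<lambda>z. z ^ a * h z) z) \<le> C1 a * (x / r) ^ n"
    by metis
  have "\<exists>C. \<forall>n. \<forall>z\<in>K. norm (remainder n (\<lambda>z. 1 / (z - \<xi>) ^ s) z) \<le> C * (x' / norm (\<Phi> \<xi>)) ^ n" if "\<xi> \<in> PS" for \<xi> s
    unfolding remainder_def using that KD by (intro fourier_pole_tail[OF PSE[OF that] K(1) _ x(1) K(3) x(2)]) auto
  then obtain C2 where C2: "\<And>\<xi> s n z. \<xi> \<in> PS \<Longrightarrow> z \<in> K \<Longrightarrow>
      norm (remainder n (\<lambda>z. 1 / (z - \<xi>) ^ s) z) \<le> C2 \<xi> s * (x' / norm (\<Phi> \<xi>)) ^ n" by metis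
  \<comment> \<open>A real majorant, uniform in z on K, whose rate can be computed without reference
    to z.\<close>
  define B where "B n = (\<Sum>a\<le>M. norm (coeff (q n) a) * (C1 a * (x / r) ^ n)) +
     (\<Sum>\<xi>\<in>PS. \<Sum>s=1..N \<xi>. norm (c \<xi> s) * (\<Sum>l<s. norm (tcoeff (q n) \<xi> l) * (C2 \<xi> (s - l) * (x' / norm (\<Phi> \<xi>)) ^ n)))" for n
  have const: "rate_le (\<lambda>n. C * a n) y" if "rate_le a y" "0 \<le> y" for C y :: real and a
    by (rule rate_le_mult_bounded[of "\<lambda>_. C" "norm C"]) (use that in auto)
  have xr0: "0 \<le> x / r" "0 \<le> x' / r" using x by auto
  have "rate_le B (x' / r)" unfolding B_def
  proof (intro rate_le_add rate_le_sum const xr0(2))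
    fix a
    have p1: "rate_le (\<lambda>n. C1 a * (x / r) ^ n) (x / r)" by (intro const rate_le_power xr0)
    have "rate_le (\<lambda>n. norm (coeff (q n) a)) 1" unfolding rate_le_norm by (rule qr)
    from rate_le_mult[OF this p1 _ xr0(1)]
    have "rate_le (\<lambda>n. norm (coeff (q n) a) * (C1 a * (x / r) ^ n)) (x / r)" by simp
    moreover have "x / r \<le> x' / r" using x by (intro divide_right_mono) auto
    ultimately show "rate_le (\<lambda>n. norm (coeff (q n) a) * (C1 a * (x / r) ^ n)) (x' / r)" by (rule rate_le_mono)
  next
    fix \<xi> s l assume \<xi>: "\<xi> \<in> PS" and s: "s \<in> {1..N \<xi>}" and l: "l \<in> {..<s}"
    have R: "0 < norm (\<Phi> \<xi>)" using Phi_gt_1[OF PSE[OF \<xi>]] by linarith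
    have R0: "0 \<le> x' / norm (\<Phi> \<xi>)" "0 \<le> norm (\<Phi> \<xi>) / r" using x by auto
    have p1: "rate_le (\<lambda>n. C2 \<xi> (s - l) * (x' / norm (\<Phi> \<xi>)) ^ n) (x' / norm (\<Phi> \<xi>))" by (intro const rate_le_power R0)
    have p2: "rate_le (\<lambda>n. norm (tcoeff (q n) \<xi> l)) (norm (\<Phi> \<xi>) / r)"
      unfolding rate_le_norm by (rule tr[OF \<xi>]) (use s l in auto)
    have "norm (\<Phi> \<xi>) / r * (x' / norm (\<Phi> \<xi>)) = x' / r" using R by simp
    then show "rate_le (\<lambda>n. norm (tcoeff (q n) \<xi> l) * (C2 \<xi> (s - l) * (x' / norm (\<Phi> \<xi>)) ^ n)) (x' / r)"
      using rate_le_mult[OF p2 p1 R0(2,1)] by (simp only:)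
  qed
  moreover have "\<forall>\<^sub>F n in sequentially. \<forall>z\<in>K. norm (poly (Q n) z * g z - poly (P n) z) \<le> B n"
    using eventually_gt_at_top[of M]
  proof eventually_elim
    case (elim n)
    have n: "1 \<le> n" "q n = Q n" using elim by (auto simp: q_def)
    show ?case
    proof
      fix z assume z: "z \<in> K"
      have ch: "continuous_on E h" by (rule continuous_on_E_of_holomorphic[OF hc(1)])
      have cp: "continuous_on E (\<lambda>w. poly (q n) w / (w - \<xi>) ^ s)" if "\<xi> \<in> PS" for \<xi> s
        using PSE[OF that] by (intro continuous_intros) auto
      have gE: "g w = w ^ k * F i w" if "w \<in> E" for w using agree_near_on[OF ec(3) that] .
      have dist: "poly (q n) w * g w = poly (q n) w * h w + (\<Sum>\<xi>\<in>PS. \<Sum>s=1..N \<xi>. c \<xi> s * (poly (q n) w / (w - \<xi>) ^ s))"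
        if "w \<in> D \<rho>c - PS" for w
        unfolding hc(2)[OF that] by (simp only: ring_distribs sum_distrib_left) (simp add: mult_ac)
      have "poly (Q n) z * g z - poly (P n) z = remainder n (\<lambda>z. poly (q n) z * g z) z"
        unfolding n(2) by (rule numerator_remainder[OF n(1) P[OF n(1)] i gE])
      also have "\<dots> = remainder n (\<lambda>z. poly (q n) z * h z + (\<Sum>\<xi>\<in>PS. \<Sum>s=1..N \<xi>. c \<xi> s * (poly (q n) z / (z - \<xi>) ^ s))) z"
        by (rule remainder_cong) (intro dist EPS, assumption, intro dist KD z)
      also have "\<dots> = remainder n (\<lambda>z. poly (q n) z * h z) z
          + remainder n (\<lambda>z. \<Sum>\<xi>\<in>PS. \<Sum>s=1..N \<xi>. c \<xi> s * (poly (q n) z / (z - \<xi>) ^ s)) z"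
        by (intro remainder_add continuous_on_sum continuous_on_mult_left cp continuous_intros ch)
      also have "remainder n (\<lambda>z. \<Sum>\<xi>\<in>PS. \<Sum>s=1..N \<xi>. c \<xi> s * (poly (q n) z / (z - \<xi>) ^ s)) z
          = (\<Sum>\<xi>\<in>PS. remainder n (\<lambda>z. \<Sum>s=1..N \<xi>. c \<xi> s * (poly (q n) z / (z - \<xi>) ^ s)) z)"
        by (rule remainder_sum) (intro continuous_on_sum continuous_on_mult_left cp)
      also have "\<dots> = (\<Sum>\<xi>\<in>PS. \<Sum>s=1..N \<xi>. c \<xi> s * (\<Sum>l<s. tcoeff (q n) \<xi> l * remainder n (\<lambda>z. 1 / (z - \<xi>) ^ (s - l)) z))"
      proof (rule sum.cong[OF refl])
        fix \<xi> assume \<xi>: "\<xi> \<in> PS"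
        have "remainder n (\<lambda>z. \<Sum>s=1..N \<xi>. c \<xi> s * (poly (q n) z / (z - \<xi>) ^ s)) z
            = (\<Sum>s=1..N \<xi>. remainder n (\<lambda>z. c \<xi> s * (poly (q n) z / (z - \<xi>) ^ s)) z)"
          by (rule remainder_sum) (intro continuous_on_mult_left cp \<xi>)
        also have "\<dots> = (\<Sum>s=1..N \<xi>. c \<xi> s * (\<Sum>l<s. tcoeff (q n) \<xi> l * remainder n (\<lambda>z. 1 / (z - \<xi>) ^ (s - l)) z))"
        proof (rule sum.cong[OF refl])
          fix s
          have "z \<noteq> \<xi>" using KD[OF z] \<xi> by blast
          then show "remainder n (\<lambda>z. c \<xi> s * (poly (q n) z / (z - \<xi>) ^ s)) z
            = c \<xi> s * (\<Sum>l<s. tcoeff (q n) \<xi> l * remainder n (\<lambda>z. 1 / (z - \<xi>) ^ (s - l)) z)"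
            unfolding remainder_cmult using remainder_poly_pole[OF qdeg elim PSE[OF \<xi>]] by simp
        qed
        finally show "remainder n (\<lambda>z. \<Sum>s=1..N \<xi>. c \<xi> s * (poly (q n) z / (z - \<xi>) ^ s)) z
            = (\<Sum>s=1..N \<xi>. c \<xi> s * (\<Sum>l<s. tcoeff (q n) \<xi> l * remainder n (\<lambda>z. 1 / (z - \<xi>) ^ (s - l)) z))" .
      qed
      also have "remainder n (\<lambda>z. poly (q n) z * h z) z = (\<Sum>a\<le>M. coeff (q n) a * remainder n (\<lambda>z. z ^ a * h z) z)"
        by (rule remainder_poly_mult[OF qdeg ch])
      finally have eq: "poly (Q n) z * g z - poly (P n) z = (\<Sum>a\<le>M. coeff (q n) a * remainder n (\<lambda>z. z ^ a * h z) z) +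
          (\<Sum>\<xi>\<in>PS. \<Sum>s=1..N \<xi>. c \<xi> s * (\<Sum>l<s. tcoeff (q n) \<xi> l * remainder n (\<lambda>z. 1 / (z - \<xi>) ^ (s - l)) z))" .
      show "norm (poly (Q n) z * g z - poly (P n) z) \<le> B n"
        unfolding eq B_def
      proof (intro order_trans[OF norm_triangle_ineq] add_mono sum_norm_le)
        fix a
        show "norm (coeff (q n) a * remainder n (\<lambda>z. z ^ a * h z) z) \<le> norm (coeff (q n) a) * (C1 a * (x / r) ^ n)"
          unfolding norm_mult using C1 z K(3) by (intro mult_left_mono) auto
      next
        fix \<xi> s assume \<xi>: "\<xi> \<in> PS" "s \<in> {1..N \<xi>}"
        have "norm (\<Sum>l<s. tcoeff (q n) \<xi> l * remainder n (\<lambda>z. 1 / (z - \<xi>) ^ (s - l)) z)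
            \<le> (\<Sum>l<s. norm (tcoeff (q n) \<xi> l) * (C2 \<xi> (s - l) * (x' / norm (\<Phi> \<xi>)) ^ n))"
        proof (rule sum_norm_le)
          fix l
          show "norm (tcoeff (q n) \<xi> l * remainder n (\<lambda>z. 1 / (z - \<xi>) ^ (s - l)) z)
            \<le> norm (tcoeff (q n) \<xi> l) * (C2 \<xi> (s - l) * (x' / norm (\<Phi> \<xi>)) ^ n)"
            unfolding norm_mult by (intro mult_left_mono C2[OF \<xi>(1) z]) auto
        qed
        then show "norm (c \<xi> s * (\<Sum>l<s. tcoeff (q n) \<xi> l * remainder n (\<lambda>z. 1 / (z - \<xi>) ^ (s - l)) z))
            \<le> norm (c \<xi> s) * (\<Sum>l<s. norm (tcoeff (q n) \<xi> l) * (C2 \<xi> (s - l) * (x' / norm (\<Phi> \<xi>)) ^ n))"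
          unfolding norm_mult by (intro mult_left_mono) auto
      qed
    qed
  qed
  ultimately show ?thesis unfolding g_def by blast
qed

text \<open>The denominators converge to \<open>Q\<^sub>F\<close> coefficientwise, hence uniformly
  on the bounded set K, where \<open>Q\<^sub>F\<close> has no zero.\<close>

lemma denominator_lower_bound:
  assumes Q: "\<And>n. 1 \<le> n \<Longrightarrow> HP_denominator \<mu> p d F m n (Q n)" and K: "compact K" "K \<inter> S = {}"
  shows "\<exists>\<delta>>0. \<forall>\<^sub>F n in sequentially. \<forall>z\<in>K. \<delta> \<le> norm (poly (Q n) z)"
proof (cases "K = {}")
  case True
  then show ?thesis by (intro exI[of _ 1]) auto
next
  case False
  have "continuous_on K (\<lambda>z. norm (poly Q\<^sub>F z))" by (intro continuous_intros)
  then obtain w where w: "w \<in> K" "\<And>z. z \<in> K \<Longrightarrow> norm (poly Q\<^sub>F w) \<le> norm (poly Q\<^sub>F z)"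
    using continuous_attains_inf[OF K(1) False] by blast
  define \<delta> where "\<delta> = norm (poly Q\<^sub>F w)"
  have \<delta>: "0 < \<delta>" using w(1) K(2) poly_system_poly_eq_0_iff[of w] by (auto simp: \<delta>_def)
  obtain b where b: "b > 0" "\<And>z. z \<in> K \<Longrightarrow> norm z \<le> b" using compact_imp_bounded[OF K(1)] bounded_pos by metis
  obtain y where y: "\<Theta> < ereal y" "y < 1" using Theta_bounds(2) ereal_dense2[of \<Theta> 1] by auto
  have y0: "0 < y" using Theta_bounds(1) y(1) by (metis le_less_trans zero_ereal_def less_ereal.simps(1))
  have "(\<lambda>n. norm (coeff (Q n - Q\<^sub>F) j)) \<longlonglongrightarrow> 0" for j
    using rate_le_tendsto_zero[OF denominator_coeff_rate[OF Q y(1)] less_imp_le[OF y0] y(2)] by (rule tendsto_norm_zero)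
  then have "(\<lambda>n. \<Sum>j\<le>M. norm (coeff (Q n - Q\<^sub>F) j) * b ^ j) \<longlonglongrightarrow> (\<Sum>j\<le>M. 0 * b ^ j)"
    by (intro tendsto_intros)
  then have "(\<lambda>n. \<Sum>j\<le>M. norm (coeff (Q n - Q\<^sub>F) j) * b ^ j) \<longlonglongrightarrow> 0" by simp
  then have "\<forall>\<^sub>F n in sequentially. (\<Sum>j\<le>M. norm (coeff (Q n - Q\<^sub>F) j) * b ^ j) < \<delta> / 2"
    by (rule order_tendstoD) (use \<delta> in simp)
  then have "\<forall>\<^sub>F n in sequentially. \<forall>z\<in>K. \<delta> / 2 \<le> norm (poly (Q n) z)"
    using eventually_ge_at_top[of 1]
  proof eventually_elim
    case (elim n)
    have "degree (Q n) \<le> M" using Q[OF elim(2)] unfolding HP_denominator_def by blast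
    then have deg: "degree (Q n - Q\<^sub>F) \<le> M" using degree_system_poly by (intro degree_diff_le) auto
    show ?case
    proof
      fix z assume z: "z \<in> K"
      have "poly (Q n - Q\<^sub>F) z = (\<Sum>j\<le>M. coeff (Q n - Q\<^sub>F) j * z ^ j)"
        unfolding poly_altdef by (rule sum.mono_neutral_left) (use deg in \<open>auto simp: coeff_eq_0 simp del: coeff_diff\<close>)
      also have "norm \<dots> \<le> (\<Sum>j\<le>M. norm (coeff (Q n - Q\<^sub>F) j) * b ^ j)"
        unfolding norm_mult norm_power using b z
        by (intro sum_norm_le) (simp add: norm_mult norm_power mult_left_mono power_mono del: coeff_diff)
      finally have "norm (poly (Q n - Q\<^sub>F) z) < \<delta> / 2" using elim(1) by linarith
      moreover have "norm (poly Q\<^sub>F z) \<le> norm (poly (Q n) z) + norm (poly (Q n - Q\<^sub>F) z)"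
        using norm_triangle_ineq4[of "poly (Q n) z" "poly (Q n - Q\<^sub>F) z"] by simp
      moreover have "\<delta> \<le> norm (poly Q\<^sub>F z)" unfolding \<delta>_def by (rule w(2)[OF z])
      ultimately show "\<delta> / 2 \<le> norm (poly (Q n) z)" by linarith
    qed
  qed
  then show ?thesis using \<delta> by (intro exI[of _ "\<delta> / 2"]) auto
qed

text \<open>Division by \<open>Q n\<close>, bounded below on K, keeps the rate of the numerator
  error. That rate x' / r comes as close to the right-hand side as desired, with x' near
  \<open>Phi_norm\<close> and r near the index, or r large if the index is infinite.\<close>

lemma approximant_limsup_le:
  assumes Q: "\<And>n. 1 \<le> n \<Longrightarrow> HP_denominator \<mu> p d F m n (Q n)"
    and P: "\<And>n. 1 \<le> n \<Longrightarrow> HP_numerator \<mu> p (F i) n (Q n) k (P n)" and i: "i \<in> {1..d}"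
    and K: "compact K" "K \<subseteq> dom_star E \<Phi> d F m i k - S"
  shows "limsup (\<lambda>n. ereal_root n (sup_norm K (\<lambda>z. poly (P n) z / poly (Q n) z - ext_comp E \<Phi> d F m i k z)))
       \<le> Phi_norm E \<Phi> K / rho_star E \<Phi> d F m i k"
proof (rule dense_ge)
  define \<rho>s where "\<rho>s = rho_star E \<Phi> d F m i k"
  define g where "g = ext_comp E \<Phi> d F m i k"
  have \<rho>s1: "1 < \<rho>s" unfolding \<rho>s_def by (rule rho_star_properties[OF i])
  have KS: "K \<inter> S = {}" "K \<subseteq> D \<rho>s" using K(2) by (auto simp: dom_star_def \<rho>s_def)
  obtain x0 where x0: "x0 > 1" "ereal x0 < \<rho>s" "K \<subseteq> D (ereal x0)" using compact_subset_D[OF \<rho>s1 K(1) KS(2)] by blast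
  have X1: "1 \<le> Phi_norm E \<Phi> K"
  proof (cases "K \<subseteq> E")
    case False
    then obtain z where z: "z \<in> K - E" by blast
    have "1 \<le> ereal (norm (\<Phi> z))" using Phi_gt_1[of z] z by simp
    also have "\<dots> \<le> (SUP z\<in>K - E. ereal (norm (\<Phi> z)))" using z by (rule SUP_upper)
    finally show ?thesis using False by (simp add: Phi_norm_def)
  qed (simp add: Phi_norm_def)
  have X2: "Phi_norm E \<Phi> K \<le> ereal x0"
  proof (cases "K \<subseteq> E")
    case False
    have "(SUP z\<in>K - E. ereal (norm (\<Phi> z))) \<le> ereal x0"
      by (rule SUP_least) (use x0(3) in \<open>auto simp: canon_dom_def less_imp_le\<close>)
    then show ?thesis using False by (simp add: Phi_norm_def)
  qed (use x0 in \<open>simp add: Phi_norm_def\<close>)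
  obtain X' where X': "Phi_norm E \<Phi> K = ereal X'" using X1 X2 by (cases "Phi_norm E \<Phi> K") auto
  have X'1: "1 \<le> X'" "ereal X' < \<rho>s" using X1 X' le_less_trans[OF X2[unfolded X'] x0(2)] by auto
  have KX: "K \<subseteq> D (ereal x)" if "X' < x" for x
  proof
    fix z assume z: "z \<in> K"
    show "z \<in> D (ereal x)"
    proof (cases "z \<in> E")
      case False
      then have "ereal (norm (\<Phi> z)) \<le> (SUP z\<in>K - E. ereal (norm (\<Phi> z)))" using z by (intro SUP_upper) auto
      also have "\<dots> = ereal X'"
      proof -
        have "\<not> K \<subseteq> E" using False z by blast
        then show ?thesis using X' by (simp add: Phi_norm_def)
      qed
      finally show ?thesis using that False by (simp add: canon_dom_def)
    qed (use E_subset_D in blast)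
  qed
  fix e assume "Phi_norm E \<Phi> K / rho_star E \<Phi> d F m i k < e"
  then have "ereal X' / \<rho>s < e" by (simp add: X' \<rho>s_def)
  then obtain e' where e': "ereal X' / \<rho>s < ereal e'" "ereal e' < e" using ereal_dense2 by blast
  have "\<exists>x x' r. X' < x \<and> x < x' \<and> x' < r \<and> ereal r < \<rho>s \<and> x' / r \<le> e'"
  proof (cases \<rho>s)
    case (real b)
    have b: "X' < b" "1 < b" using X'1 \<rho>s1 real by auto
    have "X' / b < e'" using e'(1) real X'1 b by simp
    then have lt: "X' < e' * b" using b by (simp add: divide_less_eq)
    then have e0: "0 < e'" using X'1 b by (smt (verit) mult_nonpos_nonneg)
    obtain x' where x': "X' < x'" "x' < min b (e' * b)" using lt b dense[of X' "min b (e' * b)"] by auto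
    obtain x where x: "X' < x" "x < x'" using x'(1) dense by blast
    have "x' / e' < b" using x' e0 by (simp add: divide_less_eq mult.commute)
    then obtain r where r: "max x' (x' / e') < r" "r < b" using x' dense[of "max x' (x' / e')" b] by auto
    have "x' / r \<le> e'" using r e0 x' X'1 by (simp add: field_simps)
    then show ?thesis using x r real by (intro exI[of _ x] exI[of _ x'] exI[of _ r]) auto
  next
    case PInf
    then have e0: "0 < e'" using e'(1) X'1 by simp
    \<comment> \<open>An infinite index makes the bound 0, so any positive e' is reached by taking r
      large enough.\<close>
    define r where "r = max (X' + 3) ((X' + 2) / e')"
    have r: "X' + 2 < r" "(X' + 2) / e' \<le> r" by (auto simp: r_def)
    then have "(X' + 2) / r \<le> e'" using e0 X'1 by (simp add: field_simps)
    then show ?thesis using r PInf by (intro exI[of _ "X' + 1"] exI[of _ "X' + 2"] exI[of _ r]) auto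
  next
    case MInf then show ?thesis using \<rho>s1 by simp
  qed
  then obtain x x' r where x: "X' < x" "x < x'" "x' < r" "ereal r < \<rho>s" "x' / r \<le> e'" by blast
  have x1: "1 < x" using x X'1 by simp
  obtain B where B: "rate_le B (x' / r)"
    "\<forall>\<^sub>F n in sequentially. \<forall>z\<in>K. norm (poly (Q n) z * g z - poly (P n) z) \<le> B n"
    using numerator_error_rate[OF Q P i K(1) KS(1) KX[OF x(1)] x1 x(2,3)] x(4) unfolding \<rho>s_def g_def by blast
  obtain \<delta> where \<delta>: "\<delta> > 0" "\<forall>\<^sub>F n in sequentially. \<forall>z\<in>K. \<delta> \<le> norm (poly (Q n) z)"
    using denominator_lower_bound[OF Q K(1) KS(1)] by blast
  define B' where "B' n = (1 / \<delta>) * B n" for n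
  have xr: "0 \<le> x' / r" using x x1 by simp
  have "rate_le B' (x' / r)" unfolding B'_def
    by (rule rate_le_mult_bounded[of "\<lambda>_. 1 / \<delta>" "1 / \<delta>", OF _ B(1) xr]) (use \<delta>(1) in simp)
  then have lim: "limsup (\<lambda>n. ereal (root n (norm (B' n)))) \<le> ereal (x' / r)" using xr by (rule rate_le_limsup)
  have "\<forall>\<^sub>F n in sequentially. ereal_root n (sup_norm K (\<lambda>z. poly (P n) z / poly (Q n) z - g z)) \<le> ereal (root n (norm (B' n)))"
    using B(2) \<delta>(2) eventually_gt_at_top[of 0]
  proof eventually_elim
    case (elim n)
    have "sup_norm K (\<lambda>z. poly (P n) z / poly (Q n) z - g z) \<le> ereal (norm (B' n))"
      unfolding sup_norm_def
    proof (rule SUP_least)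
      fix z assume z: "z \<in> K"
      have q: "\<delta> \<le> norm (poly (Q n) z)" "poly (Q n) z \<noteq> 0" using elim(2) z \<delta>(1) by auto
      have b: "norm (poly (Q n) z * g z - poly (P n) z) \<le> B n" using elim(1) z by blast
      have "poly (P n) z / poly (Q n) z - g z = - ((poly (Q n) z * g z - poly (P n) z) / poly (Q n) z)"
        using q(2) by (simp add: field_simps)
      then have "norm (poly (P n) z / poly (Q n) z - g z) = norm (poly (Q n) z * g z - poly (P n) z) / norm (poly (Q n) z)"
        by (simp only: norm_minus_cancel norm_divide)
      also have "\<dots> \<le> B n / \<delta>" using b q(1) \<delta>(1) norm_ge_zero order_trans by (intro frac_le) blast+
      also have "\<dots> \<le> norm (B' n)" using \<delta>(1) by (simp add: B'_def divide_right_mono)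
      finally show "ereal (norm (poly (P n) z / poly (Q n) z - g z)) \<le> ereal (norm (B' n))" by simp
    qed
    then show ?case using elim(3) by (intro ereal_root_le) auto
  qed
  then have "limsup (\<lambda>n. ereal_root n (sup_norm K (\<lambda>z. poly (P n) z / poly (Q n) z - g z))) \<le> limsup (\<lambda>n. ereal (root n (norm (B' n))))"
    by (rule Limsup_mono)
  also note lim
  also have "ereal (x' / r) \<le> ereal e'" using x(5) by simp
  also have "\<dots> \<le> e" using e'(2) by simp
  finally show "limsup (\<lambda>n. ereal_root n (sup_norm K (\<lambda>z. poly (P n) z / poly (Q n) z - ext_comp E \<Phi> d F m i k z))) \<le> e"
    unfolding g_def .
qed

end

theorem theorem2p3:
  fixes E :: "complex set" and \<Phi> :: "complex \<Rightarrow> complex"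
    and \<mu> :: "complex measure" and p :: "nat \<Rightarrow> complex poly"
    and d :: nat and F :: "nat \<Rightarrow> complex \<Rightarrow> complex" and m :: "nat \<Rightarrow> nat"
    and Q :: "nat \<Rightarrow> complex poly" and P :: "nat \<Rightarrow> nat \<Rightarrow> nat \<Rightarrow> complex poly"
  assumes "infinite E" and "compact E"
    and "simply_connected (sphere 0 1 - stereo ` E)"
    and "exterior_map E \<Phi>"
    and "orthonormal_polys \<mu> p" and "Reg12 E \<Phi> p \<mu>"
    and "1 \<le> d"
    and "\<And>i. i \<in> {1..d} \<Longrightarrow> F i analytic_on E"
    and "\<And>i. i \<in> {1..d} \<Longrightarrow> 1 \<le> m i"
    and "finite (system_poles E \<Phi> d F m)"
    and "(\<Sum>\<xi>\<in>system_poles E \<Phi> d F m. system_order E \<Phi> d F m \<xi>) = multi_size d m"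
    and "\<And>n. 1 \<le> n \<Longrightarrow> HP_denominator \<mu> p d F m n (Q n)"
    and "\<And>n i k. 1 \<le> n \<Longrightarrow> i \<in> {1..d} \<Longrightarrow> k < m i \<Longrightarrow>
           HP_numerator \<mu> p (F i) n (Q n) k (P n k i)"
  shows "(\<forall>\<^sub>F n in sequentially. \<exists>!q. HP_denominator \<mu> p d F m n q) \<and>
    limsup (\<lambda>n. ereal (root n (coeff_norm (Q n - system_poly E \<Phi> d F m)))) =
      (MAX \<xi>\<in>system_poles E \<Phi> d F m. ereal (norm (\<Phi> \<xi>)) / brho E \<Phi> d F m \<xi>) \<and>
    (\<forall>i\<in>{1..d}. \<forall>k<m i. \<forall>K.
       compact K \<and> K \<subseteq> dom_star E \<Phi> d F m i k - system_poles E \<Phi> d F m \<longrightarrow>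
       limsup (\<lambda>n. ereal_root n
         (sup_norm K (\<lambda>z. poly (P n k i) z / poly (Q n) z - ext_comp E \<Phi> d F m i k z)))
       \<le> Phi_norm E \<Phi> K / rho_star E \<Phi> d F m i k)"
proof -
  interpret hermite_pade E \<Phi> \<mu> p d F m
    by unfold_locales (use assms in auto)
  note Q = assms(12)
  show ?thesis
  proof (intro conjI ballI allI impI)
    show "\<forall>\<^sub>F n in sequentially. \<exists>!q. HP_denominator \<mu> p d F m n q" by (rule unique_denominator[OF Q])
    show "limsup (\<lambda>n. ereal (root n (coeff_norm (Q n - system_poly E \<Phi> d F m)))) =
      (MAX \<xi>\<in>system_poles E \<Phi> d F m. ereal (norm (\<Phi> \<xi>)) / brho E \<Phi> d F m \<xi>)"
      using denominator_limsup_le[OF Q] denominator_limsup_ge[OF Q] unfolding \<Theta>_def by (rule order_antisym)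
    fix i k K
    assume ik: "i \<in> {1..d}" "k < m i" and K: "compact K \<and> K \<subseteq> dom_star E \<Phi> d F m i k - system_poles E \<Phi> d F m"
    show "limsup (\<lambda>n. ereal_root n
         (sup_norm K (\<lambda>z. poly (P n k i) z / poly (Q n) z - ext_comp E \<Phi> d F m i k z)))
       \<le> Phi_norm E \<Phi> K / rho_star E \<Phi> d F m i k"
    proof (rule approximant_limsup_le[OF Q _ ik(1)])
      show "HP_numerator \<mu> p (F i) n (Q n) k (P n k i)" if "1 \<le> n" for n using assms(13) that ik by blast
    qed (use K in auto)
  qed
qed

end
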